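(* Let $b\ge1$ and $0<\alpha<1$. In the infinite Poisson model, let $V_\alpha$ be a random variable which, conditionally on $X_0$, is uniform on $\{0,1,\dots,X_0\}$ and conditionally independent of $(X_j)_{j\ne0}$; let $Q_{-1}=\max_{j\le -1}\sum_{k=j+1}^{-1}(X_k-b)$, $C_\alpha=Q_{-1}+V_\alpha$ and $D_\alpha=\lfloor C_\alpha/b\rfloor$. Then their probability generating functions are $$\psi_V(q)=\frac{1-e^{b\alpha(q-1)}}{b\alpha(1-q)},\qquad \psi_C(q)=\frac{1-\alpha}{\alpha}\cdot\frac{1-e^{b\alpha(q-1)}}{e^{b\alpha(q-1)}-q^b}\cdot\frac{\prod_{\ell=1}^{b-1}(q-\zeta_\ell)}{\prod_{\ell=1}^{b-1}(1-\zeta_\ell)},$$ with $\psi_C(q)=\psi_Q(q)\psi_V(q)$ where $\psi_Q$ is the probability generating function of $Q_{-1}$, and $$\psi_D(q)=\frac1b\sum_{j=0}^{b-1}\psi_C\bigl(\omega^jq^{1/b}\bigr)\frac{1-q^{-1}}{1-\omega^{-j}q^{-1/b}}.$$ Moreover, as $m,n\to\infty$ with $n/(bm)\to\alpha$, $V_{m,n}\to V_\alpha$, $C_{m,n}\to C_\alpha$ and $D_{m,n}\to D_\alpha$ in distribution, with convergence of all moments; furthermore, for some $\delta>0$ the corresponding probability generating functions converge uniformly for $|q|\le1+\delta$.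
   Context: $T(z)=\sum_{n\ge1}n^{n-1}z^n/n!$ is the tree function; $\omega=e^{2\pi i/b}$; $\zeta_\ell=T(\omega^\ell\alpha e^{-\alpha})/\alpha$ for $\ell=0,\dots,b-1$ (so $\zeta_0=1$). In $\psi_D$, $q^{1/b}$ is a fixed $b$-th root (the sum does not depend on the choice). Infinite Poisson model: buckets $i\in\mathbb Z$ of capacity $b$, the numbers $X_i$ of keys with hash address $i$ are i.i.d. Poisson with mean $\alpha b$. Exact model quantities: hash addresses of $n$ labelled keys are independent and uniform on $m$ cyclically arranged buckets of capacity $b$; a key $\bullet$ is chosen uniformly at random; $V_{m,n}$ is the number of other keys with the same hash address as $\bullet$ and smaller label; $Q_{m,n}$ is the overflow into bucket $h(\bullet)$ from the parking problem (linear probing without wrap-around, capacity $b$) on the other $m-1$ buckets taken in cyclic order starting just after $h(\bullet)$ and using only keys hashing there; $C_{m,n}=Q_{m,n}+V_{m,n}$, $D_{m,n}=\lfloor C_{m,n}/b\rfloor$. (For $n\le bm$, $D_{m,n}$ is the Robin Hood linear probing displacement of a random key.) *)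

theory Defs
  imports "HOL-Probability.Probability"
begin

text \<open>The index is shifted by one: the series starts with the term $z$, and the natural
  number convention $0 - 1 = 0$ would produce a spurious constant term.\<close>

definition tree_fun :: "complex \<Rightarrow> complex" where
  "tree_fun z = (\<Sum>n. of_nat (Suc n) ^ n * z ^ Suc n / fact (Suc n))"

definition root_unity :: "nat \<Rightarrow> complex" where
  "root_unity b = exp (2 * of_real pi * \<i> / of_nat b)"

definition zeta_root :: "nat \<Rightarrow> real \<Rightarrow> nat \<Rightarrow> complex" where
  "zeta_root b \<alpha> l =
     tree_fun (root_unity b ^ l * of_real (\<alpha> * exp (- \<alpha>))) / of_real \<alpha>"

text \<open>\<open>pgf M Y q\<close> is meaningful only where \<open>pgf_converges M Y q\<close> holds (always the case
  for \<open>norm q \<le> 1\<close> and a measurable \<open>Y\<close>); elsewhere the integral is zero by convention.\<close>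

definition pgf :: "'a measure \<Rightarrow> ('a \<Rightarrow> nat) \<Rightarrow> complex \<Rightarrow> complex" where
  "pgf M Y q = (\<integral>x. q ^ Y x \<partial>M)"

definition pgf_converges :: "'a measure \<Rightarrow> ('a \<Rightarrow> nat) \<Rightarrow> complex \<Rightarrow> bool" where
  "pgf_converges M Y q \<longleftrightarrow> integrable M (\<lambda>x. q ^ Y x)"

text \<open>In the next three definitions, the \<open>k\<close>-th variable \<open>Y k\<close> lives on its own
  probability space \<open>N k\<close>.\<close>

definition conv_in_distribution ::
  "(nat \<Rightarrow> 'b measure) \<Rightarrow> (nat \<Rightarrow> 'b \<Rightarrow> nat) \<Rightarrow> 'a measure \<Rightarrow> ('a \<Rightarrow> nat) \<Rightarrow> bool" where
  "conv_in_distribution N Y M Z \<longleftrightarrow>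
     weak_conv_m (\<lambda>k. distr (N k) borel (\<lambda>w. real (Y k w))) (distr M borel (\<lambda>x. real (Z x)))"

definition conv_all_moments ::
  "(nat \<Rightarrow> 'b measure) \<Rightarrow> (nat \<Rightarrow> 'b \<Rightarrow> nat) \<Rightarrow> 'a measure \<Rightarrow> ('a \<Rightarrow> nat) \<Rightarrow> bool" where
  "conv_all_moments N Y M Z \<longleftrightarrow>
     (\<forall>r::nat. integrable M (\<lambda>x. real (Z x) ^ r) \<and>
        (\<lambda>k. \<integral>w. real (Y k w) ^ r \<partial>N k) \<longlonglongrightarrow> (\<integral>x. real (Z x) ^ r \<partial>M))"

definition conv_pgf_uniformly ::
  "real \<Rightarrow> (nat \<Rightarrow> 'b measure) \<Rightarrow> (nat \<Rightarrow> 'b \<Rightarrow> nat) \<Rightarrow> 'a measure \<Rightarrow> ('a \<Rightarrow> nat) \<Rightarrow> bool" where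
  "conv_pgf_uniformly \<delta> N Y M Z \<longleftrightarrow>
     (\<forall>q\<in>cball 0 (1 + \<delta>). pgf_converges M Z q) \<and>
     uniform_limit (cball 0 (1 + \<delta>)) (\<lambda>k. pgf (N k) (Y k)) (pgf M Z) sequentially"

definition iid_poisson :: "'a measure \<Rightarrow> real \<Rightarrow> (int \<Rightarrow> 'a \<Rightarrow> nat) \<Rightarrow> bool" where
  "iid_poisson M \<mu> X \<longleftrightarrow> prob_space M \<and>
     prob_space.indep_vars M (\<lambda>_. count_space UNIV) X UNIV \<and>
     (\<forall>i. distr M (count_space UNIV) (X i) = measure_pmf (poisson_pmf \<mu>))"

text \<open>Elementary conditional probabilities suffice, since \<open>X 0\<close> is discrete and takes each
  value with positive probability. The second conjunct says that \<open>V\<close> is uniform on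
  \<open>{0..X 0}\<close> given \<open>X 0\<close>, the third that \<open>V\<close> and \<open>(X j)\<close> for \<open>j \<noteq> 0\<close> are independent
  given \<open>X 0\<close>.\<close>

definition cond_uniform_rank :: "'a measure \<Rightarrow> (int \<Rightarrow> 'a \<Rightarrow> nat) \<Rightarrow> ('a \<Rightarrow> nat) \<Rightarrow> bool" where
  "cond_uniform_rank M X V \<longleftrightarrow>
     V \<in> measurable M (count_space UNIV) \<and>
     (\<forall>k v. \<P>(x in M. V x = v \<bar> X 0 x = k) = (if v \<le> k then 1 / (real k + 1) else 0)) \<and>
     (\<forall>k v. \<forall>B \<in> sets (PiM (- {0}) (\<lambda>_. count_space UNIV)).
        \<P>(x in M. V x = v \<and> (\<lambda>j\<in>- {0}. X j x) \<in> B \<bar> X 0 x = k) =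
        \<P>(x in M. V x = v \<bar> X 0 x = k) *
        \<P>(x in M. (\<lambda>j\<in>- {0}. X j x) \<in> B \<bar> X 0 x = k))"

definition excess :: "nat \<Rightarrow> (int \<Rightarrow> 'a \<Rightarrow> nat) \<Rightarrow> 'a \<Rightarrow> int \<Rightarrow> int" where
  "excess b X x j = (\<Sum>k\<in>{j+1..-1}. (int (X k x) - int b))"

text \<open>The set contains $0$ (take $j = -1$), so \<open>nat\<close> does not truncate. \<open>Sup\<close> is the
  maximum whenever the maximum exists, and an unspecified constant otherwise.\<close>

definition Q_inf :: "nat \<Rightarrow> (int \<Rightarrow> 'a \<Rightarrow> nat) \<Rightarrow> 'a \<Rightarrow> nat" where
  "Q_inf b X x = nat (Sup (excess b X x ` {..-1}))"

definition C_inf :: "nat \<Rightarrow> (int \<Rightarrow> 'a \<Rightarrow> nat) \<Rightarrow> ('a \<Rightarrow> nat) \<Rightarrow> 'a \<Rightarrow> nat" where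
  "C_inf b X V x = Q_inf b X x + V x"

definition D_inf :: "nat \<Rightarrow> (int \<Rightarrow> 'a \<Rightarrow> nat) \<Rightarrow> ('a \<Rightarrow> nat) \<Rightarrow> 'a \<Rightarrow> nat" where
  "D_inf b X V x = C_inf b X V x div b"

text \<open>Parking on buckets \<open>1, \<dots>, N\<close> of capacity \<open>b\<close> without wrap-around. A state consists of
  the occupancies of the buckets and the number of keys that have overflowed past bucket \<open>N\<close>.
  An arriving key with address \<open>a\<close> goes to the first non-full bucket at or after \<open>a\<close>.\<close>

definition park_step :: "nat \<Rightarrow> nat \<Rightarrow> nat \<Rightarrow> (nat \<Rightarrow> nat) \<times> nat \<Rightarrow> (nat \<Rightarrow> nat) \<times> nat" where
  "park_step b N a s =
     (let c = fst s; S = {i \<in> {a..N}. c i < b}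
      in if S = {} then (c, Suc (snd s)) else (c(Min S := Suc (c (Min S))), snd s))"

definition parking_overflow :: "nat \<Rightarrow> nat \<Rightarrow> nat list \<Rightarrow> nat" where
  "parking_overflow b N as = snd (fold (park_step b N) as (\<lambda>_. 0, 0))"

text \<open>Keys are labelled \<open>0, \<dots>, n - 1\<close> and buckets \<open>0, \<dots>, m - 1\<close>. An outcome is a pair of a
  hash function and the chosen key; the uniform distribution on these pairs makes the hash
  addresses and the chosen key independent and uniform.\<close>

definition hash_model :: "nat \<Rightarrow> nat \<Rightarrow> ((nat \<Rightarrow> nat) \<times> nat) measure" where
  "hash_model m n = measure_pmf (pmf_of_set (({..<n} \<rightarrow>\<^sub>E {..<m}) \<times> {..<n}))"

definition V_exact :: "(nat \<Rightarrow> nat) \<times> nat \<Rightarrow> nat" where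
  "V_exact w = (case w of (h, c) \<Rightarrow> card {i. i < c \<and> h i = h c})"

text \<open>\<open>(h i + m - h c) mod m\<close> is the cyclic distance from the bucket of the chosen key \<open>c\<close> to
  that of key \<open>i\<close>: it is $0$ for the same bucket, and it numbers the other buckets
  \<open>1, \<dots>, m - 1\<close> in cyclic order starting just after \<open>h c\<close>.\<close>

definition Q_exact :: "nat \<Rightarrow> nat \<Rightarrow> nat \<Rightarrow> (nat \<Rightarrow> nat) \<times> nat \<Rightarrow> nat" where
  "Q_exact b m n w = (case w of (h, c) \<Rightarrow>
     parking_overflow b (m - 1)
       (filter (\<lambda>a. a \<noteq> 0) (map (\<lambda>i. (h i + m - h c) mod m) [0..<n])))"

definition C_exact :: "nat \<Rightarrow> nat \<Rightarrow> nat \<Rightarrow> (nat \<Rightarrow> nat) \<times> nat \<Rightarrow> nat" where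
  "C_exact b m n w = Q_exact b m n w + V_exact w"

definition D_exact :: "nat \<Rightarrow> nat \<Rightarrow> nat \<Rightarrow> (nat \<Rightarrow> nat) \<times> nat \<Rightarrow> nat" where
  "D_exact b m n w = C_exact b m n w div b"

end

theory Submission
  imports Defs "HOL-Real_Asymp.Real_Asymp"
begin

text \<open>Read backwards from the observed bucket, both models give the overflow as
  \<open>max\<^sub>j \<Sum>\<^sub>i\<^sub><\<^sub>j (y\<^sub>i - b)\<close> of the bucket counts \<open>y\<close>, and this maximum obeys Lindley's recursion. For
  independent Poisson counts the law of the limit is therefore a fixed point of
  \<open>Q \<mapsto> max (X + Q - b) 0\<close>, so \<open>\<psi>\<^sub>Q(q) (q\<^sup>b - e\<^bsup>b\<alpha>(q-1)\<^esup>)\<close> is a polynomial of degree \<open>b\<close> in \<open>q\<close>. It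
  vanishes at \<open>1\<close> and at the points \<open>\<zeta>\<^sub>l\<close>, which lie in the closed unit disc and solve
  \<open>\<zeta>\<^sup>b = e\<^bsup>b\<alpha>(\<zeta>-1)\<^esup>\<close> because the tree function satisfies \<open>T(z) = z e\<^bsup>T(z)\<^esup>\<close>; its leading coefficient
  follows from \<open>\<psi>\<^sub>Q(1) = 1\<close>.

  For the exact model, the law of \<open>(V, Q)\<close> is expressed through the bucket counts of a uniformly
  random hash function. Removing one bucket at a time, any finite number of these counts converges
  to independent Poisson variables, and \<open>E r\<^bsup>V+Q\<^esup>\<close> is bounded for some \<open>r > 1\<close> by a union bound over
  \<open>j\<close>. Pointwise convergence with a bounded exponential moment gives convergence of all expectations,
  uniformly over functions of smaller exponential growth.\<close>

section \<open>Lindley recursion and parking\<close>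

text \<open>In the exact model two limits happen at once: the bucket counts become Poisson and the
  depth \<open>m - 1\<close> of the recursion grows. A truncation at fixed depth, with an error
  geometric in that depth and uniform in the table size, separates them. All geometric series come
  from one radius r > 1 with exp((r - 1) \<mu>) < r^b, where \<mu> = b \<alpha> is the mean bucket
  count: the capacity beats the exponential moment of one bucket. Such r exists because \<alpha> <
  1, and it yields \<delta> = (r - 1)/2.

  The limit law of the overflow is not constructed combinatorially; it is read off the infinite
  model, where the maximum is almost surely attained.

  The uniform rank on {0..X_0} is the limit of a size bias. A random key falls into a bucket of N
  keys with probability proportional to N and has a uniform rank below N, so rank v has probability
  (m/n) P(N > v). For Poisson X, P(X > v)/\<mu> is the law of a uniform rank in {0..X}.

  The equation T = z exp(T) comes from Abel's binomial identity through a differential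
  equation.\<close>

primrec lindley :: "nat \<Rightarrow> nat \<Rightarrow> (nat \<Rightarrow> nat) \<Rightarrow> nat" where
  "lindley b 0 y = 0"
| "lindley b (Suc K) y = y 0 + lindley b K (\<lambda>i. y (Suc i)) - b"

text \<open>The definition peels off index 0, the bucket nearest to the observed one. Here the
  recursion is extended at the far end, which exposes the maximum over depths and gives monotonicity
  in the depth.\<close>

lemma lindley_Suc_max:
  "lindley b (Suc K) y = max (lindley b K y) ((\<Sum>i<Suc K. y i) - b * Suc K)"
proof (induction K arbitrary: y)
  case 0
  show ?case by simp
next
  case (Suc K)
  define S where "S = (\<Sum>i<Suc K. y (Suc i))"
  have S: "(\<Sum>i<Suc (Suc K). y i) = y 0 + S"
    unfolding S_def by (subst sum.lessThan_Suc_shift) simp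
  have "lindley b (Suc (Suc K)) y = y 0 + max (lindley b K (\<lambda>i. y (Suc i))) (S - b * Suc K) - b"
    using Suc.IH[of "\<lambda>i. y (Suc i)"] unfolding S_def by (simp only: lindley.simps(2)[of b "Suc K"])
  also have "\<dots> = max (lindley b (Suc K) y) (y 0 + S - b * Suc (Suc K))"
  proof -
    \<comment> \<open>If S \<le> c, the truncated \<open>S - c\<close> is 0 and both sides reduce to
      \<open>x + l - d\<close>, so natural subtraction does no harm.\<close>
    have "x + max l (S - c) - d = max (x + l - d) (x + S - (c + d))" for x l c d :: nat
      by (cases "S \<le> c") (auto simp: max_def)
    then show ?thesis by (simp add: algebra_simps)
  qed
  finally show ?case
    by (simp only: S)
qed

lemma lindley_mono: "K \<le> L \<Longrightarrow> lindley b K y \<le> lindley b L y"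
  by (rule lift_Suc_mono_le) (auto simp only: lindley_Suc_max)

lemma lindley_cong: "(\<And>i. i < K \<Longrightarrow> y i = z i) \<Longrightarrow> lindley b K y = lindley b K z"
proof (induction K arbitrary: y z)
  case (Suc K)
  have "lindley b K (\<lambda>i. y (Suc i)) = lindley b K (\<lambda>i. z (Suc i))"
    using Suc.prems by (intro Suc.IH) simp
  then show ?case using Suc.prems[of 0] by simp
qed simp

lemma sum_int_diff_const: "(\<Sum>i<j. int (y i) - int b) = int (\<Sum>i<j. y i) - int (b * j)"
  by (simp add: sum_subtractf)

text \<open>One half of the maximum formula; \<open>lindley_attained\<close> is the other. The sums
  are integers because they may be negative.\<close>

lemma lindley_partial_sum_le:
  "j \<le> K \<Longrightarrow> (\<Sum>i<j. int (y i) - int b) \<le> int (lindley b K y)"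
proof (induction K)
  case (Suc K)
  show ?case
  proof (cases "j \<le> K")
    case True
    then show ?thesis using Suc.IH lindley_mono[of K "Suc K" b y] by fastforce
  next
    case False
    then have j: "j = Suc K" using Suc.prems by simp
    have "(\<Sum>i<j. int (y i) - int b) \<le> int ((\<Sum>i<j. y i) - b * j)"
      unfolding sum_int_diff_const by linarith
    also have "\<dots> \<le> int (lindley b (Suc K) y)"
      unfolding lindley_Suc_max j by simp
    finally show ?thesis .
  qed
qed simp

lemma lindley_attained:
  "\<exists>j\<le>K. int (lindley b K y) = (\<Sum>i<j. int (y i) - int b)"
proof (induction K)
  case (Suc K)
  show ?case
  proof (cases "lindley b (Suc K) y = lindley b K y")
    case True
    then show ?thesis using Suc.IH le_SucI by metis
  next
    case False
    then have "lindley b (Suc K) y = (\<Sum>i<Suc K. y i) - b * Suc K" "lindley b (Suc K) y > 0"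
      unfolding lindley_Suc_max by linarith+
    then have "int (lindley b (Suc K) y) = (\<Sum>i<Suc K. int (y i) - int b)"
      by (simp add: sum_subtractf algebra_simps)
    then show ?thesis by blast
  qed
qed simp

lemma power_lindley_le:
  fixes r :: real
  assumes "r \<ge> 1"
  shows "r ^ lindley b K y \<le> (\<Sum>j\<le>K. r ^ (\<Sum>i<j. y i) / r ^ (b * j))"
proof -
  obtain j where j: "j \<le> K" "int (lindley b K y) = (\<Sum>i<j. int (y i) - int b)"
    using lindley_attained by blast
  then have eq: "lindley b K y + b * j = (\<Sum>i<j. y i)"
    unfolding sum_int_diff_const by linarith
  have "r ^ lindley b K y = r ^ (\<Sum>i<j. y i) / r ^ (b * j)"
    using assms by (simp add: eq[symmetric] power_add)
  also have "\<dots> \<le> (\<Sum>j\<le>K. r ^ (\<Sum>i<j. y i) / r ^ (b * j))"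
    using j assms by (intro member_le_sum) auto
  finally show ?thesis .
qed

text \<open>A change between depths K and L needs a candidate j > K with nonnegative partial sum,
  and such a j contributes a term of at least 1. This is Markov's inequality before expectations are
  taken.\<close>

lemma lindley_neq_le:
  fixes r :: real
  assumes "r \<ge> 1" "K \<le> L"
  shows "of_bool (lindley b L y \<noteq> lindley b K y) \<le>
           (\<Sum>j\<in>{K<..L}. r ^ (\<Sum>i<j. y i) / r ^ (b * j))"
proof (cases "lindley b L y = lindley b K y")
  case True
  then show ?thesis using assms by (auto intro!: sum_nonneg)
next
  case False
  obtain j where j: "j \<le> L" "int (lindley b L y) = (\<Sum>i<j. int (y i) - int b)"
    using lindley_attained by blast
  \<comment> \<open>A maximiser j \<le> K would already count at depth K, and monotonicity would
    force equality.\<close>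
  have "j > K"
    using lindley_partial_sum_le[of j K y b] j False lindley_mono[OF assms(2), of b y]
    by (metis le_antisym linorder_not_le of_nat_le_iff)
  from j(2) have "(\<Sum>i<j. y i) \<ge> b * j"
    unfolding sum_int_diff_const by linarith
  then have "1 \<le> r ^ (\<Sum>i<j. y i) / r ^ (b * j)"
    using assms by (simp add: power_increasing)
  also have "\<dots> \<le> (\<Sum>j\<in>{K<..L}. r ^ (\<Sum>i<j. y i) / r ^ (b * j))"
    using j \<open>j > K\<close> assms by (intro member_le_sum) auto
  finally show ?thesis by simp
qed

text \<open>Since keys pass a bucket only when it is full, the net flow across the right end of bucket \<open>i\<close>
  can be positive only if bucket \<open>i\<close> is full; this makes the flow satisfy Lindley's recursion.\<close>

definition parking_flow :: "nat list \<Rightarrow> (nat \<Rightarrow> nat) \<Rightarrow> nat \<Rightarrow> int" where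
  "parking_flow as c i = int (\<Sum>k\<in>{1..i}. count_list as k) - int (\<Sum>k\<in>{1..i}. c k)"

definition parking_inv :: "nat \<Rightarrow> nat \<Rightarrow> nat list \<Rightarrow> (nat \<Rightarrow> nat) \<times> nat \<Rightarrow> bool" where
  "parking_inv b N as s \<longleftrightarrow> (\<forall>i. fst s i \<le> b) \<and> (\<forall>i\<le>N. parking_flow as (fst s) i \<ge> 0) \<and>
     (\<forall>i\<in>{1..N}. parking_flow as (fst s) i > 0 \<longrightarrow> fst s i = b) \<and> int (snd s) = parking_flow as (fst s) N"

lemma parking_inv_fold:
  assumes "set as \<subseteq> {1..N}"
  shows "parking_inv b N as (fold (park_step b N) as (\<lambda>_. 0, 0))"
  using assms
proof (induction as rule: rev_induct)
  case Nil
  then show ?case by (simp add: parking_inv_def parking_flow_def)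
next
  case (snoc a as)
  obtain c s where cs: "fold (park_step b N) as (\<lambda>_. 0, 0) = (c, s)" by fastforce
  define fl where "fl = parking_flow as c"
  have a: "1 \<le> a" "a \<le> N" using snoc.prems by auto
  have inv: "c i \<le> b" "i \<le> N \<Longrightarrow> fl i \<ge> 0" "i \<in> {1..N} \<Longrightarrow> fl i > 0 \<Longrightarrow> c i = b"
    "int s = fl N" for i
    using snoc.IH snoc.prems by (simp_all add: cs parking_inv_def fl_def)
  have cnt: "(\<Sum>k\<in>{1..i}. count_list (as @ [a]) k) = (\<Sum>k\<in>{1..i}. count_list as k) + (if a \<le> i then 1 else 0)" for i
  proof -
    have "count_list (as @ [a]) k = count_list as k + (if k = a then 1 else 0)" for k
      by simp
    then show ?thesis using a by (simp only: sum.distrib) (simp add: sum.delta)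
  qed
  define S where "S = {i \<in> {a..N}. c i < b}"
  have step: "fold (park_step b N) (as @ [a]) (\<lambda>_. 0, 0) =
     (if S = {} then (c, Suc s) else (c(Min S := Suc (c (Min S))), s))"
    using cs by (simp add: park_step_def Let_def S_def)
  show ?case
  proof (cases "S = {}")
    case True
    \<comment> \<open>No bucket from a to N is free: the key crosses the right end of each of them,
      and all are full, so positive flow still occurs only at full buckets.\<close>
    then have full: "c i = b" if "i \<in> {a..N}" for i
      using inv(1)[of i] that unfolding S_def by force
    define fl' where "fl' = parking_flow (as @ [a]) c"
    have fl': "fl' i = fl i + (if a \<le> i then 1 else 0)" for i
      unfolding fl'_def parking_flow_def cnt fl_def by simp
    have "fl' i \<ge> 0" if "i \<le> N" for i using inv(2)[OF that] fl'[of i] by simp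
    moreover have "c i = b" if i: "i \<in> {1..N}" "fl' i > 0" for i
    proof (cases "a \<le> i")
      case True then show ?thesis using full[of i] i(1) by simp
    next
      case False
      then show ?thesis using i fl'[of i] inv(3)[OF i(1)] by simp
    qed
    moreover have "int (Suc s) = fl' N" using inv(4) fl'[of N] a by simp
    moreover have "fold (park_step b N) (as @ [a]) (\<lambda>_. 0, 0) = (c, Suc s)"
      unfolding step using True by simp
    ultimately show ?thesis using inv(1) by (simp add: parking_inv_def fl'_def)
  next
    case False
    define t where "t = Min S"
    have "finite S" unfolding S_def by simp
    then have t: "t \<in> S" "\<And>i. i \<in> S \<Longrightarrow> t \<le> i" using False unfolding t_def by auto
    then have tN: "a \<le> t" "t \<le> N" "c t < b" unfolding S_def by auto
    \<comment> \<open>The key parks in t, so it crosses only the ends of buckets a, ..., t - 1, and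
      these are full by minimality of t.\<close>
    have full: "c i = b" if "a \<le> i" "i < t" for i
      using t(2)[of i] inv(1)[of i] that tN unfolding S_def by force
    define c' where "c' = c(t := Suc (c t))"
    have csum: "(\<Sum>k\<in>{1..i}. c' k) = (\<Sum>k\<in>{1..i}. c k) + (if t \<le> i then 1 else 0)" for i
    proof -
      have "c' k = c k + (if k = t then 1 else 0)" for k
        unfolding c'_def by simp
      then show ?thesis using a tN by (simp only: sum.distrib) (simp add: sum.delta)
    qed
    define fl' where "fl' = parking_flow (as @ [a]) c'"
    have fl': "fl' i = fl i + (if a \<le> i \<and> i < t then 1 else 0)" for i
      unfolding fl'_def parking_flow_def cnt csum fl_def using tN by simp
    have "c' i \<le> b" for i using inv(1)[of i] tN unfolding c'_def by auto
    moreover have "fl' i \<ge> 0" if "i \<le> N" for i using inv(2)[OF that] fl'[of i] by simp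
    moreover have "c' i = b" if i: "i \<in> {1..N}" "fl' i > 0" for i
    proof (cases "a \<le> i \<and> i < t")
      case True then show ?thesis using full[of i] unfolding c'_def by simp
    next
      case False
      then have "fl' i = fl i" using fl'[of i] by presburger
      then have "c i = b" using inv(3)[OF i(1)] i(2) by linarith
      moreover have "i \<noteq> t" using tN calculation by blast
      ultimately show ?thesis unfolding c'_def by simp
    qed
    moreover have "int s = fl' N" using inv(4) fl'[of N] tN by simp
    moreover have "fold (park_step b N) (as @ [a]) (\<lambda>_. 0, 0) = (c', s)"
      unfolding step c'_def t_def using False by simp
    ultimately show ?thesis by (simp add: parking_inv_def fl'_def)
  qed
qed

lemma parking_overflow_eq_lindley:
  assumes "set as \<subseteq> {1..N}"
  shows "parking_overflow b N as = lindley b N (\<lambda>i. count_list as (N - i))"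
proof -
  obtain c s where cs: "fold (park_step b N) as (\<lambda>_. 0, 0) = (c, s)" by fastforce
  define fl where "fl = parking_flow as c"
  have inv: "c i \<le> b" "i \<le> N \<Longrightarrow> fl i \<ge> 0" "i \<in> {1..N} \<Longrightarrow> fl i > 0 \<Longrightarrow> c i = b"
    "int s = fl N" for i
    using parking_inv_fold[OF assms, of b] by (simp_all add: cs parking_inv_def fl_def)
  \<comment> \<open>Strengthened to every prefix, read backwards from its last bucket. If the flow
    past bucket \<open>Suc i\<close> is positive, that bucket holds b keys; otherwise the flow is 0
    and the bucket holds at most b. Both cases amount to the truncated subtraction of b.\<close>
  have "i \<le> N \<Longrightarrow> int (lindley b i (\<lambda>k. count_list as (i - k))) = fl i" for i
  proof (induction i)
    case 0
    then show ?case by (simp add: fl_def parking_flow_def)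
  next
    case (Suc i)
    have "fl (Suc i) = fl i + int (count_list as (Suc i)) - int (c (Suc i))"
      unfolding fl_def parking_flow_def by simp
    moreover have "lindley b (Suc i) (\<lambda>k. count_list as (Suc i - k)) =
        count_list as (Suc i) + lindley b i (\<lambda>k. count_list as (i - k)) - b"
      by simp
    moreover have "int (lindley b i (\<lambda>k. count_list as (i - k))) = fl i"
      using Suc by simp
    moreover have "fl (Suc i) \<ge> 0" "fl (Suc i) > 0 \<Longrightarrow> c (Suc i) = b"
      using inv(2)[of "Suc i"] inv(3)[of "Suc i"] Suc.prems by simp_all
    ultimately show ?case
      using inv(1)[of "Suc i"] by (cases "fl (Suc i) > 0") linarith+
  qed
  from this[of N] show ?thesis
    unfolding parking_overflow_def cs using inv(4) by simp
qed

section \<open>Bucket counts of a random hash function\<close>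

text \<open>The total of g over the occupancy vectors of all m^n placements, built one key at a
  time. Induction on the number of keys then works without a changing function space.\<close>

primrec count_sum :: "nat \<Rightarrow> nat \<Rightarrow> ((nat \<Rightarrow> nat) \<Rightarrow> real) \<Rightarrow> real" where
  "count_sum 0 m g = g (\<lambda>_. 0)"
| "count_sum (Suc n) m g = (\<Sum>j<m. count_sum n m (\<lambda>y. g (y(j := Suc (y j)))))"

abbreviation bucket_counts :: "nat \<Rightarrow> (nat \<Rightarrow> nat) \<Rightarrow> nat \<Rightarrow> nat" where
  "bucket_counts n h j \<equiv> card {i \<in> {..<n}. h i = j}"

lemma count_sum_PiE:
  "(\<Sum>h\<in>{..<n} \<rightarrow>\<^sub>E {..<m}. g (bucket_counts n h)) = count_sum n m g"
proof (induction n arbitrary: g)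
  case 0
  show ?case by simp
next
  case (Suc n)
  have inj: "inj_on (\<lambda>(a, h). h(n := a)) ({..<m} \<times> ({..<n} \<rightarrow>\<^sub>E {..<m}))"
    using inj_combinator[of n "{..<n}" "\<lambda>_. {..<m}"] by simp
  have eq: "{..<Suc n} \<rightarrow>\<^sub>E {..<m} = (\<lambda>(a, h). h(n := a)) ` ({..<m} \<times> ({..<n} \<rightarrow>\<^sub>E {..<m}))"
    using PiE_insert_eq[of n "{..<n}" "\<lambda>_. {..<m}"] by (simp add: lessThan_Suc)
  have cnt: "bucket_counts (Suc n) (h(n := a)) = (bucket_counts n h)(a := Suc (bucket_counts n h a))" for h a
  proof
    fix j
    have "{i \<in> {..<Suc n}. (h(n := a)) i = j} = {i \<in> {..<n}. h i = j} \<union> (if j = a then {n} else {})"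
      by (auto simp: less_Suc_eq)
    then show "bucket_counts (Suc n) (h(n := a)) j = ((bucket_counts n h)(a := Suc (bucket_counts n h a))) j"
      by (auto simp: card_insert_if)
  qed
  have "(\<Sum>h\<in>{..<Suc n} \<rightarrow>\<^sub>E {..<m}. g (bucket_counts (Suc n) h)) =
      (\<Sum>(a, h)\<in>{..<m} \<times> ({..<n} \<rightarrow>\<^sub>E {..<m}). g (bucket_counts (Suc n) (h(n := a))))"
    unfolding eq by (subst sum.reindex[OF inj]) (simp add: case_prod_unfold)
  also have "\<dots> = (\<Sum>a<m. \<Sum>h\<in>{..<n} \<rightarrow>\<^sub>E {..<m}.
      g ((bucket_counts n h)(a := Suc (bucket_counts n h a))))"
    by (subst sum.cartesian_product[symmetric]) (simp only: cnt)
  also have "\<dots> = count_sum (Suc n) m g"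
    using Suc.IH[of "\<lambda>y. g (y(_ := Suc (y _)))"] by (simp add: Suc.IH[symmetric])
  finally show ?case .
qed

lemma count_sum_const: "count_sum n m (\<lambda>_. c) = c * real m ^ n"
  by (induction n) simp_all

lemma count_sum_mono: "(\<And>y. f y \<le> g y) \<Longrightarrow> count_sum n m f \<le> count_sum n m g"
  by (induction n arbitrary: f g) (auto intro!: sum_mono)

lemma count_sum_cmult: "count_sum n m (\<lambda>y. c * f y) = c * count_sum n m f"
  by (induction n arbitrary: f) (auto simp: sum_distrib_left)

lemma count_sum_sum: "count_sum n m (\<lambda>y. \<Sum>x\<in>A. f x y) = (\<Sum>x\<in>A. count_sum n m (f x))"
proof (induction n arbitrary: f)
  case (Suc n)
  then show ?case by (simp add: sum.swap[of _ "{..<m}" A])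
qed simp

lemma count_sum_diff: "count_sum n m (\<lambda>y. f y - g y) = count_sum n m f - count_sum n m g"
  by (induction n arbitrary: f g) (auto simp: sum_subtractf)

lemma case_nat_upd_0: "(case_nat u y)(0 := v) = case_nat v y"
  by (auto simp: fun_eq_iff split: nat.split)

lemma case_nat_upd_Suc: "(case_nat u y)(Suc j := v) = case_nat u (y(j := v))"
  by (auto simp: fun_eq_iff split: nat.split)

text \<open>Placements are sorted by the number u of keys in bucket 0: these can be selected in n
  choose u ways, and the rest fill the m other buckets, renumbered by \<open>case_nat\<close>. In
  the induction the new key goes to bucket 0 or elsewhere, and Pascal's rule merges the two
  sums.\<close>

lemma count_sum_peel:
  "count_sum n (Suc m) g = (\<Sum>u\<le>n. real (n choose u) * count_sum (n - u) m (\<lambda>y. g (case_nat u y)))"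
proof (induction n arbitrary: g)
  case 0
  have "case_nat 0 (\<lambda>_. 0) = (\<lambda>_. 0 :: nat)" by (auto simp: fun_eq_iff split: nat.split)
  then show ?case by simp
next
  case (Suc n)
  define A where "A u = count_sum (Suc n - u) m (\<lambda>y. g (case_nat u y))" for u
  have "count_sum (Suc n) (Suc m) g =
     (\<Sum>u\<le>n. real (n choose u) * count_sum (n - u) m (\<lambda>y. g (case_nat (Suc u) y))) +
     (\<Sum>j<m. \<Sum>u\<le>n. real (n choose u) * count_sum (n - u) m (\<lambda>y. g (case_nat u (y(j := Suc (y j))))))"
    by (simp only: count_sum.simps sum.lessThan_Suc_shift Suc.IH case_nat_upd_0 case_nat_upd_Suc nat.case)
  also have "(\<Sum>j<m. \<Sum>u\<le>n. real (n choose u) * count_sum (n - u) m (\<lambda>y. g (case_nat u (y(j := Suc (y j)))))) =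
     (\<Sum>u\<le>n. real (n choose u) * A u)"
    unfolding A_def by (subst sum.swap) (auto intro!: sum.cong simp: Suc_diff_le sum_distrib_left)
  also have "(\<Sum>u\<le>n. real (n choose u) * count_sum (n - u) m (\<lambda>y. g (case_nat (Suc u) y))) =
     (\<Sum>u\<le>n. real (n choose u) * A (Suc u))"
    unfolding A_def by simp
  \<comment> \<open>The added term u = \<open>Suc n\<close> vanishes because n choose
    \<open>Suc n\<close> is 0; afterwards both sums run over \<open>A (Suc u)\<close>.\<close>
  also have "(\<Sum>u\<le>n. real (n choose u) * A u) = A 0 + (\<Sum>u\<le>n. real (n choose Suc u) * A (Suc u))"
  proof -
    have "(\<Sum>u\<le>n. real (n choose u) * A u) = (\<Sum>u\<le>Suc n. real (n choose u) * A u)" by simp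
    also have "\<dots> = A 0 + (\<Sum>u\<le>n. real (n choose Suc u) * A (Suc u))"
      by (subst sum.atMost_Suc_shift) simp
    finally show ?thesis .
  qed
  also have "(\<Sum>u\<le>n. real (n choose u) * A (Suc u)) + (A 0 + (\<Sum>u\<le>n. real (n choose Suc u) * A (Suc u))) =
     A 0 + (\<Sum>u\<le>n. real (Suc n choose Suc u) * A (Suc u))"
    by (simp add: sum.distrib algebra_simps)
  also have "\<dots> = (\<Sum>u\<le>Suc n. real (Suc n choose u) * A u)"
    by (subst sum.atMost_Suc_shift) simp
  finally show ?case unfolding A_def .
qed

text \<open>Each key independently contributes r if it lands in I and 1 otherwise, so the sum
  factorises into n equal factors.\<close>

lemma count_sum_power:
  assumes "I \<subseteq> {..<m}"
  shows "count_sum n m (\<lambda>y. r ^ (\<Sum>i\<in>I. y i)) = (real m + real (card I) * (r - 1)) ^ n"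
proof (induction n)
  case 0
  show ?case by simp
next
  case (Suc n)
  have fin: "finite I" using assms finite_subset by blast
  have "(\<Sum>i\<in>I. (y(j := Suc (y j))) i) = (if j \<in> I then 1 else 0) + (\<Sum>i\<in>I. y i)" for y :: "nat \<Rightarrow> nat" and j
  proof -
    have "(y(j := Suc (y j))) i = (if i = j then 1 else 0) + y i" for i by simp
    then show ?thesis by (simp only: sum.distrib) (simp add: fin)
  qed
  then have "count_sum (Suc n) m (\<lambda>y. r ^ (\<Sum>i\<in>I. y i)) =
      (\<Sum>j<m. r ^ (if j \<in> I then 1 else 0) * (real m + real (card I) * (r - 1)) ^ n)"
    by (simp only: count_sum.simps power_add count_sum_cmult Suc.IH)
  also have "(\<Sum>j<m. r ^ (if j \<in> I then 1 else 0)) = real m + real (card I) * (r - 1)"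
  proof -
    have "(\<Sum>j<m. r ^ (if j \<in> I then 1 else 0)) = (\<Sum>j<m. 1 + (if j \<in> I then r - 1 else 0))"
      by (intro sum.cong) auto
    also have "\<dots> = real m + (\<Sum>j\<in>{..<m} \<inter> I. r - 1)"
      by (simp only: sum.distrib sum.inter_restrict[OF finite_lessThan]) simp
    also have "{..<m} \<inter> I = I" using assms by auto
    finally show ?thesis by simp
  qed
  then have "(\<Sum>j<m. r ^ (if j \<in> I then 1 else 0) * (real m + real (card I) * (r - 1)) ^ n) =
     (real m + real (card I) * (r - 1)) ^ Suc n"
    by (simp add: sum_distrib_right[symmetric])
  finally show ?case .
qed

section \<open>Expectations over a uniformly random hash function\<close>

definition occ_exp :: "nat \<Rightarrow> nat \<Rightarrow> ((nat \<Rightarrow> nat) \<Rightarrow> real) \<Rightarrow> real" where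
  "occ_exp m n g = count_sum n m g / real m ^ n"

lemma occ_exp_const: "m > 0 \<Longrightarrow> occ_exp m n (\<lambda>_. c) = c"
  by (simp add: occ_exp_def count_sum_const)

lemma occ_exp_mono: "(\<And>y. f y \<le> g y) \<Longrightarrow> occ_exp m n f \<le> occ_exp m n g"
  by (simp add: occ_exp_def count_sum_mono divide_right_mono)

lemma occ_exp_cmult: "occ_exp m n (\<lambda>y. c * f y) = c * occ_exp m n f"
  by (simp add: occ_exp_def count_sum_cmult)

lemma occ_exp_sum: "occ_exp m n (\<lambda>y. \<Sum>x\<in>A. f x y) = (\<Sum>x\<in>A. occ_exp m n (f x))"
  by (simp add: occ_exp_def count_sum_sum sum_divide_distrib)

lemma occ_exp_diff: "occ_exp m n (\<lambda>y. f y - g y) = occ_exp m n f - occ_exp m n g"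
  by (simp add: occ_exp_def count_sum_diff diff_divide_distrib)

lemma occ_exp_power_le:
  assumes "I \<subseteq> {..<m}" "r \<ge> 1"
  shows "occ_exp m n (\<lambda>y. r ^ (\<Sum>i\<in>I. y i)) \<le> exp (real (card I) * (r - 1) * (real n / real m))"
proof (cases "m = 0")
  \<comment> \<open>Then I is empty; for n > 0 division by zero makes the left-hand side 0, for n =
    0 it is 1.\<close>
  case True
  then show ?thesis using assms by (auto simp: occ_exp_def count_sum_const power_0_left)
next
  case False
  define x where "x = real (card I) * (r - 1) / real m"
  have x: "x \<ge> 0" using assms by (simp add: x_def)
  have "occ_exp m n (\<lambda>y. r ^ (\<Sum>i\<in>I. y i)) = ((real m + real (card I) * (r - 1)) / real m) ^ n"
    using assms by (simp add: occ_exp_def count_sum_power power_divide)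
  also have "\<dots> = (1 + x) ^ n" using False by (simp add: x_def field_simps)
  also have "\<dots> \<le> exp x ^ n" using x by (intro power_mono) auto
  also have "\<dots> = exp (real (card I) * (r - 1) * (real n / real m))"
    by (simp add: x_def exp_of_nat_mult[symmetric] field_simps)
  finally show ?thesis .
qed

definition binom_weight :: "nat \<Rightarrow> nat \<Rightarrow> nat \<Rightarrow> real" where
  "binom_weight m n u = real (n choose u) * (1 / real m) ^ u * (1 - 1 / real m) ^ (n - u)"

text \<open>Bucket 0 receives a Binomial(n, 1/m) number u of keys; given u, the other keys are
  hashed uniformly to m - 1 buckets. With m \<ge> 2 the normalising power of m - 1 is
  nonzero.\<close>

lemma occ_exp_peel:
  assumes "m \<ge> 2"
  shows "occ_exp m n g =
    (\<Sum>u\<le>n. binom_weight m n u * occ_exp (m - 1) (n - u) (\<lambda>y. g (case_nat u y)))"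
proof -
  obtain m' where m: "m = Suc m'" "m' > 0" using assms by (cases m) auto
  have "real (n choose u) * c / real m ^ n = binom_weight m n u * (c / real m' ^ (n - u))"
    if "u \<le> n" for u c
  proof -
    have "real m ^ n = real m ^ u * real m ^ (n - u)" using that by (simp flip: power_add)
    moreover have "1 - 1 / real m = real m' / real m" using m by (simp add: field_simps)
    ultimately show ?thesis using m unfolding binom_weight_def by (simp add: power_divide field_simps)
  qed
  then show ?thesis
    unfolding occ_exp_def m(1) count_sum_peel sum_divide_distrib
    by (intro sum.cong) (auto simp: m)
qed

definition occ_limit :: "real \<Rightarrow> (nat \<Rightarrow> nat) \<Rightarrow> (nat \<Rightarrow> nat) \<Rightarrow> bool" where
  "occ_limit \<mu> m n \<longleftrightarrow> filterlim m at_top sequentially \<and> filterlim n at_top sequentially \<and>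
     (\<lambda>k. real (n k) / real (m k)) \<longlonglongrightarrow> \<mu>"

lemma occ_limit_const_div:
  assumes "occ_limit \<mu> m n"
  shows "(\<lambda>k. c / real (m k)) \<longlonglongrightarrow> 0"
  using assms unfolding occ_limit_def
  by (intro real_tendsto_divide_at_top tendsto_const filterlim_compose[OF filterlim_real_sequentially]) auto

text \<open>The Poisson limit of Binomial(n, 1/m): the falling factorial over m^u tends to \<mu>^u,
  and the power of 1 - 1/m to exp(-\<mu>).\<close>

lemma binom_weight_limit:
  assumes lim: "occ_limit \<mu> m n"
  shows "(\<lambda>k. binom_weight (m k) (n k) u) \<longlonglongrightarrow> \<mu> ^ u / fact u * exp (- \<mu>)"
proof -
  have m: "filterlim m at_top sequentially" and n: "filterlim n at_top sequentially"
    and r: "(\<lambda>k. real (n k) / real (m k)) \<longlonglongrightarrow> \<mu>"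
    using lim unfolding occ_limit_def by auto
  note c = occ_limit_const_div[OF lim]
  have ratio: "(\<lambda>k. (real (n k) - real i) / real (m k)) \<longlonglongrightarrow> \<mu>" for i
    using tendsto_diff[OF r c[of "real i"]] by (simp add: diff_divide_distrib)
  have "(\<lambda>k. (\<Prod>i=0..<u. (real (n k) - real i) / real (m k)) / fact u) \<longlonglongrightarrow> (\<Prod>i=0..<u. \<mu>) / fact u"
    by (intro tendsto_intros ratio) auto
  moreover have "real (n choose u) * (1 / real m) ^ u = (\<Prod>i=0..<u. (real n - real i) / real m) / fact u" for n m
    by (simp add: binomial_gbinomial gbinomial_prod_rev prod_dividef power_divide)
  ultimately have A: "(\<lambda>k. real (n k choose u) * (1 / real (m k)) ^ u) \<longlonglongrightarrow> \<mu> ^ u / fact u"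
    by simp
  \<comment> \<open>The exponent of the second factor is split as ((n - u)/m) (m ln(1 - 1/m)); the
    two parts tend to \<mu> and -1.\<close>
  have "((\<lambda>x::real. x * ln (1 - 1 / x)) \<longlongrightarrow> -1) at_top"
    by real_asymp
  then have "(\<lambda>k. real (m k) * ln (1 - 1 / real (m k))) \<longlonglongrightarrow> -1"
    by (rule filterlim_compose) (rule filterlim_compose[OF filterlim_real_sequentially m])
  from tendsto_mult[OF ratio[of u] this]
  have "(\<lambda>k. exp ((real (n k) - real u) / real (m k) * (real (m k) * ln (1 - 1 / real (m k))))) \<longlonglongrightarrow> exp (\<mu> * -1)"
    by (rule tendsto_exp)
  moreover have "eventually (\<lambda>k. exp ((real (n k) - real u) / real (m k) * (real (m k) * ln (1 - 1 / real (m k)))) =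
      (1 - 1 / real (m k)) ^ (n k - u)) sequentially"
    using eventually_compose_filterlim[OF eventually_ge_at_top[of 2] m]
      eventually_compose_filterlim[OF eventually_ge_at_top[of u] n]
  proof eventually_elim
    case (elim k)
    have pos: "1 - 1 / real (m k) > 0" using elim by (simp add: field_simps)
    have "(1 - 1 / real (m k)) ^ (n k - u) = exp (real (n k - u) * ln (1 - 1 / real (m k)))"
      using pos by (simp add: exp_of_nat_mult)
    then show ?case using elim by (simp add: of_nat_diff)
  qed
  ultimately have "(\<lambda>k. (1 - 1 / real (m k)) ^ (n k - u)) \<longlonglongrightarrow> exp (- \<mu>)"
    by (simp add: tendsto_cong)
  from tendsto_mult[OF A this] show ?thesis
    unfolding binom_weight_def .
qed

text \<open>The limit regime survives the removal of a bucket with u keys, so peeling can be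
  iterated any fixed number of times.\<close>

lemma occ_limit_peel:
  assumes "occ_limit \<mu> m n"
  shows "occ_limit \<mu> (\<lambda>k. m k - 1) (\<lambda>k. n k - u)"
proof -
  have m: "filterlim m at_top sequentially" and n: "filterlim n at_top sequentially"
    and r: "(\<lambda>k. real (n k) / real (m k)) \<longlonglongrightarrow> \<mu>"
    using assms unfolding occ_limit_def by auto
  note c = occ_limit_const_div[OF assms]
  have "(\<lambda>k. (real (n k) / real (m k) - real u / real (m k)) / (1 - 1 / real (m k))) \<longlonglongrightarrow> (\<mu> - 0) / (1 - 0)"
    by (intro tendsto_intros r c) auto
  moreover have "eventually (\<lambda>k. (real (n k) / real (m k) - real u / real (m k)) / (1 - 1 / real (m k)) =
      real (n k - u) / real (m k - 1)) sequentially"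
    using eventually_compose_filterlim[OF eventually_ge_at_top[of 2] m]
      eventually_compose_filterlim[OF eventually_ge_at_top[of u] n]
    by eventually_elim (simp add: field_simps of_nat_diff)
  ultimately have "(\<lambda>k. real (n k - u) / real (m k - 1)) \<longlonglongrightarrow> \<mu>"
    by (simp add: tendsto_cong)
  moreover have "filterlim (\<lambda>k. f k - c) at_top sequentially"
    if "filterlim f at_top sequentially" for f :: "nat \<Rightarrow> nat" and c
    by (rule filterlim_compose[OF _ that]) (rule filterlim_minus_const_nat_at_top)
  ultimately show ?thesis using m n unfolding occ_limit_def by blast
qed

text \<open>The peeled sum runs over the growing range u \<le> n k. Confining the support of g to
  finitely many counts of bucket 0 makes it a fixed finite sum, for which termwise limits
  suffice.\<close>

lemma occ_exp_peel_limit: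
  assumes lim: "occ_limit \<mu> m n" and fin: "finite U"
    and G: "\<And>u. u \<in> U \<Longrightarrow> (\<lambda>k. occ_exp (m k - 1) (n k - u) (\<lambda>y. g (case_nat u y))) \<longlonglongrightarrow> G u"
    and zero: "\<And>u y. u \<notin> U \<Longrightarrow> g (case_nat u y) = 0"
  shows "(\<lambda>k. occ_exp (m k) (n k) g) \<longlonglongrightarrow> (\<Sum>u\<in>U. \<mu> ^ u / fact u * exp (- \<mu>) * G u)"
proof -
  have m: "filterlim m at_top sequentially" and n: "filterlim n at_top sequentially"
    using lim unfolding occ_limit_def by auto
  have "(\<lambda>k. \<Sum>u\<in>U. binom_weight (m k) (n k) u * occ_exp (m k - 1) (n k - u) (\<lambda>y. g (case_nat u y)))
      \<longlonglongrightarrow> (\<Sum>u\<in>U. \<mu> ^ u / fact u * exp (- \<mu>) * G u)"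
    by (intro tendsto_sum tendsto_mult binom_weight_limit[OF lim] G)
  moreover have "eventually (\<lambda>k. (\<Sum>u\<in>U. binom_weight (m k) (n k) u * occ_exp (m k - 1) (n k - u) (\<lambda>y. g (case_nat u y))) =
     occ_exp (m k) (n k) g) sequentially"
    using eventually_compose_filterlim[OF eventually_ge_at_top[of 2] m]
      eventually_compose_filterlim[OF eventually_ge_at_top[of "Max (insert 0 U)"] n]
  proof eventually_elim
    case (elim k)
    have "U \<subseteq> {..n k}" using elim(2) fin by auto
    moreover have "occ_exp m' n' (\<lambda>y. g (case_nat u y)) = 0" if "u \<notin> U" for u m' n'
      using zero[OF that] by (simp add: occ_exp_def count_sum_const)
    ultimately show ?case
      unfolding occ_exp_peel[OF elim(1)] by (intro sum.mono_neutral_left) auto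
  qed
  ultimately show ?thesis by (simp add: tendsto_cong)
qed

section \<open>Poisson limit of the overflow\<close>

definition queue_step :: "nat \<Rightarrow> real \<Rightarrow> nat pmf \<Rightarrow> nat pmf" where
  "queue_step b \<mu> q = map_pmf (\<lambda>(u, w). u + w - b) (pair_pmf (poisson_pmf \<mu>) q)"

primrec queue_pmf :: "nat \<Rightarrow> real \<Rightarrow> nat \<Rightarrow> nat pmf" where
  "queue_pmf b \<mu> 0 = return_pmf 0"
| "queue_pmf b \<mu> (Suc K) = queue_step b \<mu> (queue_pmf b \<mu> K)"

text \<open>The event u + w - b = k forces u, w \<le> k + b, also for k = 0, where truncation merges
  several totals. Being a finite sum, the right-hand side respects pointwise limits of q.\<close>

lemma pmf_queue_step:
  "pmf (queue_step b \<mu> q) k =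
     (\<Sum>u\<le>k + b. pmf (poisson_pmf \<mu>) u * (\<Sum>w\<in>{w. w \<le> k + b \<and> u + w - b = k}. pmf q w))"
proof -
  define S where "S u = {w. w \<le> k + b \<and> u + w - b = k}" for u
  have fin: "finite (S u)" for u unfolding S_def by simp
  have eq: "(\<lambda>(u, w). u + w - b) -` {k} = Sigma {..k + b} S"
    by (auto simp: S_def)
  have "pmf (queue_step b \<mu> q) k = measure (pair_pmf (poisson_pmf \<mu>) q) (Sigma {..k + b} S)"
    by (simp add: queue_step_def pmf_map eq)
  also have "\<dots> = (\<Sum>x\<in>Sigma {..k + b} S. pmf (pair_pmf (poisson_pmf \<mu>) q) x)"
    using fin by (intro measure_measure_pmf_finite) auto
  also have "\<dots> = (\<Sum>u\<le>k + b. \<Sum>w\<in>S u. pmf (poisson_pmf \<mu>) u * pmf q w)"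
    using fin by (subst sum.Sigma) (auto intro!: sum.cong simp: pmf_pair)
  finally show ?thesis by (simp add: sum_distrib_left S_def)
qed

text \<open>Induction on the depth with m and n arbitrary, since peeling changes both. The value w
  bounds the first count by w + b, which supplies the finite support.\<close>

lemma occ_lindley_limit:
  assumes "\<mu> > 0" "occ_limit \<mu> m n"
  shows "(\<lambda>k. occ_exp (m k) (n k) (\<lambda>y. of_bool (lindley b K y = w))) \<longlonglongrightarrow> pmf (queue_pmf b \<mu> K) w"
  using assms(2)
proof (induction K arbitrary: m n w)
  case 0
  have "eventually (\<lambda>k. occ_exp (m k) (n k) (\<lambda>y. of_bool (lindley b 0 y = w)) = pmf (queue_pmf b \<mu> 0) w) sequentially"
    using 0 eventually_compose_filterlim[OF eventually_ge_at_top[of 1], of m sequentially]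
    unfolding occ_limit_def
    by (auto elim!: eventually_mono simp: occ_exp_const pmf_return indicator_def)
  then show ?case by (rule tendsto_eventually)
next
  case (Suc K)
  define S where "S u = {l. l \<le> w + b \<and> u + l - b = w}" for u
  have fin: "finite (S u)" for u unfolding S_def by simp
  have eq: "of_bool (lindley b (Suc K) (case_nat u y) = w) = (\<Sum>l\<in>S u. of_bool (lindley b K y = l) :: real)" for u y
  proof (cases "lindley b K y \<in> S u")
    case True
    then show ?thesis using fin[of u]
      by (simp add: of_bool_def sum.delta) (simp add: S_def)
  next
    case False
    then show ?thesis by (auto simp: S_def intro!: sum.neutral[symmetric])
  qed
  have "(\<lambda>k. occ_exp (m k) (n k) (\<lambda>y. of_bool (lindley b (Suc K) y = w))) \<longlonglongrightarrow>
     (\<Sum>u\<in>{..w + b}. \<mu> ^ u / fact u * exp (- \<mu>) * (\<Sum>l\<in>S u. pmf (queue_pmf b \<mu> K) l))"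
  proof (rule occ_exp_peel_limit[OF Suc.prems])
    fix u
    show "(\<lambda>k. occ_exp (m k - 1) (n k - u) (\<lambda>y. of_bool (lindley b (Suc K) (case_nat u y) = w))) \<longlonglongrightarrow>
       (\<Sum>l\<in>S u. pmf (queue_pmf b \<mu> K) l)"
      unfolding eq occ_exp_sum by (intro tendsto_sum Suc.IH occ_limit_peel Suc.prems)
  next
    fix u y assume "u \<notin> {..w + b}"
    then have "S u = {}" by (auto simp: S_def)
    then show "of_bool (lindley b (Suc K) (case_nat u y) = w) = (0 :: real)" unfolding eq by simp
  qed simp
  then show ?case using assms(1) by (simp add: pmf_queue_step S_def)
qed

lemma occ_joint_limit:
  assumes "\<mu> > 0" "occ_limit \<mu> m n"
  shows "(\<lambda>k. occ_exp (m k) (n k) (\<lambda>y. of_bool (y 0 = u \<and> lindley b K (\<lambda>i. y (Suc i)) = w)))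
    \<longlonglongrightarrow> pmf (poisson_pmf \<mu>) u * pmf (queue_pmf b \<mu> K) w"
proof -
  have "(\<lambda>k. occ_exp (m k) (n k) (\<lambda>y. of_bool (y 0 = u \<and> lindley b K (\<lambda>i. y (Suc i)) = w)))
    \<longlonglongrightarrow> (\<Sum>u\<in>{u}. \<mu> ^ u / fact u * exp (- \<mu>) * pmf (queue_pmf b \<mu> K) w)"
    by (rule occ_exp_peel_limit[OF assms(2)])
       (use occ_lindley_limit[OF assms(1) occ_limit_peel[OF assms(2)]] in auto)
  then show ?thesis using assms(1) by simp
qed

section \<open>Exponential bounds and truncation of the depth, uniform in the table size\<close>

lemma sum_power_tail_le:
  fixes \<rho> :: real
  assumes "0 \<le> \<rho>" "\<rho> < 1"
  shows "(\<Sum>j\<in>{K<..L}. \<rho> ^ j) \<le> \<rho> ^ K / (1 - \<rho>)"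
proof -
  have "(\<Sum>j\<in>{K<..L}. \<rho> ^ j) \<le> (\<Sum>j. \<rho> ^ (j + K))"
  proof -
    have "(\<Sum>j\<in>{K<..L}. \<rho> ^ j) \<le> (\<Sum>j\<in>{K..<K + Suc L}. \<rho> ^ j)"
      using assms by (intro sum_mono2) auto
    also have "\<dots> = (\<Sum>j<Suc L. \<rho> ^ (j + K))"
      by (rule sum.reindex_bij_witness[of _ "\<lambda>j. j + K" "\<lambda>j. j - K"]) auto
    also have "\<dots> \<le> (\<Sum>j. \<rho> ^ (j + K))"
      using assms by (intro sum_le_suminf) (auto intro: summable_geometric summable_ignore_initial_segment)
    finally show ?thesis .
  qed
  also have "\<dots> = \<rho> ^ K / (1 - \<rho>)"
    using assms by (simp add: power_add suminf_mult2[symmetric] suminf_geometric summable_geometric)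
  finally show ?thesis .
qed

text \<open>Chernoff bounds for a single candidate j; \<rho> compares the exponential moment of one
  bucket with its capacity factor r^b. The second bound includes bucket 0, which costs one more
  bucket factor, at most \<rho> r^b.\<close>

lemma occ_exp_excess_le:
  assumes "r \<ge> 1" "exp ((r - 1) * (real n / real m)) / r ^ b \<le> \<rho>" "j < m"
  shows "occ_exp m n (\<lambda>y. r ^ (\<Sum>i<j. y (Suc i)) / r ^ (b * j)) \<le> \<rho> ^ j"
    and "occ_exp m n (\<lambda>y. r ^ (\<Sum>i<Suc j. y i) / r ^ (b * j)) \<le> \<rho> * r ^ b * \<rho> ^ j"
proof -
  define x where "x = exp ((r - 1) * (real n / real m))"
  have x: "0 \<le> x / r ^ b" "x / r ^ b \<le> \<rho>" "x \<le> \<rho> * r ^ b"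
    using assms by (auto simp: x_def field_simps)
  have le: "occ_exp m n (\<lambda>y. r ^ (\<Sum>i\<in>I. y i) / r ^ (b * j)) \<le> x ^ card I / r ^ (b * j)" if "I \<subseteq> {..<m}" for I
  proof -
    have "occ_exp m n (\<lambda>y. r ^ (\<Sum>i\<in>I. y i) / r ^ (b * j)) = occ_exp m n (\<lambda>y. r ^ (\<Sum>i\<in>I. y i)) / r ^ (b * j)"
      using occ_exp_cmult[of m n "1 / r ^ (b * j)" "\<lambda>y. r ^ (\<Sum>i\<in>I. y i)"] by simp
    also have "\<dots> \<le> exp (real (card I) * (r - 1) * (real n / real m)) / r ^ (b * j)"
      using assms(1) that by (intro divide_right_mono occ_exp_power_le) auto
    also have "exp (real (card I) * (r - 1) * (real n / real m)) = x ^ card I"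
      by (simp add: x_def exp_of_nat_mult[symmetric] mult.assoc)
    finally show ?thesis .
  qed
  have "(\<Sum>i<j. y (Suc i)) = (\<Sum>i\<in>Suc ` {..<j}. y i)" for y :: "nat \<Rightarrow> nat"
    by (simp add: sum.reindex)
  moreover have "x ^ j / r ^ (b * j) \<le> \<rho> ^ j"
    using power_mono[OF x(2,1), of j] by (simp add: power_divide power_mult)
  ultimately show "occ_exp m n (\<lambda>y. r ^ (\<Sum>i<j. y (Suc i)) / r ^ (b * j)) \<le> \<rho> ^ j"
    using le[of "Suc ` {..<j}"] assms(3) by (simp add: card_image) fastforce
  have "occ_exp m n (\<lambda>y. r ^ (\<Sum>i<Suc j. y i) / r ^ (b * j)) \<le> x ^ Suc j / r ^ (b * j)"
    using le[of "{..<Suc j}"] assms(3) by (simp only: card_lessThan) fastforce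
  also have "\<dots> = x * (x / r ^ b) ^ j" by (simp add: power_divide power_mult)
  also have "\<dots> \<le> (\<rho> * r ^ b) * \<rho> ^ j"
    using x assms(1) by (intro mult_mono power_mono) (auto intro: order_trans)
  finally show "occ_exp m n (\<lambda>y. r ^ (\<Sum>i<Suc j. y i) / r ^ (b * j)) \<le> \<rho> * r ^ b * \<rho> ^ j" .
qed

text \<open>By \<open>lindley_neq_le\<close> only candidates j > K can matter. The resulting bound
  depends on m and n only through \<rho>.\<close>

lemma occ_truncation_error:
  assumes r: "r \<ge> 1" "exp ((r - 1) * (real n / real m)) / r ^ b \<le> \<rho>" "\<rho> < 1" and K: "K < m"
  shows "\<bar>occ_exp m n (\<lambda>y. of_bool (P y \<and> lindley b (m - 1) (\<lambda>i. y (Suc i)) = w)) -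
      occ_exp m n (\<lambda>y. of_bool (P y \<and> lindley b K (\<lambda>i. y (Suc i)) = w))\<bar> \<le> \<rho> ^ K / (1 - \<rho>)"
proof -
  have \<rho>: "0 \<le> \<rho>" using r by (auto intro: order_trans[rotated])
  define f where "f L y = (of_bool (P y \<and> lindley b L (\<lambda>i. y (Suc i)) = w) :: real)" for L y
  define E where "E y = (\<Sum>j\<in>{K<..m - 1}. r ^ (\<Sum>i<j. y (Suc i)) / r ^ (b * j))" for y
  have le: "\<bar>f (m - 1) y - f K y\<bar> \<le> E y" for y
  proof -
    have "0 \<le> E y" unfolding E_def using r(1) by (intro sum_nonneg) auto
    moreover have "of_bool (lindley b (m - 1) (\<lambda>i. y (Suc i)) \<noteq> lindley b K (\<lambda>i. y (Suc i))) \<le> E y"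
      unfolding E_def using lindley_neq_le[OF r(1), of K "m - 1" b "\<lambda>i. y (Suc i)"] K by simp
    ultimately show ?thesis unfolding f_def by (auto simp: of_bool_def split: if_splits)
  qed
  have "occ_exp m n (\<lambda>y. f (m - 1) y - f K y) \<le> occ_exp m n E"
    using le by (intro occ_exp_mono) (auto simp: abs_le_iff)
  moreover have "occ_exp m n (\<lambda>y. f K y - f (m - 1) y) \<le> occ_exp m n E"
    using le by (intro occ_exp_mono) (auto simp: abs_le_iff)
  ultimately have "\<bar>occ_exp m n (f (m - 1)) - occ_exp m n (f K)\<bar> \<le> occ_exp m n E"
    unfolding occ_exp_diff by linarith
  also have "\<dots> \<le> (\<Sum>j\<in>{K<..m - 1}. \<rho> ^ j)"
    unfolding E_def occ_exp_sum using K by (intro sum_mono occ_exp_excess_le[OF r(1,2)]) auto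
  also have "\<dots> \<le> \<rho> ^ K / (1 - \<rho>)"
    using \<rho> r(3) by (rule sum_power_tail_le)
  finally show ?thesis unfolding f_def .
qed

text \<open>A union bound over the candidates j; the factor r^(y 0) extends the sum over j counts to
  one over j + 1 counts.\<close>

lemma occ_exp_moment_bound:
  assumes r: "r \<ge> 1" "exp ((r - 1) * (real n / real m)) / r ^ b \<le> \<rho>" "\<rho> < 1" and m: "m > 0"
  shows "occ_exp m n (\<lambda>y. r ^ (y 0 + lindley b (m - 1) (\<lambda>i. y (Suc i)))) \<le> \<rho> * r ^ b / (1 - \<rho>)"
proof -
  have \<rho>: "0 \<le> \<rho>" using r by (auto intro: order_trans[rotated])
  have "r ^ (y 0 + lindley b (m - 1) (\<lambda>i. y (Suc i))) \<le> (\<Sum>j\<le>m - 1. r ^ (\<Sum>i<Suc j. y i) / r ^ (b * j))" for y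
  proof -
    have "r ^ y 0 * r ^ lindley b (m - 1) (\<lambda>i. y (Suc i)) \<le>
        r ^ y 0 * (\<Sum>j\<le>m - 1. r ^ (\<Sum>i<j. y (Suc i)) / r ^ (b * j))"
      using r by (intro mult_left_mono power_lindley_le) auto
    also have "\<dots> = (\<Sum>j\<le>m - 1. r ^ (\<Sum>i<Suc j. y i) / r ^ (b * j))"
      by (simp add: sum_distrib_left sum.lessThan_Suc_shift power_add del: sum.lessThan_Suc)
    finally show ?thesis by (simp add: power_add)
  qed
  then have "occ_exp m n (\<lambda>y. r ^ (y 0 + lindley b (m - 1) (\<lambda>i. y (Suc i)))) \<le>
      occ_exp m n (\<lambda>y. \<Sum>j\<le>m - 1. r ^ (\<Sum>i<Suc j. y i) / r ^ (b * j))"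
    by (rule occ_exp_mono)
  also have "\<dots> \<le> (\<Sum>j\<le>m - 1. \<rho> * r ^ b * \<rho> ^ j)"
    unfolding occ_exp_sum using m by (intro sum_mono occ_exp_excess_le[OF r(1,2)]) auto
  also have "\<dots> = \<rho> * r ^ b * (\<Sum>j\<le>m - 1. \<rho> ^ j)" by (simp add: sum_distrib_left)
  also have "\<dots> \<le> \<rho> * r ^ b * (1 / (1 - \<rho>))"
  proof (rule mult_left_mono)
    have "(\<Sum>j\<le>m - 1. \<rho> ^ j) \<le> (\<Sum>j. \<rho> ^ j)"
      using \<rho> r(3) by (intro sum_le_suminf) (auto intro: summable_geometric)
    then show "(\<Sum>j\<le>m - 1. \<rho> ^ j) \<le> 1 / (1 - \<rho>)"
      using \<rho> r(3) by (simp add: suminf_geometric)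
  qed (use \<rho> r in auto)
  finally show ?thesis by simp
qed

text \<open>The convergence of the finite-depth laws to q is a hypothesis here;
  \<open>poisson_model_law\<close> supplies it.\<close>

lemma occ_full_limit:
  assumes "\<mu> > 0" and lim: "occ_limit \<mu> m n" and r: "r \<ge> 1" "exp ((r - 1) * \<mu>) < r ^ b"
    and q: "\<And>w. (\<lambda>K. pmf (queue_pmf b \<mu> K) w) \<longlonglongrightarrow> pmf q w"
  obtains B where
    "\<And>u w. (\<lambda>k. occ_exp (m k) (n k) (\<lambda>y. of_bool (y 0 = u \<and> lindley b (m k - 1) (\<lambda>i. y (Suc i)) = w)))
      \<longlonglongrightarrow> pmf (poisson_pmf \<mu>) u * pmf q w"
    "eventually (\<lambda>k. occ_exp (m k) (n k) (\<lambda>y. r ^ (y 0 + lindley b (m k - 1) (\<lambda>i. y (Suc i)))) \<le> B) sequentially"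
proof -
  have m: "filterlim m at_top sequentially" and rat: "(\<lambda>k. real (n k) / real (m k)) \<longlonglongrightarrow> \<mu>"
    using lim unfolding occ_limit_def by auto
  have rb: "r ^ b > 0" using r by simp
  \<comment> \<open>The slack between the limiting ratio and 1 absorbs the fluctuation of n/m, so
    one \<rho> serves all large k.\<close>
  obtain \<rho> where \<rho>: "exp ((r - 1) * \<mu>) / r ^ b < \<rho>" "\<rho> < 1"
    using dense[of "exp ((r - 1) * \<mu>) / r ^ b" 1] r rb by (auto simp: field_simps)
  have \<rho>0: "0 \<le> \<rho>" using \<rho>(1) rb by (auto intro: order_trans[rotated] less_imp_le)
  have "(\<lambda>k. exp ((r - 1) * (real (n k) / real (m k))) / r ^ b) \<longlonglongrightarrow> exp ((r - 1) * \<mu>) / r ^ b"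
    using rb by (intro tendsto_divide tendsto_exp tendsto_mult tendsto_const rat) linarith
  from order_tendstoD(2)[OF this \<rho>(1)]
  have ev: "eventually (\<lambda>k. exp ((r - 1) * (real (n k) / real (m k))) / r ^ b \<le> \<rho>) sequentially"
    by (rule eventually_mono) simp
  show ?thesis
  proof (rule that)
    show "eventually (\<lambda>k. occ_exp (m k) (n k) (\<lambda>y. r ^ (y 0 + lindley b (m k - 1) (\<lambda>i. y (Suc i)))) \<le>
        \<rho> * r ^ b / (1 - \<rho>)) sequentially"
      using ev eventually_compose_filterlim[OF eventually_ge_at_top[of 1] m]
      by eventually_elim (rule occ_exp_moment_bound, use r \<rho> in auto)
  next
    fix u w
    define a where "a L k = occ_exp (m k) (n k) (\<lambda>y. of_bool (y 0 = u \<and> lindley b L (\<lambda>i. y (Suc i)) = w))" for L k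
    define c where "c K = pmf (poisson_pmf \<mu>) u * pmf (queue_pmf b \<mu> K) w" for K
    define c' where "c' = pmf (poisson_pmf \<mu>) u * pmf q w"
    have c: "c \<longlonglongrightarrow> c'" unfolding c_def c'_def by (intro tendsto_intros q)
    have a: "a K \<longlonglongrightarrow> c K" for K unfolding a_def c_def by (rule occ_joint_limit[OF assms(1,2)])
    have "(\<lambda>K. \<rho> ^ K / (1 - \<rho>)) \<longlonglongrightarrow> 0 / (1 - \<rho>)"
      using \<rho>0 \<rho> by (intro tendsto_divide LIMSEQ_realpow_zero tendsto_const) auto
    then have z: "(\<lambda>K. \<rho> ^ K / (1 - \<rho>)) \<longlonglongrightarrow> 0" by simp
    have "(\<lambda>k. a (m k - 1) k) \<longlonglongrightarrow> c'"
    \<comment> \<open>Three errors of e/3: full depth against depth K, the limit in k at depth K,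
      and depth K against q in the limit. K is fixed before k.\<close>
    proof (rule tendstoI)
      fix e :: real assume e: "e > 0"
      have "eventually (\<lambda>K. dist (c K) c' < e / 3 \<and> \<rho> ^ K / (1 - \<rho>) < e / 3) sequentially"
        using tendstoD[OF c, of "e / 3"] order_tendstoD(2)[OF z, of "e / 3"] e by (simp add: eventually_conj)
      then obtain K where K: "dist (c K) c' < e / 3" "\<rho> ^ K / (1 - \<rho>) < e / 3"
        using eventually_happens'[OF sequentially_bot] by blast
      have "eventually (\<lambda>k. dist (a K k) (c K) < e / 3) sequentially"
        using tendstoD[OF a, of "e / 3"] e by simp
      with ev eventually_compose_filterlim[OF eventually_gt_at_top[of K] m]
      show "eventually (\<lambda>k. dist (a (m k - 1) k) c' < e) sequentially"
      proof eventually_elim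
        case (elim k)
        have "\<bar>a (m k - 1) k - a K k\<bar> \<le> \<rho> ^ K / (1 - \<rho>)"
          unfolding a_def by (rule occ_truncation_error[OF r(1) elim(1) \<rho>(2) elim(2)])
        then show ?case using elim(3) K unfolding dist_real_def by linarith
      qed
    qed
    then show "(\<lambda>k. occ_exp (m k) (n k) (\<lambda>y. of_bool (y 0 = u \<and> lindley b (m k - 1) (\<lambda>i. y (Suc i)) = w)))
      \<longlonglongrightarrow> pmf (poisson_pmf \<mu>) u * pmf q w"
      unfolding a_def c'_def .
  qed
qed

section \<open>Reduction of the exact model to bucket counts\<close>

text \<open>The ranks of the elements of S run through 0, ..., card S - 1 once each; inserting a new
  maximum leaves the other ranks alone.\<close>

lemma sum_rank:
  fixes S :: "nat set"
  assumes "finite S"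
  shows "(\<Sum>c\<in>S. f (card {i \<in> S. i < c})) = (\<Sum>v<card S. f v)"
  using assms
proof (induction S rule: finite_linorder_max_induct)
  case empty
  show ?case by simp
next
  case (insert b A)
  have "b \<notin> A" using insert.hyps(2) by blast
  have 1: "{i \<in> insert b A. i < b} = A" using insert.hyps(2) by auto
  have 2: "{i \<in> insert b A. i < c} = {i \<in> A. i < c}" if "c \<in> A" for c
    using insert.hyps(2) that by fastforce
  have "(\<Sum>c\<in>insert b A. f (card {i \<in> insert b A. i < c})) = f (card A) + (\<Sum>c\<in>A. f (card {i \<in> A. i < c}))"
    unfolding sum.insert[OF insert.hyps(1) \<open>b \<notin> A\<close>] 1 by (intro arg_cong2[of _ _ _ _ "(+)"] refl sum.cong) (simp only: 2)
  then show ?case using insert.IH insert.hyps(1) \<open>b \<notin> A\<close> by (simp add: add.commute)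
qed

lemma count_list_filter_map_upt:
  assumes "P a"
  shows "count_list (filter P (map f [0..<n])) a = card {i \<in> {..<n}. f i = a}"
proof -
  have "count_list (filter P (map f [0..<n])) a = length (filter (\<lambda>i. f i = a) [0..<n])"
    using assms by (induction n) auto
  also have "\<dots> = card {i \<in> {..<n}. f i = a}"
    by (subst length_filter_conv_card) (auto intro!: arg_cong[of _ _ card])
  finally show ?thesis .
qed

text \<open>Steps back from a to x. For fixed a this is the reflection of x to a - x modulo m: it is
  its own inverse and moves a to 0, so composing hash functions with it is a bijection whose inverse
  is the same map.\<close>

definition back_dist :: "nat \<Rightarrow> nat \<Rightarrow> nat \<Rightarrow> nat" where
  "back_dist m a x = (a + m - x) mod m"

lemma back_dist_lt: "m > 0 \<Longrightarrow> back_dist m a x < m"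
  by (simp add: back_dist_def)

lemma back_dist_eq: "a < m \<Longrightarrow> x < m \<Longrightarrow> back_dist m a x = (if x \<le> a then a - x else a + m - x)"
  by (auto simp: back_dist_def mod_if)

lemma back_dist_involution: "a < m \<Longrightarrow> x < m \<Longrightarrow> back_dist m a (back_dist m a x) = x"
  using back_dist_lt[of m a x] by (subst back_dist_eq) (auto simp: back_dist_eq)

lemma back_dist_0_iff: "a < m \<Longrightarrow> x < m \<Longrightarrow> back_dist m a x = 0 \<longleftrightarrow> x = a"
  by (auto simp: back_dist_eq)

lemma back_dist_forward:
  "a < m \<Longrightarrow> x < m \<Longrightarrow> 0 < d \<Longrightarrow> d < m \<Longrightarrow> (x + m - a) mod m = d \<longleftrightarrow> back_dist m a x = m - d"
  by (auto simp: back_dist_def mod_if)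

text \<open>Parking numbers the buckets forwards and the recursion reads them backwards: index i
  belongs to forward distance m - 1 - i, which is backward distance i + 1.\<close>

lemma Q_exact_eq_lindley:
  assumes "h \<in> {..<n} \<rightarrow>\<^sub>E {..<m}" "c < n"
  shows "Q_exact b m n (h, c) =
     lindley b (m - 1) (\<lambda>i. bucket_counts n (\<lambda>i\<in>{..<n}. back_dist m (h c) (h i)) (Suc i))"
proof -
  have h: "h i < m" if "i < n" for i using assms(1) that by auto
  then have m: "m > 0" using assms(2) by fastforce
  define as where "as = filter (\<lambda>a. a \<noteq> 0) (map (\<lambda>i. (h i + m - h c) mod m) [0..<n])"
  have "set as \<subseteq> {1..m - 1}"
  proof
    fix a assume "a \<in> set as"
    then obtain x where "a = x mod m" "a \<noteq> 0" by (auto simp: as_def)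
    then show "a \<in> {1..m - 1}" using mod_less_divisor[OF m, of x] by simp
  qed
  then have "Q_exact b m n (h, c) = lindley b (m - 1) (\<lambda>i. count_list as (m - 1 - i))"
    unfolding Q_exact_def as_def[symmetric] split by (rule parking_overflow_eq_lindley)
  also have "\<dots> = lindley b (m - 1) (\<lambda>i. bucket_counts n (\<lambda>i\<in>{..<n}. back_dist m (h c) (h i)) (Suc i))"
  proof (rule lindley_cong)
    fix i assume i: "i < m - 1"
    have "count_list as (m - 1 - i) = card {k \<in> {..<n}. (h k + m - h c) mod m = m - 1 - i}"
      unfolding as_def using i by (intro count_list_filter_map_upt) simp
    also have "{k \<in> {..<n}. (h k + m - h c) mod m = m - 1 - i} =
        {k \<in> {..<n}. (\<lambda>i\<in>{..<n}. back_dist m (h c) (h i)) k = Suc i}"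
      using i h assms(2) back_dist_forward[of "h c" m _ "m - 1 - i"] by auto
    finally show "count_list as (m - 1 - i) =
        bucket_counts n (\<lambda>i\<in>{..<n}. back_dist m (h c) (h i)) (Suc i)" .
  qed
  finally show ?thesis .
qed

lemma V_exact_eq:
  assumes "h \<in> {..<n} \<rightarrow>\<^sub>E {..<m}" "c < n"
  shows "V_exact (h, c) = card {i \<in> {..<c}. (\<lambda>i\<in>{..<n}. back_dist m (h c) (h i)) i = 0}"
proof -
  have h: "h i < m" if "i < n" for i using assms(1) that by auto
  have "{i. i < c \<and> h i = h c} = {i \<in> {..<c}. (\<lambda>i\<in>{..<n}. back_dist m (h c) (h i)) i = 0}"
    using assms(2) h back_dist_0_iff[of "h c" m] by auto
  then show ?thesis unfolding V_exact_def by simp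
qed

text \<open>Rotating the table so that the bucket of the chosen key becomes bucket \<open>0\<close> turns the choice
  of a key into the choice of one of the keys of bucket \<open>0\<close>; the rank of that key runs through
  \<open>0, \<dots>, N - 1\<close>, where \<open>N\<close> is the number of keys of bucket \<open>0\<close>.\<close>

lemma sum_hash_outcomes:
  fixes F :: "nat \<Rightarrow> nat \<Rightarrow> complex"
  assumes "m > 0"
  shows "(\<Sum>w\<in>({..<n} \<rightarrow>\<^sub>E {..<m}) \<times> {..<n}. F (V_exact w) (Q_exact b m n w)) =
    of_nat m * (\<Sum>h\<in>{..<n} \<rightarrow>\<^sub>E {..<m}. \<Sum>v<bucket_counts n h 0.
       F v (lindley b (m - 1) (\<lambda>i. bucket_counts n h (Suc i))))"
proof -
  let ?H = "{..<n} \<rightarrow>\<^sub>E {..<m}"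
  define rot where "rot a h = (\<lambda>i\<in>{..<n}. back_dist m a (h i))" for a h
  define Q where "Q h = lindley b (m - 1) (\<lambda>i. bucket_counts n h (Suc i))" for h
  have rot_in: "rot a h \<in> ?H" if "h \<in> ?H" for a h
    using that assms unfolding rot_def by (auto intro: back_dist_lt)
  have rot_rot: "rot a (rot a h) = h" if "h \<in> ?H" "a < m" for a h
  proof
    fix i show "rot a (rot a h) i = h i"
      using that back_dist_involution[OF that(2), of "h i"] unfolding rot_def
      by (cases "i < n") (auto simp: PiE_def extensional_def)
  qed
  have "(\<Sum>w\<in>?H \<times> {..<n}. F (V_exact w) (Q_exact b m n w)) =
      (\<Sum>(a, h, c)\<in>{..<m} \<times> (SIGMA h:?H. {c \<in> {..<n}. h c = 0}). F (card {i \<in> {..<c}. h i = 0}) (Q h))"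
  \<comment> \<open>The address a of the chosen key is kept as a separate coordinate, so that the
    reflection can be undone. The summand does not depend on it, whence the factor m.\<close>
  proof (rule sum.reindex_bij_witness[of _ "\<lambda>(a, h, c). (rot a h, c)" "\<lambda>(h, c). (h c, rot (h c) h, c)"])
    fix w assume "w \<in> ?H \<times> {..<n}"
    then obtain h c where w: "w = (h, c)" "h \<in> ?H" "c < n" by auto
    then have hc: "h c < m" by auto
    show "(case case w of (h, c) \<Rightarrow> (h c, rot (h c) h, c) of (a, h, c) \<Rightarrow> (rot a h, c)) = w"
      using w rot_rot hc by simp
    have "rot (h c) h c = 0" using w hc unfolding rot_def by (simp add: back_dist_0_iff)
    then show "(case w of (h, c) \<Rightarrow> (h c, rot (h c) h, c)) \<in> {..<m} \<times> (SIGMA h:?H. {c \<in> {..<n}. h c = 0})"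
      using w hc rot_in by simp
    show "(case case w of (h, c) \<Rightarrow> (h c, rot (h c) h, c) of (a, h, c) \<Rightarrow> F (card {i \<in> {..<c}. h i = 0}) (Q h)) =
        F (V_exact w) (Q_exact b m n w)"
      using V_exact_eq[OF w(2,3)] Q_exact_eq_lindley[OF w(2,3), of b] w(1)
      by (simp add: rot_def Q_def)
  next
    fix z assume "z \<in> {..<m} \<times> (SIGMA h:?H. {c \<in> {..<n}. h c = 0})"
    then obtain a h c where z: "z = (a, h, c)" "a < m" "h \<in> ?H" "c < n" "h c = 0" by auto
    have a: "rot a h c = a" using z(2,4,5) by (simp add: rot_def back_dist_def)
    show "(case case z of (a, h, c) \<Rightarrow> (rot a h, c) of (h, c) \<Rightarrow> (h c, rot (h c) h, c)) = z"
      using z(1) rot_rot[OF z(3,2)] by (simp add: a)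
    show "(case z of (a, h, c) \<Rightarrow> (rot a h, c)) \<in> ?H \<times> {..<n}"
      using z rot_in by simp
  qed
  also have "\<dots> = (\<Sum>a<m. \<Sum>h\<in>?H. \<Sum>c\<in>{c \<in> {..<n}. h c = 0}. F (card {i \<in> {..<c}. h i = 0}) (Q h))"
    by (subst sum.cartesian_product[symmetric], subst sum.Sigma)
       (auto intro: finite_PiE simp: case_prod_unfold)
  also have "\<dots> = of_nat m * (\<Sum>h\<in>?H. \<Sum>c\<in>{c \<in> {..<n}. h c = 0}. F (card {i \<in> {..<c}. h i = 0}) (Q h))"
    by simp
  also have "(\<Sum>h\<in>?H. \<Sum>c\<in>{c \<in> {..<n}. h c = 0}. F (card {i \<in> {..<c}. h i = 0}) (Q h)) =
      (\<Sum>h\<in>?H. \<Sum>v<bucket_counts n h 0. F v (Q h))"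
  proof (rule sum.cong[OF refl])
    fix h
    define S where "S = {c \<in> {..<n}. h c = (0::nat)}"
    have "(\<Sum>c\<in>S. F (card {i \<in> {..<c}. h i = 0}) (Q h)) = (\<Sum>c\<in>S. F (card {i \<in> S. i < c}) (Q h))"
      by (intro sum.cong refl arg_cong2[of _ _ _ _ F] arg_cong[of _ _ card]) (auto simp: S_def)
    also have "\<dots> = (\<Sum>v<card S. F v (Q h))"
      by (rule sum_rank) (simp add: S_def)
    finally show "(\<Sum>c\<in>{c \<in> {..<n}. h c = 0}. F (card {i \<in> {..<c}. h i = 0}) (Q h)) =
        (\<Sum>v<bucket_counts n h 0. F v (Q h))"
      unfolding S_def .
  qed
  finally show ?thesis unfolding Q_def .
qed

definition occ_pmf :: "nat \<Rightarrow> nat \<Rightarrow> nat \<Rightarrow> (nat \<times> nat) pmf" where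
  "occ_pmf b m n = map_pmf (\<lambda>h. (bucket_counts n h 0, lindley b (m - 1) (\<lambda>i. bucket_counts n h (Suc i))))
     (pmf_of_set ({..<n} \<rightarrow>\<^sub>E {..<m}))"

lemma finite_hash: "finite ({..<n} \<rightarrow>\<^sub>E {..<m::nat})" for n :: nat
  by (intro finite_PiE) auto

lemma hash_nonempty: "m > 0 \<Longrightarrow> {..<n} \<rightarrow>\<^sub>E {..<m::nat} \<noteq> {}" for n :: nat
  by (auto simp: PiE_eq_empty_iff)

lemma integral_pmf_of_set_scaleR:
  fixes f :: "'b \<Rightarrow> 'a :: {banach, second_countable_topology}"
  assumes "finite S" "S \<noteq> {}"
  shows "(\<integral>x. f x \<partial>pmf_of_set S) = (\<Sum>x\<in>S. f x) /\<^sub>R real (card S)"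
proof -
  have "(\<integral>x. f x \<partial>pmf_of_set S) = (\<Sum>x\<in>S. pmf (pmf_of_set S) x *\<^sub>R f x)"
    using assms by (intro integral_measure_pmf) auto
  also have "\<dots> = (\<Sum>x\<in>S. f x /\<^sub>R real (card S))"
    using assms by (intro sum.cong) (auto simp: divide_inverse)
  finally show ?thesis by (simp add: scaleR_sum_right)
qed

lemma card_hash: "card ({..<n} \<rightarrow>\<^sub>E {..<m::nat}) = m ^ n" for n :: nat
  by (simp add: card_PiE)

lemma integral_occ_pmf:
  fixes G :: "nat \<times> nat \<Rightarrow> 'a :: {banach, second_countable_topology}"
  assumes "m > 0"
  shows "(\<integral>z. G z \<partial>occ_pmf b m n) =
    (\<Sum>h\<in>{..<n} \<rightarrow>\<^sub>E {..<m}. G (bucket_counts n h 0, lindley b (m - 1) (\<lambda>i. bucket_counts n h (Suc i)))) /\<^sub>R real m ^ n"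
  unfolding occ_pmf_def integral_map_pmf
    integral_pmf_of_set_scaleR[OF finite_hash hash_nonempty[OF assms]] card_hash of_nat_power ..

lemma integral_occ_pmf_real:
  assumes "m > 0"
  shows "(\<integral>z. g z \<partial>occ_pmf b m n) = occ_exp m n (\<lambda>y. g (y 0, lindley b (m - 1) (\<lambda>i. y (Suc i))))"
  unfolding integral_occ_pmf[OF assms] occ_exp_def
  using count_sum_PiE[of "\<lambda>y. g (y 0, lindley b (m - 1) (\<lambda>i. y (Suc i)))" n m]
  by (simp add: divide_inverse mult.commute)

lemma pmf_occ_pmf:
  assumes "m > 0"
  shows "pmf (occ_pmf b m n) (u, w) = occ_exp m n (\<lambda>y. of_bool (y 0 = u \<and> lindley b (m - 1) (\<lambda>i. y (Suc i)) = w))"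
proof -
  have "pmf (occ_pmf b m n) (u, w) = (\<integral>z. indicator {(u, w)} z \<partial>occ_pmf b m n)"
    by (simp add: measure_pmf_single)
  also have "\<dots> = occ_exp m n (\<lambda>y. of_bool (y 0 = u \<and> lindley b (m - 1) (\<lambda>i. y (Suc i)) = w))"
    unfolding integral_occ_pmf_real[OF assms] by (simp add: indicator_def of_bool_def)
  finally show ?thesis .
qed

text \<open>The size bias of the bucket of a random key: each outcome has weight 1/(m^n n), and m/n
  is the reciprocal of the mean count of bucket 0.\<close>

lemma integral_hash_model:
  fixes F :: "nat \<Rightarrow> nat \<Rightarrow> complex"
  assumes "m > 0" "n > 0"
  shows "(\<integral>w. F (V_exact w) (Q_exact b m n w) \<partial>hash_model m n) =
    of_real (real m / real n) * (\<integral>z. (\<Sum>v<fst z. F v (snd z)) \<partial>occ_pmf b m n)"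
proof -
  have "(\<integral>w. F (V_exact w) (Q_exact b m n w) \<partial>hash_model m n) =
      (\<Sum>w\<in>({..<n} \<rightarrow>\<^sub>E {..<m}) \<times> {..<n}. F (V_exact w) (Q_exact b m n w)) /\<^sub>R (real m ^ n * real n)"
    unfolding hash_model_def using assms hash_nonempty[OF assms(1), of n]
    by (subst integral_pmf_of_set_scaleR) (auto simp: finite_hash card_hash card_cartesian_product)
  also have "\<dots> = of_real (real m / real n) * (\<integral>z. (\<Sum>v<fst z. F v (snd z)) \<partial>occ_pmf b m n)"
    unfolding sum_hash_outcomes[OF assms(1)] integral_occ_pmf[OF assms(1)]
    by (simp add: scaleR_conv_of_real divide_inverse)
  finally show ?thesis .
qed

section \<open>Uniform convergence of expectations\<close>

lemma integral_pmf_nat: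
  fixes f :: "nat \<Rightarrow> 'a :: {banach, second_countable_topology}"
  assumes "integrable (measure_pmf p) f"
  shows "(\<lambda>k. pmf p k *\<^sub>R f k) sums (\<integral>k. f k \<partial>p)"
proof -
  have i: "integrable (count_space UNIV) (\<lambda>k. pmf p k *\<^sub>R f k)"
    using assms unfolding measure_pmf_eq_density by (subst (asm) integrable_density) auto
  have "(\<integral>k. f k \<partial>p) = (\<integral>k. pmf p k *\<^sub>R f k \<partial>count_space UNIV)"
    unfolding measure_pmf_eq_density by (subst integral_density) auto
  then show ?thesis using sums_integral_count_space_nat[OF i] by simp
qed

text \<open>Fatou's lemma for the counting measure, with the pmfs as densities; it hands the
  exponential moment bound to the limit law.\<close>

lemma pmf_fatou:
  fixes p :: "nat \<Rightarrow> 'i pmf" and R :: "'i \<Rightarrow> real"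
  assumes lim: "\<And>x. (\<lambda>k. pmf (p k) x) \<longlonglongrightarrow> pmf q x"
    and bnd: "eventually (\<lambda>k. integrable (p k) R \<and> (\<integral>x. R x \<partial>p k) \<le> B) sequentially"
    and R: "\<And>x. 0 \<le> R x"
  shows "integrable (measure_pmf q) R" "(\<integral>x. R x \<partial>q) \<le> B"
proof -
  have "(\<integral>\<^sup>+x. ennreal (R x) \<partial>q) = (\<integral>\<^sup>+x. ennreal (pmf q x) * ennreal (R x) \<partial>count_space UNIV)"
    by (rule nn_integral_measure_pmf)
  also have "\<dots> = (\<integral>\<^sup>+x. liminf (\<lambda>k. ennreal (pmf (p k) x) * ennreal (R x)) \<partial>count_space UNIV)"
  proof (intro nn_integral_cong)
    fix x
    have "(\<lambda>k. ennreal (pmf (p k) x * R x)) \<longlonglongrightarrow> ennreal (pmf q x * R x)"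
      by (intro tendsto_ennrealI tendsto_mult lim tendsto_const)
    then show "ennreal (pmf q x) * ennreal (R x) = liminf (\<lambda>k. ennreal (pmf (p k) x) * ennreal (R x))"
      using R by (subst lim_imp_Liminf) (auto simp: ennreal_mult')
  qed
  also have "\<dots> \<le> liminf (\<lambda>k. \<integral>\<^sup>+x. ennreal (pmf (p k) x) * ennreal (R x) \<partial>count_space UNIV)"
    by (rule nn_integral_liminf) simp
  also have "\<dots> = liminf (\<lambda>k. \<integral>\<^sup>+x. ennreal (R x) \<partial>p k)"
    by (simp add: nn_integral_measure_pmf)
  also have "\<dots> \<le> limsup (\<lambda>k. \<integral>\<^sup>+x. ennreal (R x) \<partial>p k)"
    by (rule Liminf_le_Limsup) simp
  also have "\<dots> \<le> ennreal B"
    by (rule Limsup_bounded, use bnd in eventually_elim) (auto simp: nn_integral_eq_integral R intro: ennreal_leI)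
  finally have le: "(\<integral>\<^sup>+x. ennreal (R x) \<partial>q) \<le> ennreal B" .
  then show "integrable (measure_pmf q) R"
    using R by (intro integrableI_nonneg) (auto simp: le_less_trans)
  obtain k where "integrable (p k) R" "(\<integral>x. R x \<partial>p k) \<le> B"
    using eventually_happens'[OF sequentially_bot bnd] by blast
  moreover have "0 \<le> (\<integral>x. R x \<partial>p k)" using R by simp
  ultimately have "B \<ge> 0" by linarith
  then show "(\<integral>x. R x \<partial>q) \<le> B"
    using le R by (intro integral_real_bounded) (auto)
qed

text \<open>Outside the finite set where S exceeds \<epsilon> R, the norm of G is at most \<epsilon>
  R.\<close>

lemma pmf_integral_truncate:
  fixes G :: "'i \<Rightarrow> complex"
  assumes "integrable (measure_pmf p) R" "\<And>x. norm (G x) \<le> S x" "\<And>x. S x \<le> R x"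
    "finite {x. \<epsilon> * R x < S x}" "\<epsilon> > 0"
  shows "norm ((\<integral>x. G x \<partial>p) - (\<Sum>x\<in>{x. \<epsilon> * R x < S x}. pmf p x *\<^sub>R G x)) \<le> \<epsilon> * (\<integral>x. R x \<partial>p)"
proof -
  define J where "J = {x. \<epsilon> * R x < S x}"
  have J: "finite J" using assms(4) by (simp add: J_def)
  have R0: "0 \<le> R x" for x using assms(2,3)[of x] norm_ge_zero[of "G x"] by linarith
  have G: "integrable (measure_pmf p) G"
    using assms(2,3) R0 by (intro Bochner_Integration.integrable_bound[OF assms(1)]) (auto intro: order_trans)
  have iJ: "integrable (measure_pmf p) (\<lambda>x. indicator J x *\<^sub>R G x)"
    by (rule Bochner_Integration.integrable_bound[OF G]) (auto simp: indicator_def)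
  have eq: "(\<integral>x. indicator J x *\<^sub>R G x \<partial>p) = (\<Sum>x\<in>J. pmf p x *\<^sub>R G x)"
    using J by (subst integral_measure_pmf[OF J]) (auto simp: indicator_def split: if_splits)
  have "(\<integral>x. G x \<partial>p) - (\<Sum>x\<in>J. pmf p x *\<^sub>R G x) = (\<integral>x. G x - indicator J x *\<^sub>R G x \<partial>p)"
    using G iJ by (simp add: eq)
  also have "norm \<dots> \<le> (\<integral>x. norm (G x - indicator J x *\<^sub>R G x) \<partial>p)"
    by (rule integral_norm_bound)
  also have "\<dots> \<le> (\<integral>x. \<epsilon> * R x \<partial>p)"
  proof (rule integral_mono)
    fix x show "norm (G x - indicator J x *\<^sub>R G x) \<le> \<epsilon> * R x"
      using assms(2)[of x] R0[of x] assms(5) by (auto simp: J_def indicator_def)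
  qed (use G iJ assms(1) in auto)
  finally show ?thesis unfolding J_def by simp
qed

text \<open>The finite set and all error bounds depend on G only through S. Hence one threshold for
  k serves every G at once, as uniform convergence of generating functions requires.\<close>

lemma pmf_limit_uniform:
  fixes p :: "nat \<Rightarrow> 'i pmf"
  assumes lim: "\<And>x. (\<lambda>k. pmf (p k) x) \<longlonglongrightarrow> pmf q x"
    and bnd: "eventually (\<lambda>k. integrable (p k) R \<and> (\<integral>x. R x \<partial>p k) \<le> B) sequentially"
    and S: "\<And>x. 0 \<le> S x" "\<And>x. S x \<le> R x"
    and fin: "\<And>\<epsilon>. \<epsilon> > 0 \<Longrightarrow> finite {x. \<epsilon> * R x < S x}"
    and e: "e > 0"
  shows "eventually (\<lambda>k. \<forall>G :: 'i \<Rightarrow> complex. (\<forall>x. norm (G x) \<le> S x) \<longrightarrow>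
     norm ((\<integral>x. G x \<partial>p k) - (\<integral>x. G x \<partial>q)) < e) sequentially"
proof -
  have R0: "0 \<le> R x" for x using S[of x] by linarith
  note q = pmf_fatou[OF lim bnd R0]
  \<comment> \<open>C is positive and dominates B, so that each truncation costs at most
    e/4.\<close>
  define C where "C = \<bar>B\<bar> + 1"
  define \<epsilon> where "\<epsilon> = e / (4 * C)"
  have C: "C > 0" "B \<le> C" by (auto simp: C_def)
  have \<epsilon>: "\<epsilon> > 0" "\<epsilon> * C = e / 4" using e C by (auto simp: \<epsilon>_def)
  define J where "J = {x. \<epsilon> * R x < S x}"
  have "(\<lambda>k. \<Sum>x\<in>J. \<bar>pmf (p k) x - pmf q x\<bar> * S x) \<longlonglongrightarrow> (\<Sum>x\<in>J. \<bar>pmf q x - pmf q x\<bar> * S x)"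
    by (intro tendsto_intros lim)
  then have "eventually (\<lambda>k. (\<Sum>x\<in>J. \<bar>pmf (p k) x - pmf q x\<bar> * S x) < e / 4) sequentially"
    using e by (intro order_tendstoD(2)[where y = 0]) auto
  with bnd show ?thesis
  proof eventually_elim
    case (elim k)
    show ?case
    proof (intro allI impI)
      fix G :: "'i \<Rightarrow> complex" assume G: "\<forall>x. norm (G x) \<le> S x"
      have 1: "norm ((\<integral>x. G x \<partial>p k) - (\<Sum>x\<in>J. pmf (p k) x *\<^sub>R G x)) \<le> \<epsilon> * (\<integral>x. R x \<partial>p k)"
        unfolding J_def using elim(1) G S(2) \<epsilon>(1) fin[OF \<epsilon>(1)] by (intro pmf_integral_truncate) auto
      have 2: "norm ((\<integral>x. G x \<partial>q) - (\<Sum>x\<in>J. pmf q x *\<^sub>R G x)) \<le> \<epsilon> * (\<integral>x. R x \<partial>q)"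
        unfolding J_def using q(1) G S(2) \<epsilon>(1) fin[OF \<epsilon>(1)] by (intro pmf_integral_truncate) auto
      have 3: "norm ((\<Sum>x\<in>J. pmf (p k) x *\<^sub>R G x) - (\<Sum>x\<in>J. pmf q x *\<^sub>R G x)) \<le>
          (\<Sum>x\<in>J. \<bar>pmf (p k) x - pmf q x\<bar> * S x)"
        unfolding sum_subtractf[symmetric] scaleR_diff_left[symmetric]
        using G by (intro sum_norm_le) (auto intro!: mult_left_mono)
      have 4: "\<epsilon> * (\<integral>x. R x \<partial>p k) \<le> e / 4" "\<epsilon> * (\<integral>x. R x \<partial>q) \<le> e / 4"
        using elim(1) q(2) C(2) \<epsilon> by (auto intro!: order_trans[OF mult_left_mono[of _ C \<epsilon>]])
      have "(\<integral>x. G x \<partial>p k) - (\<integral>x. G x \<partial>q) =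
          ((\<integral>x. G x \<partial>p k) - (\<Sum>x\<in>J. pmf (p k) x *\<^sub>R G x)) -
          ((\<integral>x. G x \<partial>q) - (\<Sum>x\<in>J. pmf q x *\<^sub>R G x)) +
          ((\<Sum>x\<in>J. pmf (p k) x *\<^sub>R G x) - (\<Sum>x\<in>J. pmf q x *\<^sub>R G x))"
        by simp
      also have "norm \<dots> \<le> e / 4 + e / 4 + (\<Sum>x\<in>J. \<bar>pmf (p k) x - pmf q x\<bar> * S x)"
      proof -
        have "norm (X - Y + Z) \<le> norm X + norm Y + norm Z" for X Y Z :: complex
          using norm_triangle_ineq[of "X - Y" Z] norm_triangle_ineq4[of X Y] by linarith
        then show ?thesis
          by (rule order_trans) (intro add_mono; use 1 2 3 4 in linarith)
      qed
      also have "\<dots> < e" using elim(2) e by simp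
      finally show "norm ((\<integral>x. G x \<partial>p k) - (\<integral>x. G x \<partial>q)) < e" .
    qed
  qed
qed

lemma finite_power_ratio:
  fixes r s :: real
  assumes "1 \<le> s" "s < r" "\<epsilon> > 0"
  shows "finite {x :: nat \<times> nat. \<epsilon> * r ^ (fst x + snd x) < s ^ (fst x + snd x)}"
proof -
  obtain T where T: "1 / \<epsilon> < (r / s) ^ T"
    using real_arch_pow[of "r / s" "1 / \<epsilon>"] assms by (auto simp: field_simps)
  have "fst x + snd x < T" if "\<epsilon> * r ^ (fst x + snd x) < s ^ (fst x + snd x)" for x :: "nat \<times> nat"
  proof (rule ccontr)
    assume "\<not> fst x + snd x < T"
    then have "(r / s) ^ T \<le> (r / s) ^ (fst x + snd x)"
      using assms by (intro power_increasing) (auto simp: field_simps)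
    moreover have "(r / s) ^ (fst x + snd x) < 1 / \<epsilon>"
      using that assms by (simp add: power_divide field_simps)
    ultimately show False using T by linarith
  qed
  then have "{x :: nat \<times> nat. \<epsilon> * r ^ (fst x + snd x) < s ^ (fst x + snd x)} \<subseteq> {..T} \<times> {..T}"
    by fastforce
  then show ?thesis by (rule finite_subset) simp
qed

section \<open>The rank of the chosen key and the joint limit law\<close>

definition rank_pmf :: "real \<Rightarrow> nat pmf" where
  "rank_pmf \<mu> = bind_pmf (poisson_pmf \<mu>) (\<lambda>u. pmf_of_set {..u})"

text \<open>For Poisson weights p(u)/(u + 1) = p(u + 1)/\<mu>, which turns the average of the
  uniform laws over u \<ge> v into the tail beyond v.\<close>

lemma pmf_rank_pmf:
  assumes "\<mu> > 0"
  shows "pmf (rank_pmf \<mu>) v = measure (poisson_pmf \<mu>) {v<..} / \<mu>"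
proof -
  have "(\<lambda>u. pmf (poisson_pmf \<mu>) u *\<^sub>R pmf (pmf_of_set {..u}) v) sums pmf (rank_pmf \<mu>) v"
    unfolding rank_pmf_def pmf_bind
    by (rule integral_pmf_nat, rule measure_pmf.integrable_const_bound[where B = 1])
       (simp_all add: pmf_le_1 del: pmf_of_set)
  moreover have "pmf (poisson_pmf \<mu>) u *\<^sub>R pmf (pmf_of_set {..u}) v =
      pmf (poisson_pmf \<mu>) (Suc u) *\<^sub>R indicator {v<..} (Suc u) / \<mu>" for u
    using assms by (auto simp: indicator_def divide_inverse mult_ac)
  ultimately have 1: "(\<lambda>u. pmf (poisson_pmf \<mu>) (Suc u) *\<^sub>R indicator {v<..} (Suc u) / \<mu>) sums pmf (rank_pmf \<mu>) v"
    by simp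
  have "(\<lambda>u. pmf (poisson_pmf \<mu>) u *\<^sub>R indicator {v<..} u) sums measure (poisson_pmf \<mu>) {v<..}"
  proof -
    have "integrable (poisson_pmf \<mu>) (indicat_real {v<..})"
      by (rule measure_pmf.integrable_const_bound[where B = 1]) (auto simp: indicator_def)
    from integral_pmf_nat[OF this] show ?thesis by simp
  qed
  then have "(\<lambda>u. pmf (poisson_pmf \<mu>) (Suc u) *\<^sub>R indicator {v<..} (Suc u)) sums measure (poisson_pmf \<mu>) {v<..}"
    using sums_Suc_iff[of "\<lambda>u. pmf (poisson_pmf \<mu>) u *\<^sub>R indicat_real {v<..} u"] by simp
  from sums_divide[OF this, of \<mu>] sums_unique2[OF 1] show ?thesis by simp
qed

definition exact_pmf :: "nat \<Rightarrow> nat \<Rightarrow> nat \<Rightarrow> (nat \<times> nat) pmf" where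
  "exact_pmf b m n = map_pmf (\<lambda>w. (V_exact w, Q_exact b m n w)) (pmf_of_set (({..<n} \<rightarrow>\<^sub>E {..<m}) \<times> {..<n}))"

lemma integral_exact_pmf:
  fixes G :: "nat \<times> nat \<Rightarrow> 'a :: {banach, second_countable_topology}"
  shows "(\<integral>z. G z \<partial>exact_pmf b m n) = (\<integral>w. G (V_exact w, Q_exact b m n w) \<partial>hash_model m n)"
  unfolding exact_pmf_def hash_model_def by simp

lemma finite_set_exact_pmf: "m > 0 \<Longrightarrow> n > 0 \<Longrightarrow> finite (set_pmf (exact_pmf b m n))"
  using hash_nonempty[of m n] unfolding exact_pmf_def
  by (subst set_map_pmf, subst set_pmf_of_set) (auto simp: finite_hash)

lemma finite_set_occ_pmf: "m > 0 \<Longrightarrow> finite (set_pmf (occ_pmf b m n))"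
  using hash_nonempty[of m n] unfolding occ_pmf_def
  by (subst set_map_pmf, subst set_pmf_of_set) (auto simp: finite_hash)

text \<open>By \<open>integral_hash_model\<close>, rank v and overflow w have m/n times the
  probability that bucket 0 holds more than v keys and receives overflow w. For the moments, the sum
  of r^v over v < N is at most r^N/(r - 1).\<close>

lemma exact_pmf_limit:
  assumes "\<mu> > 0" and lim: "occ_limit \<mu> m n" and r: "r > 1" "exp ((r - 1) * \<mu>) < r ^ b"
    and q: "\<And>w. (\<lambda>K. pmf (queue_pmf b \<mu> K) w) \<longlonglongrightarrow> pmf q w"
  shows "(\<lambda>k. pmf (exact_pmf b (m k) (n k)) x) \<longlonglongrightarrow> pmf (pair_pmf (rank_pmf \<mu>) q) x"
    and "\<exists>B. eventually (\<lambda>k. integrable (exact_pmf b (m k) (n k)) (\<lambda>x. r ^ (fst x + snd x)) \<and>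
        (\<integral>x. r ^ (fst x + snd x) \<partial>exact_pmf b (m k) (n k)) \<le> B) sequentially"
proof -
  have m: "filterlim m at_top sequentially" and n: "filterlim n at_top sequentially"
    and rat: "(\<lambda>k. real (n k) / real (m k)) \<longlonglongrightarrow> \<mu>"
    using lim unfolding occ_limit_def by auto
  have pos: "eventually (\<lambda>k. m k > 0) sequentially" "eventually (\<lambda>k. n k > 0) sequentially"
    using eventually_compose_filterlim[OF eventually_gt_at_top[of 0] m]
      eventually_compose_filterlim[OF eventually_gt_at_top[of 0] n] by auto
  have rat': "(\<lambda>k. real (m k) / real (n k)) \<longlonglongrightarrow> 1 / \<mu>"
    using tendsto_divide[OF tendsto_const[of 1] rat] assms(1) by simp
  obtain B where B: "\<And>u w. (\<lambda>k. occ_exp (m k) (n k) (\<lambda>y. of_bool (y 0 = u \<and> lindley b (m k - 1) (\<lambda>i. y (Suc i)) = w)))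
      \<longlonglongrightarrow> pmf (poisson_pmf \<mu>) u * pmf q w"
    "eventually (\<lambda>k. occ_exp (m k) (n k) (\<lambda>y. r ^ (y 0 + lindley b (m k - 1) (\<lambda>i. y (Suc i)))) \<le> B) sequentially"
    using occ_full_limit[OF assms(1,2) less_imp_le[OF r(1)] r(2) q] by blast
  have occ_lim: "(\<lambda>k. pmf (occ_pmf b (m k) (n k)) x) \<longlonglongrightarrow> pmf (pair_pmf (poisson_pmf \<mu>) q) x" for x
  proof -
    obtain u w where x: "x = (u, w)" by fastforce
    have "eventually (\<lambda>k. occ_exp (m k) (n k) (\<lambda>y. of_bool (y 0 = u \<and> lindley b (m k - 1) (\<lambda>i. y (Suc i)) = w)) =
       pmf (occ_pmf b (m k) (n k)) x) sequentially"
      using pos(1) by eventually_elim (simp add: pmf_occ_pmf x)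
    from Lim_transform_eventually[OF B(1) this] show ?thesis
      by (simp add: x pmf_pair)
  qed
  have occ_bnd: "eventually (\<lambda>k. integrable (occ_pmf b (m k) (n k)) (\<lambda>x. r ^ (fst x + snd x)) \<and>
      (\<integral>x. r ^ (fst x + snd x) \<partial>occ_pmf b (m k) (n k)) \<le> B) sequentially"
    using B(2) pos(1)
    by eventually_elim (auto simp: integral_occ_pmf_real intro: integrable_measure_pmf_finite finite_set_occ_pmf)
  show "(\<lambda>k. pmf (exact_pmf b (m k) (n k)) x) \<longlonglongrightarrow> pmf (pair_pmf (rank_pmf \<mu>) q) x"
  proof -
    obtain v w where x: "x = (v, w)" by fastforce
    \<comment> \<open>This set of pairs is infinite, so pointwise limits of the pmfs are not enough;
      \<open>pmf_limit_uniform\<close> is applied with S = 1.\<close>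
    define G :: "nat \<times> nat \<Rightarrow> complex" where "G = indicator ({v<..} \<times> {w})"
    have "(\<lambda>k. (\<integral>z. G z \<partial>occ_pmf b (m k) (n k))) \<longlonglongrightarrow> (\<integral>z. G z \<partial>pair_pmf (poisson_pmf \<mu>) q)"
    proof (rule tendstoI)
      fix e :: real assume "e > 0"
      have "eventually (\<lambda>k. \<forall>G :: nat \<times> nat \<Rightarrow> complex. (\<forall>x. norm (G x) \<le> 1 ^ (fst x + snd x)) \<longrightarrow>
         norm ((\<integral>x. G x \<partial>occ_pmf b (m k) (n k)) - (\<integral>x. G x \<partial>pair_pmf (poisson_pmf \<mu>) q)) < e) sequentially"
        by (rule pmf_limit_uniform[OF occ_lim occ_bnd])
           (use r finite_power_ratio[of 1 r] \<open>e > 0\<close> in auto)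
      then show "eventually (\<lambda>k. dist (\<integral>z. G z \<partial>occ_pmf b (m k) (n k)) (\<integral>z. G z \<partial>pair_pmf (poisson_pmf \<mu>) q) < e) sequentially"
        by eventually_elim (auto simp: dist_norm G_def indicator_def)
    qed
    from tendsto_mult[OF tendsto_of_real[OF rat'] this]
    have lim2: "(\<lambda>k. of_real (real (m k) / real (n k)) * (\<integral>z. G z \<partial>occ_pmf b (m k) (n k))) \<longlonglongrightarrow>
        complex_of_real (1 / \<mu>) * (\<integral>z. G z \<partial>pair_pmf (poisson_pmf \<mu>) q)" .
    have ind: "(\<integral>z. indicator A z \<partial>measure_pmf p) = complex_of_real (measure p A)" for A and p :: "(nat \<times> nat) pmf"
    proof -
      have "(\<integral>z. indicator A z \<partial>measure_pmf p) = (\<integral>z. complex_of_real (indicator A z) \<partial>measure_pmf p)"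
        by (intro Bochner_Integration.integral_cong) (auto simp: indicator_def)
      then show ?thesis by (simp add: integral_complex_of_real)
    qed
    have "measure (pair_pmf (poisson_pmf \<mu>) q) ({v<..} \<times> {w}) = measure (poisson_pmf \<mu>) {v<..} * pmf q w"
      by (subst measure_pmf_prob_product) (auto simp: measure_pmf_single)
    then have lim3: "complex_of_real (1 / \<mu>) * (\<integral>z. G z \<partial>pair_pmf (poisson_pmf \<mu>) q) =
        of_real (pmf (pair_pmf (rank_pmf \<mu>) q) x)"
      unfolding G_def ind by (simp add: x pmf_pair pmf_rank_pmf[OF assms(1)])
    have "eventually (\<lambda>k. of_real (real (m k) / real (n k)) * (\<integral>z. G z \<partial>occ_pmf b (m k) (n k)) =
        complex_of_real (pmf (exact_pmf b (m k) (n k)) x)) sequentially"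
      using pos
    proof eventually_elim
      case (elim k)
      have "complex_of_real (pmf (exact_pmf b (m k) (n k)) x) = (\<integral>z. indicator {x} z \<partial>exact_pmf b (m k) (n k))"
        unfolding ind by (simp add: measure_pmf_single)
      also have "\<dots> = of_real (real (m k) / real (n k)) *
          (\<integral>z. (\<Sum>v'<fst z. indicator {x} (v', snd z)) \<partial>occ_pmf b (m k) (n k))"
        unfolding integral_exact_pmf using integral_hash_model[OF elim, of "\<lambda>v w. indicator {x} (v, w)" b] by simp
      also have "(\<lambda>z. \<Sum>v'<fst z. indicator {x} (v', snd z)) = G"
        by (auto simp: fun_eq_iff G_def x indicator_def sum.If_cases)
      finally show ?case ..
    qed
    from Lim_transform_eventually[OF lim2 this] lim3 show ?thesis
      by (simp add: tendsto_of_real_iff)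
  qed
  have "eventually (\<lambda>k. real (m k) / real (n k) < 1 / \<mu> + 1) sequentially"
    by (rule order_tendstoD(2)[OF rat']) simp
  then have "eventually (\<lambda>k. integrable (exact_pmf b (m k) (n k)) (\<lambda>x. r ^ (fst x + snd x)) \<and>
        (\<integral>x. r ^ (fst x + snd x) \<partial>exact_pmf b (m k) (n k)) \<le> (1 / \<mu> + 1) * (B / (r - 1))) sequentially"
    using pos occ_bnd
  proof eventually_elim
    case (elim k)
    define I where "I = (\<integral>x. r ^ (fst x + snd x) \<partial>exact_pmf b (m k) (n k))"
    have geo: "(\<Sum>v<u. r ^ (v + w)) \<le> r ^ (u + w) / (r - 1)" for u w
    proof -
      have "(\<Sum>v<u. r ^ (v + w)) = (r ^ u - 1) / (r - 1) * r ^ w"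
        using r by (simp add: power_add sum_distrib_right[symmetric] geometric_sum)
      also have "\<dots> \<le> r ^ (u + w) / (r - 1)"
        using r by (simp add: power_add divide_right_mono field_simps)
      finally show ?thesis .
    qed
    have fo: "finite (set_pmf (occ_pmf b (m k) (n k)))" by (rule finite_set_occ_pmf[OF elim(2)])
    have "complex_of_real I = of_real (real (m k) / real (n k)) *
        (\<integral>z. (\<Sum>v<fst z. complex_of_real (r ^ (v + snd z))) \<partial>occ_pmf b (m k) (n k))"
      unfolding I_def integral_complex_of_real[symmetric] integral_exact_pmf
      using integral_hash_model[OF elim(2,3), of "\<lambda>v w. of_real (r ^ (v + w))" b] by simp
    also have "\<dots> = of_real (real (m k) / real (n k) * (\<integral>z. (\<Sum>v<fst z. r ^ (v + snd z)) \<partial>occ_pmf b (m k) (n k)))"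
      by (simp only: of_real_sum[symmetric] integral_complex_of_real of_real_mult)
    finally have I: "I = real (m k) / real (n k) * (\<integral>z. (\<Sum>v<fst z. r ^ (v + snd z)) \<partial>occ_pmf b (m k) (n k))"
      by (simp only: of_real_eq_iff)
    have "(\<integral>z. (\<Sum>v<fst z. r ^ (v + snd z)) \<partial>occ_pmf b (m k) (n k)) \<le>
        (\<integral>z. r ^ (fst z + snd z) / (r - 1) \<partial>occ_pmf b (m k) (n k))"
      using fo geo by (intro integral_mono integrable_measure_pmf_finite) auto
    also have "\<dots> = (\<integral>z. r ^ (fst z + snd z) \<partial>occ_pmf b (m k) (n k)) / (r - 1)" by simp
    also have "\<dots> \<le> B / (r - 1)" using elim(4) r by (intro divide_right_mono) auto
    finally have J: "(\<integral>z. (\<Sum>v<fst z. r ^ (v + snd z)) \<partial>occ_pmf b (m k) (n k)) \<le> B / (r - 1)" .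
    have "0 \<le> (\<integral>z. (\<Sum>v<fst z. r ^ (v + snd z)) \<partial>occ_pmf b (m k) (n k))"
      using r by (intro integral_nonneg_AE AE_I2 sum_nonneg) auto
    then have "I \<le> (1 / \<mu> + 1) * (B / (r - 1))"
      unfolding I using elim(1) J assms(1) by (intro mult_mono) auto
    then show ?case
      using finite_set_exact_pmf[OF elim(2,3)] by (auto simp: I_def intro: integrable_measure_pmf_finite)
  qed
  then show "\<exists>B. eventually (\<lambda>k. integrable (exact_pmf b (m k) (n k)) (\<lambda>x. r ^ (fst x + snd x)) \<and>
        (\<integral>x. r ^ (fst x + snd x) \<partial>exact_pmf b (m k) (n k)) \<le> B) sequentially"
    by blast
qed

lemma exact_limit_uniform:
  assumes "\<mu> > 0" and "occ_limit \<mu> m n" and "r > 1" "exp ((r - 1) * \<mu>) < r ^ b"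
    and "\<And>w. (\<lambda>K. pmf (queue_pmf b \<mu> K) w) \<longlonglongrightarrow> pmf q w"
    and s: "1 \<le> s" "s < r" and "e > 0"
  shows "eventually (\<lambda>k. \<forall>G :: nat \<times> nat \<Rightarrow> complex. (\<forall>x. norm (G x) \<le> s ^ (fst x + snd x)) \<longrightarrow>
     norm ((\<integral>w. G (V_exact w, Q_exact b (m k) (n k) w) \<partial>hash_model (m k) (n k)) -
       (\<integral>x. G x \<partial>pair_pmf (rank_pmf \<mu>) q)) < e) sequentially"
proof -
  obtain B where B: "eventually (\<lambda>k. integrable (exact_pmf b (m k) (n k)) (\<lambda>x. r ^ (fst x + snd x)) \<and>
        (\<integral>x. r ^ (fst x + snd x) \<partial>exact_pmf b (m k) (n k)) \<le> B) sequentially"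
    using exact_pmf_limit(2)[OF assms(1-5)] by blast
  show ?thesis
    unfolding integral_exact_pmf[symmetric]
    by (rule pmf_limit_uniform[OF exact_pmf_limit(1)[OF assms(1-5)] B])
       (use s assms(8) finite_power_ratio[OF s] in \<open>auto intro: power_mono\<close>)
qed

section \<open>The tree function and roots of unity\<close>

text \<open>The n-th difference of a polynomial of degree j < n. One factor x + k is split: x leaves
  a lower power, while k (n choose k) = n (n - 1 choose k - 1) lowers n and moves x to x +
  1.\<close>

lemma alternating_binomial_power_sum:
  fixes x :: real
  assumes "j < n"
  shows "(\<Sum>k\<le>n. (-1) ^ k * real (n choose k) * (x + real k) ^ j) = 0"
  using assms
proof (induction j arbitrary: n x)
  case 0
  then show ?case using choose_alternating_sum[of n, where 'a = real] by simp
next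
  case (Suc j)
  obtain n' where n: "n = Suc n'" using Suc.prems by (cases n) auto
  have "(\<Sum>k\<le>n. (-1) ^ k * real (n choose k) * (x + real k) ^ Suc j) =
     x * (\<Sum>k\<le>n. (-1) ^ k * real (n choose k) * (x + real k) ^ j) +
     (\<Sum>k\<le>n. (-1) ^ k * (real k * real (n choose k)) * (x + real k) ^ j)"
    by (simp add: sum_distrib_left sum.distrib[symmetric] algebra_simps)
  also have "(\<Sum>k\<le>n. (-1) ^ k * real (n choose k) * (x + real k) ^ j) = 0"
    using Suc by simp
  also have "(\<Sum>k\<le>n. (-1) ^ k * (real k * real (n choose k)) * (x + real k) ^ j) =
     (\<Sum>k\<le>n'. (-1) ^ Suc k * (real (Suc k * (Suc n' choose Suc k))) * (x + real (Suc k)) ^ j)"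
    unfolding n by (subst sum.atMost_Suc_shift) (simp add: algebra_simps del: binomial_Suc_Suc)
  also have "\<dots> = - real n * (\<Sum>k\<le>n'. (-1) ^ k * real (n' choose k) * ((x + 1) + real k) ^ j)"
    unfolding Suc_times_binomial n by (simp add: sum_distrib_left algebra_simps sum_negf)
  also have "(\<Sum>k\<le>n'. (-1) ^ k * real (n' choose k) * ((x + 1) + real k) ^ j) = 0"
    using Suc.prems n by (intro Suc.IH) simp
  finally show ?case by simp
qed

text \<open>Abel's binomial identity \<open>\<Sum>k. C(n,k) x (x+k)^(k-1) (y+n-k)^(n-k) = (x+y+n)^n\<close> at \<open>x = 1\<close>. Both
  sides have the same derivative in \<open>y\<close> by induction, and for \<open>y = -1-n\<close> the left-hand side is an
  \<open>n\<close>-th difference of a polynomial of degree \<open>n-1\<close>.\<close>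

lemma abel_binomial:
  fixes y :: real
  shows "(\<Sum>k\<le>n. real (n choose k) * (1 + real k) ^ (k - 1) * (y + real (n - k)) ^ (n - k)) = (1 + y + real n) ^ n"
proof (induction n arbitrary: y)
  case 0
  show ?case by simp
next
  case (Suc n)
  define f where "f y = (\<Sum>k\<le>Suc n. real (Suc n choose k) * (1 + real k) ^ (k - 1) *
     (y + real (Suc n - k)) ^ (Suc n - k)) - (1 + y + real (Suc n)) ^ Suc n" for y :: real
  have "(f has_real_derivative 0) (at y)" for y
  proof -
    have "(f has_real_derivative ((\<Sum>k\<le>Suc n. real (Suc n choose k) * (1 + real k) ^ (k - 1) *
       (real (Suc n - k) * (y + real (Suc n - k)) ^ (Suc n - k - 1))) - real (Suc n) * (1 + y + real (Suc n)) ^ n)) (at y)"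
    proof -
      have pw: "((\<lambda>y. c * (y + d) ^ m) has_real_derivative c * (real m * (y + d) ^ (m - 1))) (at y)" for c d m
        by (auto intro!: derivative_eq_intros)
      have "((\<lambda>y. (1 + y + real (Suc n)) ^ Suc n) has_real_derivative real (Suc n) * (1 + y + real (Suc n)) ^ n) (at y)"
        using pw[of 1 "1 + real (Suc n)" "Suc n"] by (simp add: add_ac)
      then show ?thesis unfolding f_def by (intro DERIV_diff DERIV_sum pw)
    qed
    also have "(\<Sum>k\<le>Suc n. real (Suc n choose k) * (1 + real k) ^ (k - 1) *
       (real (Suc n - k) * (y + real (Suc n - k)) ^ (Suc n - k - 1))) =
       (\<Sum>k\<le>n. real (Suc n) * (real (n choose k) * (1 + real k) ^ (k - 1) * ((y + 1) + real (n - k)) ^ (n - k)))"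
    proof -
      have eq: "real (Suc n choose k) * (1 + real k) ^ (k - 1) *
          (real (Suc n - k) * (y + real (Suc n - k)) ^ (Suc n - k - 1)) =
          real (Suc n) * (real (n choose k) * (1 + real k) ^ (k - 1) * ((y + 1) + real (n - k)) ^ (n - k))"
        if k: "k \<le> n" for k
      proof -
        have 1: "real (Suc n choose k) * real (Suc n - k) = real (Suc n) * real (n choose k)"
          using arg_cong[OF binomial_absorb_comp[of "Suc n" k], of real]
          by (simp only: of_nat_mult diff_Suc_1 mult.commute)
        have 2: "y + real (Suc n - k) = (y + 1) + real (n - k)" "Suc n - k - 1 = n - k"
          using k by (auto simp: of_nat_diff)
        have "a * p * (c * e) = d * (f * p * e)" if "a * c = d * f" for a p c d e f :: real
          using arg_cong[OF that, of "\<lambda>t. t * (p * e)"] by (simp only: mult_ac)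
        from this[OF 1] show ?thesis unfolding 2 .
      qed
      show ?thesis
        by (simp only: sum.atMost_Suc diff_self_eq_0 of_nat_0 mult_zero_left mult_zero_right add_0_right)
           (intro sum.cong refl eq, simp)
    qed
    also have "\<dots> = real (Suc n) * (1 + (y + 1) + real n) ^ n"
      unfolding sum_distrib_left[symmetric] Suc.IH ..
    finally show ?thesis by (simp add: algebra_simps)
  qed
  then have "f y = f (- 1 - real (Suc n))"
    using DERIV_isconst_all by blast
  also have "\<dots> = 0"
  proof -
    have "real (Suc n choose k) * (1 + real k) ^ (k - 1) * (- 1 - real (Suc n) + real (Suc n - k)) ^ (Suc n - k) =
       (-1) ^ Suc n * ((-1) ^ k * real (Suc n choose k) * (1 + real k) ^ n)" if "k \<le> Suc n" for k
    proof -
      \<comment> \<open>At this y the base of the last power is -(1 + k), so the two powers of 1 + k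
        combine to exponent n, whatever k is.\<close>
      have "- 1 - real (Suc n) + real (Suc n - k) = (-1) * (1 + real k)" using that by (simp add: of_nat_diff)
      then have "(- 1 - real (Suc n) + real (Suc n - k)) ^ (Suc n - k) = (-1) ^ (Suc n - k) * (1 + real k) ^ (Suc n - k)"
        by (simp only: power_mult_distrib)
      \<comment> \<open>For k = 0 the exponent \<open>k - 1\<close> is 0 instead of -1, which is
        harmless because the base is 1.\<close>
      moreover have "(1 + real k) ^ (k - 1) * (1 + real k) ^ (Suc n - k) = (1 + real k) ^ n"
        using that by (cases k) (simp_all flip: power_add)
      moreover have "(-1 :: real) ^ (Suc n - k) = (-1) ^ Suc n * (-1) ^ k"
        using that by (simp add: neg_one_power_add_eq_neg_one_power_diff[symmetric] flip: power_add)
      ultimately show ?thesis by (simp add: mult_ac)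
    qed
    then have "f (- 1 - real (Suc n)) =
        (-1) ^ Suc n * (\<Sum>k\<le>Suc n. (-1) ^ k * real (Suc n choose k) * (1 + real k) ^ n)"
      unfolding f_def by (simp add: sum_distrib_left del: sum.atMost_Suc)
    also have "\<dots> = 0"
      using alternating_binomial_power_sum[of n "Suc n" 1] by simp
    finally show ?thesis .
  qed
  finally show ?case unfolding f_def by simp
qed

section \<open>The functional equation of the tree function\<close>

definition tree_quot :: "complex fps" where
  "tree_quot = Abs_fps (\<lambda>n. of_nat (Suc n) ^ n / fact (Suc n))"

text \<open>With U = T(z)/z for \<open>tree_quot\<close>, T = z exp(T) reads U = exp(zU), and this
  is its logarithmic derivative. The coefficient of z^n is Abel's identity at y = 1.\<close>

lemma tree_quot_deriv: "fps_deriv tree_quot = tree_quot * fps_deriv (fps_X * tree_quot)"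
proof (rule fps_ext)
  fix n
  have X_deriv: "fps_nth (fps_deriv (fps_X * tree_quot)) j = of_real ((1 + real j) ^ j / fact j)" for j
  proof -
    have "fps_nth (fps_deriv (fps_X * tree_quot)) j = of_nat (Suc j) * fps_nth tree_quot j"
      by (simp add: algebra_simps)
    also have "\<dots> = of_nat (Suc j) ^ j / fact j"
      by (simp add: tree_quot_def del: of_nat_Suc)
    finally show ?thesis by (simp add: add_ac)
  qed
  have "fps_nth (fps_deriv tree_quot) n = of_nat (n + 2) ^ n / fact n"
    by (simp add: tree_quot_def field_simps del: of_nat_Suc)
  also have "of_nat (n + 2) ^ n = complex_of_real ((1 + 1 + real n) ^ n)"
    by (simp add: add_ac)
  also have "\<dots> = of_real (\<Sum>k\<le>n. real (n choose k) * (1 + real k) ^ (k - 1) * (1 + real (n - k)) ^ (n - k))"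
    unfolding abel_binomial ..
  also have "\<dots> / fact n = (\<Sum>k\<le>n. fps_nth tree_quot k * fps_nth (fps_deriv (fps_X * tree_quot)) (n - k))"
    unfolding of_real_sum sum_divide_distrib
  proof (intro sum.cong refl)
    fix k assume "k \<in> {..n}"
    then have k: "k \<le> n" by simp
    have 1: "fps_nth tree_quot k = of_real ((1 + real k) ^ (k - 1) / fact k)"
      by (cases k) (simp_all add: tree_quot_def field_simps del: of_nat_Suc, simp)
    have 2: "fps_nth (fps_deriv (fps_X * tree_quot)) (n - k) = of_real ((1 + real (n - k)) ^ (n - k) / fact (n - k))"
      by (simp only: X_deriv)
    have "of_real (real (n choose k)) / fact n = (1 / (fact k * fact (n - k)) :: complex)"
      using k by (simp add: binomial_fact)
    then show "complex_of_real (real (n choose k) * (1 + real k) ^ (k - 1) * (1 + real (n - k)) ^ (n - k)) / fact n =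
        fps_nth tree_quot k * fps_nth (fps_deriv (fps_X * tree_quot)) (n - k)"
      unfolding 1 2 by (simp add: field_simps)
  qed
  also have "\<dots> = fps_nth (tree_quot * fps_deriv (fps_X * tree_quot)) n"
    by (simp add: fps_mult_nth atLeast0AtMost)
  finally show "fps_nth (fps_deriv tree_quot) n = fps_nth (tree_quot * fps_deriv (fps_X * tree_quot)) n" .
qed

text \<open>A single term of the exponential series gives N^N/N! \<le> e^N, here with N = n +
  1.\<close>

lemma tree_quot_norm_le: "norm (fps_nth tree_quot n) \<le> exp 1 * exp 1 ^ n"
proof -
  have "real (Suc n) ^ Suc n / fact (Suc n) \<le> exp (real (Suc n))"
    using sum_le_suminf[OF summable_exp_generic[of "real (Suc n)"], of "{Suc n}"]
    by (simp add: exp_def divide_inverse mult.commute)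
  moreover have "real (Suc n) ^ n \<le> real (Suc n) ^ Suc n" by (intro power_increasing) auto
  then have "real (Suc n) ^ n / fact (Suc n) \<le> real (Suc n) ^ Suc n / fact (Suc n)"
    by (intro divide_right_mono) auto
  moreover have "exp (real (Suc n)) = exp 1 * exp 1 ^ n"
    by (simp add: exp_add exp_of_nat_mult[symmetric])
  moreover have "norm (fps_nth tree_quot n) = real (Suc n) ^ n / fact (Suc n)"
    by (simp add: tree_quot_def norm_divide norm_power del: of_nat_Suc fact_Suc)
  ultimately show ?thesis by linarith
qed

lemma tree_quot_conv_radius: "fps_conv_radius tree_quot \<ge> exp (-1)"
  unfolding fps_conv_radius_def
proof (rule conv_radius_geI_ex)
  fix r :: real assume r: "0 < r" "ereal r < ereal (exp (-1))"
  have lt: "exp 1 * r < 1" using r(2) by (simp add: exp_minus field_simps)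
  have "summable (\<lambda>n. fps_nth tree_quot n * of_real r ^ n)"
  proof (rule summable_comparison_test')
    show "summable (\<lambda>n. exp 1 * (exp 1 * r) ^ n)"
      using lt r(1) by (intro summable_mult summable_geometric) auto
    show "norm (fps_nth tree_quot n * of_real r ^ n) \<le> exp 1 * (exp 1 * r) ^ n" for n
      using mult_right_mono[OF tree_quot_norm_le[of n], of "r ^ n"] r(1)
      by (simp add: norm_mult norm_power power_mult_distrib mult_ac)
  qed
  then show "\<exists>z. norm z = r \<and> summable (\<lambda>n. fps_nth tree_quot n * z ^ n)"
    using r(1) by (intro exI[of _ "of_real r"]) simp
qed

lemma less_tree_quot_conv_radius:
  "norm z < exp (-1) \<Longrightarrow> ereal (norm z) < fps_conv_radius tree_quot"
  by (rule less_le_trans[OF _ tree_quot_conv_radius]) simp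

lemma tree_fun_eval:
  assumes "norm z < exp (-1)"
  shows "(\<lambda>n. of_nat (Suc n) ^ n * z ^ Suc n / fact (Suc n)) sums (z * eval_fps tree_quot z)"
    and "tree_fun z = z * eval_fps tree_quot z"
proof -
  from sums_mult[OF sums_eval_fps[OF less_tree_quot_conv_radius[OF assms]], of z]
  show "(\<lambda>n. of_nat (Suc n) ^ n * z ^ Suc n / fact (Suc n)) sums (z * eval_fps tree_quot z)"
    by (simp add: tree_quot_def mult_ac del: of_nat_Suc fact_Suc)
  then show "tree_fun z = z * eval_fps tree_quot z"
    unfolding tree_fun_def by (rule sums_unique[symmetric])
qed

text \<open>U exp(-zU) has derivative 0 on the disc by \<open>tree_quot_deriv\<close>, and value 1
  at the origin.\<close>

lemma tree_fun_equation:
  assumes "norm z < exp (-1)"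
  shows "tree_fun z = z * exp (tree_fun z)"
proof -
  define D where "D = ball (0 :: complex) (exp (-1))"
  define T where "T = fps_X * tree_quot"
  have rU: "ereal (norm w) < fps_conv_radius tree_quot" if "w \<in> D" for w
    using that by (intro less_tree_quot_conv_radius) (simp add: D_def)
  have rT: "fps_conv_radius tree_quot \<le> fps_conv_radius T"
    unfolding T_def using fps_conv_radius_mult[of fps_X tree_quot] by simp
  have eT: "eval_fps T w = w * eval_fps tree_quot w" if "w \<in> D" for w
    unfolding T_def using rU[OF that] by (subst eval_fps_mult) auto
  have "((\<lambda>w. eval_fps tree_quot w * exp (- eval_fps T w)) has_field_derivative 0) (at w within D)"
    if w: "w \<in> D" for w
  proof -
    have "eval_fps (fps_deriv tree_quot) w = eval_fps tree_quot w * eval_fps (fps_deriv T) w"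
      unfolding tree_quot_deriv T_def[symmetric] using rU[OF w] rT
      by (intro eval_fps_mult) (auto intro: less_le_trans[OF _ fps_conv_radius_deriv])
    then show ?thesis
      using rU[OF w] less_le_trans[OF rU[OF w] rT]
      by (auto intro!: derivative_eq_intros has_field_derivative_eval_fps simp: in_eball_iff)
  qed
  from has_field_derivative_zero_constant[OF _ this]
  obtain c where c: "\<And>w. w \<in> D \<Longrightarrow> eval_fps tree_quot w * exp (- eval_fps T w) = c"
    unfolding D_def by auto
  have "c = 1"
    using c[of 0] by (simp add: D_def eval_fps_at_0 T_def tree_quot_def)
  moreover have zD: "z \<in> D" using assms by (simp add: D_def)
  ultimately have "eval_fps tree_quot z = exp (tree_fun z)"
    using c[OF zD] eT[OF zD] tree_fun_eval(2)[OF assms] by (simp add: exp_minus field_simps)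
  then show ?thesis using tree_fun_eval(2)[OF assms] by simp
qed

text \<open>The strict maximum of x exp(-x) is at 1; this puts \<alpha> exp(-\<alpha>) inside the
  disc of convergence.\<close>

lemma less_exp_minus_one:
  fixes x :: real
  assumes "0 < x" "x \<noteq> 1"
  shows "x * exp (- x) < exp (-1)"
proof -
  have "ln x < x - 1"
    using ln_le_minus_one[OF assms(1)] ln_eq_minus_one[OF assms(1)] assms(2) by fastforce
  then have "x < exp (x - 1)" using assms(1) by (metis exp_less_mono exp_ln)
  then show ?thesis by (simp add: exp_diff exp_minus field_simps)
qed

text \<open>Nonnegative coefficients reduce the claim to T(x) \<le> \<alpha> at x = \<alpha>
  exp(-\<alpha>). There the equation t = x exp(t) has a second solution above 1; continuity from
  T(0) = 0 selects the right branch.\<close>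

lemma norm_tree_fun_le:
  assumes \<alpha>: "0 < \<alpha>" "\<alpha> < 1" and z: "norm z = \<alpha> * exp (- \<alpha>)"
  shows "norm (tree_fun z) \<le> \<alpha>"
proof -
  define x where "x = \<alpha> * exp (- \<alpha>)"
  have x: "0 < x" "x < exp (-1)" using \<alpha> less_exp_minus_one[of \<alpha>] by (auto simp: x_def)
  define t where "t y = Re (tree_fun (of_real y))" for y :: real
  have t_sums: "(\<lambda>n. real (Suc n) ^ n * y ^ Suc n / fact (Suc n)) sums t y"
    and t_eq: "of_real (t y) = tree_fun (of_real y)" if "0 \<le> y" "y \<le> x" for y
  proof -
    have "norm (complex_of_real y) < exp (-1)" using that x by simp
    from tree_fun_eval(1)[OF this]
    have s: "(\<lambda>n. of_real (real (Suc n) ^ n * y ^ Suc n / fact (Suc n))) sums tree_fun (of_real y)"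
      unfolding tree_fun_eval(2)[OF \<open>norm (complex_of_real y) < exp (-1)\<close>] by simp
    from sums_Re[OF this] show *: "(\<lambda>n. real (Suc n) ^ n * y ^ Suc n / fact (Suc n)) sums t y"
      unfolding t_def Re_complex_of_real .
    from sums_of_real[OF this, where 'a = complex] s show "of_real (t y) = tree_fun (of_real y)"
      by (rule sums_unique2)
  qed
  have t_equation: "t y = y * exp (t y)" if "0 \<le> y" "y \<le> x" for y
  proof -
    have "complex_of_real (t y) = of_real (y * exp (t y))"
      using tree_fun_equation[of "of_real y"] t_eq[OF that] that x exp_of_real[of "t y", where 'a = complex] by simp
    then show ?thesis by (simp only: of_real_eq_iff)
  qed
  have cont: "continuous_on {0..x} t"
  proof -
    have "ereal y < fps_conv_radius tree_quot" if "0 \<le> y" "y \<le> x" for y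
      using less_tree_quot_conv_radius[of "complex_of_real y"] that x by simp
    then have "continuous_on {0..x} (\<lambda>y. Re (complex_of_real y * eval_fps tree_quot (complex_of_real y)))"
      using x
      by (intro continuous_intros continuous_on_compose2[OF continuous_on_eval_fps])
         (auto simp: in_eball_iff)
    moreover have "Re (complex_of_real y * eval_fps tree_quot (complex_of_real y)) = t y" if "y \<in> {0..x}" for y
      unfolding t_def using that x by (subst tree_fun_eval(2)) auto
    ultimately show ?thesis by (subst (asm) continuous_on_cong[OF refl]) auto
  qed
  have "t x \<le> \<alpha>"
  proof (rule ccontr)
    assume "\<not> t x \<le> \<alpha>"
    moreover have "t 0 = 0" using t_equation[of 0] x by simp
    \<comment> \<open>A value above \<alpha> at x would mean the value \<alpha> at some y \<le> x;
      the equation then gives y = \<alpha> exp(-\<alpha>) = x.\<close>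
    ultimately obtain y where y: "0 \<le> y" "y \<le> x" "t y = \<alpha>"
      using IVT'[of t 0 \<alpha> x] \<alpha> x cont by auto
    then have "y = x" using t_equation[OF y(1,2)] by (simp add: x_def exp_minus field_simps)
    then show False using y \<open>\<not> t x \<le> \<alpha>\<close> by simp
  qed
  moreover have "norm (tree_fun z) \<le> t x"
  proof -
    have z': "norm z < exp (-1)" using z x by (simp add: x_def)
    have "tree_fun z = (\<Sum>n. of_nat (Suc n) ^ n * z ^ Suc n / fact (Suc n))" by (simp add: tree_fun_def)
    moreover have nrm: "norm (of_nat (Suc n) ^ n * z ^ Suc n / fact (Suc n)) = real (Suc n) ^ n * x ^ Suc n / fact (Suc n)" for n
      by (simp add: norm_mult norm_divide norm_power z x_def del: of_nat_Suc fact_Suc)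
    have "norm (\<Sum>n. of_nat (Suc n) ^ n * z ^ Suc n / fact (Suc n)) \<le> (\<Sum>n. norm (of_nat (Suc n) ^ n * z ^ Suc n / fact (Suc n)))"
      by (rule summable_norm, unfold nrm, rule sums_summable[OF t_sums]) (use x in auto)
    moreover have "(\<Sum>n. real (Suc n) ^ n * x ^ Suc n / fact (Suc n)) = t x"
      by (rule sums_unique[symmetric, OF t_sums]) (use x in auto)
    ultimately show ?thesis by (simp only: nrm)
  qed
  ultimately show ?thesis by linarith
qed

section \<open>Roots of unity and the points \<open>zeta_root\<close>\<close>

lemma root_unity_power: "root_unity b ^ l = exp (2 * of_real pi * \<i> * of_nat l / of_nat b)"
  by (simp add: root_unity_def exp_of_nat_mult[symmetric] mult_ac)

lemma norm_root_unity_power: "norm (root_unity b ^ l) = 1"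
  unfolding root_unity_def norm_power by (simp add: norm_exp_eq_Re)

lemma root_unity_power_b: "b \<ge> 1 \<Longrightarrow> root_unity b ^ b = 1"
  by (simp add: root_unity_power)

lemma root_unity_power_eq_iff:
  "j < b \<Longrightarrow> l < b \<Longrightarrow> root_unity b ^ j = root_unity b ^ l \<longleftrightarrow> j = l"
  unfolding root_unity_power by (subst complex_root_unity_eq) auto

lemma zeta_root_equation:
  assumes "0 < \<alpha>" "\<alpha> < 1"
  shows "zeta_root b \<alpha> l = root_unity b ^ l * exp (of_real \<alpha> * (zeta_root b \<alpha> l - 1))"
proof -
  define z where "z = root_unity b ^ l * of_real (\<alpha> * exp (- \<alpha>))"
  have "norm z < exp (-1)"
    using assms less_exp_minus_one[of \<alpha>] by (simp add: z_def norm_mult norm_root_unity_power)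
  from tree_fun_equation[OF this]
  have "of_real \<alpha> * zeta_root b \<alpha> l = z * exp (of_real \<alpha> * zeta_root b \<alpha> l)"
    using assms by (simp add: zeta_root_def z_def)
  then have "of_real \<alpha> * zeta_root b \<alpha> l =
      of_real \<alpha> * (root_unity b ^ l * exp (of_real \<alpha> * (zeta_root b \<alpha> l - 1)))"
    by (simp add: z_def exp_diff exp_minus exp_of_real[symmetric] field_simps)
  then show ?thesis using assms by simp
qed

lemma zeta_root_norm_le: "0 < \<alpha> \<Longrightarrow> \<alpha> < 1 \<Longrightarrow> norm (zeta_root b \<alpha> l) \<le> 1"
  using norm_tree_fun_le[of \<alpha> "root_unity b ^ l * of_real (\<alpha> * exp (- \<alpha>))"]
  by (simp add: zeta_root_def norm_mult norm_divide norm_root_unity_power)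

lemma zeta_root_power:
  assumes "0 < \<alpha>" "\<alpha> < 1" "b \<ge> 1"
  shows "zeta_root b \<alpha> l ^ b = exp (of_real (real b * \<alpha>) * (zeta_root b \<alpha> l - 1))"
proof -
  have "zeta_root b \<alpha> l ^ b = (root_unity b ^ l * exp (of_real \<alpha> * (zeta_root b \<alpha> l - 1))) ^ b"
    using zeta_root_equation[OF assms(1,2), of b l] by simp
  also have "\<dots> = (root_unity b ^ b) ^ l * exp (of_nat b * (of_real \<alpha> * (zeta_root b \<alpha> l - 1)))"
    by (simp only: power_mult_distrib exp_of_nat_mult power_mult[symmetric] mult.commute)
  finally show ?thesis using root_unity_power_b[OF assms(3)] by (simp add: mult_ac)
qed

text \<open>The equation recovers \<omega>^l from \<zeta>_l, so distinct l give distinct points, and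
  the value 1 would give \<omega>^l = 1.\<close>

lemma zeta_root_inj:
  assumes "0 < \<alpha>" "\<alpha> < 1"
  shows "inj_on (zeta_root b \<alpha>) {1..b - 1}" "1 \<notin> zeta_root b \<alpha> ` {1..b - 1}"
proof -
  have eq: "root_unity b ^ l = zeta_root b \<alpha> l / exp (of_real \<alpha> * (zeta_root b \<alpha> l - 1))" for l
    using zeta_root_equation[OF assms, of b l] by (simp add: field_simps)
  show "inj_on (zeta_root b \<alpha>) {1..b - 1}"
  proof (rule inj_onI)
    fix j l assume "j \<in> {1..b - 1}" "l \<in> {1..b - 1}" "zeta_root b \<alpha> j = zeta_root b \<alpha> l"
    then show "j = l" using eq[of j] eq[of l] root_unity_power_eq_iff[of j b l] by auto
  qed
  show "1 \<notin> zeta_root b \<alpha> ` {1..b - 1}"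
  proof
    assume "1 \<in> zeta_root b \<alpha> ` {1..b - 1}"
    then obtain l where "l \<in> {1..b - 1}" "zeta_root b \<alpha> l = 1" by auto
    then show False using eq[of l] root_unity_power_eq_iff[of l b 0] by fastforce
  qed
qed

text \<open>With s = \<omega>^j r the quotient is the sum of s^(-i) over i < b, and s^c = q^(c div
  b) s^(c mod b). Summing over j kills every term except i = c mod b.\<close>

lemma root_unity_filter:
  assumes b: "b \<ge> 1" and q: "q \<noteq> 0" "q \<noteq> 1" "r ^ b = q"
  shows "(\<Sum>j<b. (root_unity b ^ j * r) ^ c *
      ((1 - inverse q) / (1 - inverse (root_unity b ^ j) * inverse r))) = of_nat b * q ^ (c div b)"
proof -
  define w where "w = root_unity b"
  define e where "e = c mod b"
  have r: "r \<noteq> 0" using q b by auto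
  have w: "w \<noteq> 0" unfolding w_def root_unity_def by simp
  have wb: "w ^ b = 1" unfolding w_def by (rule root_unity_power_b[OF b])
  have e: "e < b" using b by (simp add: e_def)
  have sb: "(w ^ j * r) ^ b = q" for j
    using q(3) wb by (simp add: power_mult_distrib power_mult[symmetric] mult.commute[of j] power_mult)
  have "(w ^ j * r) ^ c * ((1 - inverse q) / (1 - inverse (w ^ j) * inverse r)) =
      q ^ (c div b) * (\<Sum>i<b. r ^ e / r ^ i * (w ^ e / w ^ i) ^ j)" for j
  proof -
    define s where "s = w ^ j * r"
    have s: "s \<noteq> 0" "s ^ b = q" using w r sb by (auto simp: s_def)
    \<comment> \<open>Since s^b = q is not 1, no denominator vanishes.\<close>
    then have "inverse s \<noteq> 1" using q(2) by auto
    then have "(1 - inverse q) / (1 - inverse s) = (\<Sum>i<b. inverse s ^ i)"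
      using geometric_sum[of "inverse s" b] s q(1)
      by (simp add: power_inverse) (metis minus_diff_eq minus_divide_divide)
    moreover have "s ^ c = q ^ (c div b) * s ^ e"
      using s(2) by (metis e_def mult_div_mod_eq power_add power_mult)
    ultimately have "s ^ c * ((1 - inverse q) / (1 - inverse s)) = q ^ (c div b) * (\<Sum>i<b. s ^ e / s ^ i)"
      by (simp add: sum_distrib_left divide_inverse power_inverse mult_ac)
    moreover have "s ^ e / s ^ i = r ^ e / r ^ i * (w ^ e / w ^ i) ^ j" for i
      by (simp add: s_def power_mult_distrib power_divide power_mult[symmetric] mult.commute)
    ultimately show ?thesis by (simp add: s_def)
  qed
  then have "(\<Sum>j<b. (w ^ j * r) ^ c * ((1 - inverse q) / (1 - inverse (w ^ j) * inverse r))) =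
      q ^ (c div b) * (\<Sum>i<b. r ^ e / r ^ i * (\<Sum>j<b. (w ^ e / w ^ i) ^ j))"
    by (simp only: sum_distrib_left[symmetric]) (subst sum.swap, simp only: sum_distrib_left[symmetric])
  also have "(\<Sum>i<b. r ^ e / r ^ i * (\<Sum>j<b. (w ^ e / w ^ i) ^ j)) = (\<Sum>i<b. if i = e then of_nat b else 0)"
  proof (intro sum.cong refl)
    fix i assume "i \<in> {..<b}"
    then have i: "i < b" by simp
    show "r ^ e / r ^ i * (\<Sum>j<b. (w ^ e / w ^ i) ^ j) = (if i = e then of_nat b else 0)"
    proof (cases "i = e")
      case True
      then show ?thesis using w r by simp
    next
      case False
      then have "w ^ e / w ^ i \<noteq> 1"
        using root_unity_power_eq_iff[OF e i] w unfolding w_def by (auto simp: field_simps)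
      moreover have "(w ^ e / w ^ i) ^ b = 1"
        using wb by (simp add: power_divide power_mult[symmetric] mult.commute[of _ b] power_mult)
      ultimately show ?thesis using False geometric_sum[of "w ^ e / w ^ i" b] by simp
    qed
  qed
  also have "\<dots> = of_nat b" using e by simp
  finally show ?thesis by (simp add: w_def mult.commute)
qed

section \<open>The stationary law of the overflow\<close>

lemma indep_var_pair_pmf:
  fixes p q :: "nat pmf"
  shows "prob_space.indep_var (pair_pmf p q) (count_space UNIV) fst (count_space UNIV) snd"
proof -
  have "measure_pmf p = distr (pair_pmf p q) (count_space UNIV) fst"
    by (metis map_fst_pair_pmf map_pmf_rep_eq)
  moreover have "measure_pmf q = distr (pair_pmf p q) (count_space UNIV) snd"
    by (metis map_snd_pair_pmf map_pmf_rep_eq)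
  moreover have "measure_pmf p \<Otimes>\<^sub>M measure_pmf q =
      distr (pair_pmf p q) (count_space UNIV \<Otimes>\<^sub>M count_space UNIV) (\<lambda>x. (fst x, snd x))"
  proof (rule pair_measure_eqI)
    show "sigma_finite_measure (measure_pmf p)" "sigma_finite_measure (measure_pmf q)"
      by (rule measure_pmf.sigma_finite_measure_axioms)+
    show "sets (measure_pmf p \<Otimes>\<^sub>M measure_pmf q) =
        sets (distr (pair_pmf p q) (count_space UNIV \<Otimes>\<^sub>M count_space UNIV) (\<lambda>x. (fst x, snd x)))"
      by (simp add: sets_pair_measure_cong[OF sets_measure_pmf_count_space sets_measure_pmf_count_space])
    fix A B
    have "emeasure (distr (pair_pmf p q) (count_space UNIV \<Otimes>\<^sub>M count_space UNIV) (\<lambda>x. (fst x, snd x))) (A \<times> B) =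
        emeasure (pair_pmf p q) (A \<times> B)"
      by (subst emeasure_distr) (auto simp: pair_measure_countable)
    also have "\<dots> = emeasure (measure_pmf p) A * emeasure (measure_pmf q) B"
      using measure_pmf_prob_product[of A B p q]
      by (simp add: measure_pmf.emeasure_eq_measure ennreal_mult')
    finally show "emeasure (measure_pmf p) A * emeasure (measure_pmf q) B =
        emeasure (distr (pair_pmf p q) (count_space UNIV \<Otimes>\<^sub>M count_space UNIV) (\<lambda>x. (fst x, snd x))) (A \<times> B)" ..
  qed
  ultimately show ?thesis
    by (subst prob_space.indep_var_distribution_eq[OF prob_space_measure_pmf]) (simp add: pair_measure_countable)
qed

lemma pair_pmf_product:
  fixes f g :: "nat \<Rightarrow> complex"
  assumes "integrable (measure_pmf p) f" "integrable (measure_pmf q) g"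
  shows "(\<integral>x. f (fst x) * g (snd x) \<partial>pair_pmf p q) = (\<integral>u. f u \<partial>p) * (\<integral>w. g w \<partial>q)"
    and "integrable (pair_pmf p q) (\<lambda>x. f (fst x) * g (snd x))"
proof -
  have ind: "prob_space.indep_var (pair_pmf p q) borel (f \<circ> fst) borel (g \<circ> snd)"
    by (rule prob_space.indep_var_compose[OF prob_space_measure_pmf indep_var_pair_pmf]) auto
  have f: "integrable (pair_pmf p q) (f \<circ> fst)"
    using assms(1) unfolding comp_def by (subst integrable_map_pmf_eq[symmetric]) (simp add: map_fst_pair_pmf)
  have g: "integrable (pair_pmf p q) (g \<circ> snd)"
    using assms(2) unfolding comp_def by (subst integrable_map_pmf_eq[symmetric]) (simp add: map_snd_pair_pmf)
  show "integrable (pair_pmf p q) (\<lambda>x. f (fst x) * g (snd x))"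
    using prob_space.indep_var_integrable[OF prob_space_measure_pmf ind f g] by simp
  show "(\<integral>x. f (fst x) * g (snd x) \<partial>pair_pmf p q) = (\<integral>u. f u \<partial>p) * (\<integral>w. g w \<partial>q)"
    using prob_space.indep_var_lebesgue_integral[OF prob_space_measure_pmf ind f g] by simp
qed

text \<open>For norm z \<le> 1 the powers are bounded; otherwise the larger exponent dominates the
  smaller.\<close>

lemma pair_pmf_power_integrableD:
  fixes z :: complex
  assumes "integrable (pair_pmf p q) (\<lambda>x. z ^ (fst x + snd x))"
  shows "integrable (measure_pmf p) (\<lambda>v. z ^ v)" "integrable (measure_pmf q) (\<lambda>w. z ^ w)"
proof -
  have "integrable (pair_pmf p q) (\<lambda>x. z ^ f x)" if f: "\<And>x. f x \<le> fst x + snd x" for f :: "nat \<times> nat \<Rightarrow> nat"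
  proof (cases "norm z \<le> 1")
    case True
    then show ?thesis
      by (intro measure_pmf.integrable_const_bound[where B = 1]) (auto simp: norm_power power_le_one)
  next
    case False
    show ?thesis
      using False f by (intro Bochner_Integration.integrable_bound[OF assms]) (auto simp: norm_power intro: power_increasing)
  qed
  from this[of fst] this[of snd] show "integrable (measure_pmf p) (\<lambda>v. z ^ v)" "integrable (measure_pmf q) (\<lambda>w. z ^ w)"
    by (metis (no_types) integrable_map_pmf_eq map_fst_pair_pmf le_add1,
        metis (no_types) integrable_map_pmf_eq map_snd_pair_pmf le_add2)
qed

lemma pair_pmf_power:
  fixes z :: complex
  assumes "integrable (pair_pmf p q) (\<lambda>x. z ^ (fst x + snd x))"
  shows "(\<integral>x. z ^ (fst x + snd x) \<partial>pair_pmf p q) = (\<integral>v. z ^ v \<partial>p) * (\<integral>w. z ^ w \<partial>q)"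
  using pair_pmf_product(1)[OF pair_pmf_power_integrableD[OF assms]] by (simp add: power_add)

lemma integrable_pmf_nat:
  fixes f :: "nat \<Rightarrow> complex"
  assumes "summable (\<lambda>k. pmf p k * norm (f k))"
  shows "integrable (measure_pmf p) f"
proof -
  have "integrable (count_space UNIV) (\<lambda>k. pmf p k *\<^sub>R f k)"
    using assms unfolding integrable_count_space_nat_iff by simp
  then show ?thesis unfolding measure_pmf_eq_density by (subst integrable_density) auto
qed

lemma poisson_pgf_sums:
  assumes "\<mu> > 0"
  shows "(\<lambda>u. of_real (pmf (poisson_pmf \<mu>) u) * z ^ u) sums exp (of_real \<mu> * (z - 1) :: complex)"
proof -
  have "(\<lambda>u. exp (- of_real \<mu>) * ((of_real \<mu> * z) ^ u /\<^sub>R fact u)) sums (exp (- of_real \<mu>) * exp (of_real \<mu> * z))"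
    by (intro sums_mult exp_converges)
  moreover have "exp (- of_real \<mu>) * ((of_real \<mu> * z) ^ u /\<^sub>R fact u) = of_real (pmf (poisson_pmf \<mu>) u) * z ^ u" for u
    using assms by (simp add: scaleR_conv_of_real power_mult_distrib divide_inverse mult_ac flip: exp_of_real)
  moreover have "exp (- of_real \<mu>) * exp (of_real \<mu> * z) = exp (of_real \<mu> * (z - 1) :: complex)"
    by (simp add: exp_add[symmetric] algebra_simps)
  ultimately show ?thesis by simp
qed

lemma poisson_pgf:
  fixes z :: complex
  assumes "\<mu> > 0"
  shows "integrable (measure_pmf (poisson_pmf \<mu>)) (\<lambda>u. z ^ u)"
    and "(\<integral>u. z ^ u \<partial>poisson_pmf \<mu>) = exp (of_real \<mu> * (z - 1))"
proof -
  have "(\<lambda>u. of_real (pmf (poisson_pmf \<mu>) u) * of_real (norm z) ^ u) sums exp (of_real \<mu> * (of_real (norm z) - 1) :: complex)"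
    by (rule poisson_pgf_sums[OF assms])
  from sums_summable[OF sums_Re[OF this]]
  have "summable (\<lambda>u. pmf (poisson_pmf \<mu>) u * norm (z ^ u))"
    by (simp add: norm_power flip: of_real_power of_real_mult)
  then show i: "integrable (measure_pmf (poisson_pmf \<mu>)) (\<lambda>u. z ^ u)"
    by (rule integrable_pmf_nat)
  show "(\<integral>u. z ^ u \<partial>poisson_pmf \<mu>) = exp (of_real \<mu> * (z - 1))"
    using integral_pmf_nat[OF i] poisson_pgf_sums[OF assms, of z]
    by (simp add: scaleR_conv_of_real sums_iff)
qed

text \<open>Summation by parts against the tail probabilities \<open>T\<close> of the Poisson law.\<close>

lemma rank_pgf:
  fixes z :: complex
  assumes \<mu>: "\<mu> > 0" and int: "integrable (measure_pmf (rank_pmf \<mu>)) (\<lambda>v. z ^ v)" and z: "z \<noteq> 1"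
  shows "(\<integral>v. z ^ v \<partial>rank_pmf \<mu>) = (1 - exp (of_real \<mu> * (z - 1))) / (of_real \<mu> * (1 - z))"
proof -
  define T where "T v = measure (poisson_pmf \<mu>) {v<..}" for v
  define p where "p v = complex_of_real (pmf (poisson_pmf \<mu>) v)" for v
  define S where "S = of_real \<mu> * (\<integral>v. z ^ v \<partial>rank_pmf \<mu>)"
  have T_Suc: "T (Suc v) = T v - pmf (poisson_pmf \<mu>) (Suc v)" for v
  proof -
    have "{v<..} = {Suc v<..} \<union> {Suc v}" by auto
    then have "T v = T (Suc v) + pmf (poisson_pmf \<mu>) (Suc v)"
      unfolding T_def measure_pmf_single[symmetric] by (simp only:) (rule measure_pmf.finite_measure_Union, auto)
    then show ?thesis by simp
  qed
  have T_0: "T 0 = 1 - pmf (poisson_pmf \<mu>) 0"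
  proof -
    have "{0<..} = UNIV - {0 :: nat}" by auto
    then show ?thesis
      unfolding T_def measure_pmf_single[symmetric] using measure_pmf.prob_compl[of "{0}" "poisson_pmf \<mu>"] by simp
  qed
  have 1: "(\<lambda>v. of_real (T v) * z ^ v) sums S"
  proof -
    have "(\<lambda>v. of_real \<mu> * (pmf (rank_pmf \<mu>) v *\<^sub>R z ^ v)) sums S"
      unfolding S_def by (intro sums_mult integral_pmf_nat int)
    then show ?thesis using \<mu> by (simp add: pmf_rank_pmf T_def scaleR_conv_of_real)
  qed
  then have 2: "(\<lambda>v. of_real (T (Suc v)) * z ^ Suc v) sums (S - of_real (T 0))"
    using sums_Suc_iff[of "\<lambda>v. of_real (T v) * z ^ v" "S - of_real (T 0)"] by simp
  have 3: "(\<lambda>v. p (Suc v) * z ^ Suc v) sums (exp (of_real \<mu> * (z - 1)) - p 0)"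
    using sums_Suc_iff[of "\<lambda>v. p v * z ^ v" "exp (of_real \<mu> * (z - 1)) - p 0"] poisson_pgf_sums[OF \<mu>, of z]
    by (simp add: p_def)
  have 4: "(\<lambda>v. z * (of_real (T v) * z ^ v) - p (Suc v) * z ^ Suc v) sums (z * S - (exp (of_real \<mu> * (z - 1)) - p 0))"
    by (intro sums_diff sums_mult 1 3)
  \<comment> \<open>By \<open>T_Suc\<close> the shifted tail series is z times the tail series minus
    the shifted Poisson series, which gives a linear equation for S.\<close>
  have "z * (of_real (T v) * z ^ v) - p (Suc v) * z ^ Suc v = of_real (T (Suc v)) * z ^ Suc v" for v
    by (simp add: T_Suc p_def algebra_simps)
  with 4 have "S - of_real (T 0) = z * S - (exp (of_real \<mu> * (z - 1)) - p 0)"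
    using sums_unique2[OF 2] by simp
  then have "S * (1 - z) = 1 - exp (of_real \<mu> * (z - 1))"
    by (simp add: T_0 p_def algebra_simps)
  then show ?thesis using \<mu> z unfolding S_def by (simp add: field_simps)
qed

text \<open>The shifted sequence has the same limit q, and the finite sum in
  \<open>pmf_queue_step\<close> lets the limit pass through \<open>queue_step\<close>.\<close>

lemma queue_limit_stationary:
  assumes "\<And>w. (\<lambda>K. pmf (queue_pmf b \<mu> K) w) \<longlonglongrightarrow> pmf q w"
  shows "queue_step b \<mu> q = q"
proof (rule pmf_eqI)
  fix k
  have "(\<lambda>K. pmf (queue_pmf b \<mu> (Suc K)) k) \<longlonglongrightarrow> pmf q k"
    using assms[of k] by (rule LIMSEQ_Suc)
  moreover have "(\<lambda>K. pmf (queue_pmf b \<mu> (Suc K)) k) \<longlonglongrightarrow> pmf (queue_step b \<mu> q) k"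
    unfolding queue_pmf.simps pmf_queue_step by (intro tendsto_intros assms)
  ultimately show "pmf (queue_step b \<mu> q) k = pmf q k"
    by (rule LIMSEQ_unique[rotated])
qed

definition arrivals_pmf :: "real \<Rightarrow> nat pmf \<Rightarrow> nat pmf" where
  "arrivals_pmf \<mu> q = map_pmf (\<lambda>(u, w). u + w) (pair_pmf (poisson_pmf \<mu>) q)"

text \<open>z^(k - b) z^b equals z^k except for totals k < b, where truncation leaves z^b. Only
  these b values reach the right-hand side, so it is a polynomial in z.\<close>

lemma stationary_pgf_equation:
  fixes z :: complex
  assumes \<mu>: "\<mu> > 0" and stat: "queue_step b \<mu> q = q" and int: "integrable (measure_pmf q) (\<lambda>w. z ^ w)"
  shows "(\<integral>w. z ^ w \<partial>q) * (z ^ b - exp (of_real \<mu> * (z - 1))) =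
    (\<Sum>k<b. of_real (pmf (arrivals_pmf \<mu> q) k) * (z ^ b - z ^ k))"
proof -
  define s where "s = arrivals_pmf \<mu> q"
  have q: "q = map_pmf (\<lambda>k. k - b) s"
    using stat unfolding s_def arrivals_pmf_def queue_step_def map_pmf_comp by (simp add: case_prod_unfold)
  have s_int: "integrable (measure_pmf s) (\<lambda>k. z ^ k)"
    using pair_pmf_product(2)[OF poisson_pgf(1)[OF \<mu>, of z] int]
    unfolding s_def arrivals_pmf_def integrable_map_pmf_eq by (simp add: case_prod_unfold power_add)
  have s_eq: "(\<integral>k. z ^ k \<partial>s) = exp (of_real \<mu> * (z - 1)) * (\<integral>w. z ^ w \<partial>q)"
    using pair_pmf_product(1)[OF poisson_pgf(1)[OF \<mu>, of z] int]
    unfolding s_def arrivals_pmf_def integral_map_pmf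
    by (simp add: case_prod_unfold power_add poisson_pgf(2)[OF \<mu>])
  define d where "d k = (if k < b then z ^ b - z ^ k else 0)" for k
  have d_eq: "(\<integral>k. d k \<partial>s) = (\<Sum>k<b. of_real (pmf s k) * (z ^ b - z ^ k))"
    by (subst integral_measure_pmf[of "{..<b}"]) (auto simp: d_def scaleR_conv_of_real split: if_splits)
  have d_int: "integrable (measure_pmf s) d"
  proof (rule measure_pmf.integrable_const_bound)
    show "AE k in measure_pmf s. norm (d k) \<le> (\<Sum>k<b. norm (z ^ b - z ^ k))"
      by (intro AE_I2) (auto simp: d_def intro!: member_le_sum sum_nonneg)
  qed simp
  have "(\<integral>w. z ^ w \<partial>q) * z ^ b = (\<integral>w. z ^ w * z ^ b \<partial>q)" by simp
  also have "\<dots> = (\<integral>k. z ^ (k - b) * z ^ b \<partial>s)" by (subst q) simp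
  also have "\<dots> = (\<integral>k. z ^ k + d k \<partial>s)"
    by (intro Bochner_Integration.integral_cong refl) (auto simp: d_def simp flip: power_add)
  also have "\<dots> = exp (of_real \<mu> * (z - 1)) * (\<integral>w. z ^ w \<partial>q) + (\<Sum>k<b. of_real (pmf s k) * (z ^ b - z ^ k))"
    using s_int d_int by (simp add: s_eq d_eq)
  finally show ?thesis by (simp add: s_def algebra_simps)
qed

text \<open>The coefficient of degree n, rather than the leading one, allows p to have smaller
  degree. The difference of both sides has degree below n and n roots.\<close>

lemma poly_eq_prod_roots:
  fixes p :: "complex poly"
  assumes "degree p \<le> n" "finite A" "card A = n" "\<And>a. a \<in> A \<Longrightarrow> poly p a = 0"
  shows "p = smult (coeff p n) (\<Prod>a\<in>A. [:- a, 1:])"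
proof -
  define P where "P = (\<Prod>a\<in>A. [:- a, 1:] :: complex poly)"
  define d where "d = p - smult (coeff p n) P"
  have deg: "degree P = n" unfolding P_def using assms(2,3) by (subst degree_prod_eq_sum_degree) auto
  have "lead_coeff P = 1" unfolding P_def by (simp add: lead_coeff_prod)
  then have c: "coeff d n = 0" using deg by (simp add: d_def)
  have "degree d \<le> n" unfolding d_def using assms(1) deg by (intro degree_diff_le) (auto intro: order_trans[OF degree_smult_le])
  have "d = 0"
  proof (rule ccontr)
    assume nz: "d \<noteq> 0"
    then have "degree d \<noteq> n" using c by auto
    then have "degree d < n" using \<open>degree d \<le> n\<close> by simp
    moreover have "A \<subseteq> {x. poly d x = 0}"
      using assms(2,4) by (auto simp: d_def P_def poly_prod intro!: prod_zero)
    then have "n \<le> degree d"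
      using card_mono[OF poly_roots_finite[OF nz], of A] card_poly_roots_bound[OF nz] assms(3) by simp
    ultimately show False by simp
  qed
  then show ?thesis by (simp add: d_def P_def)
qed

lemma stationary_pgf:
  fixes z :: complex
  assumes b: "b \<ge> 1" and \<alpha>: "0 < \<alpha>" "\<alpha> < 1" and stat: "queue_step b (\<alpha> * real b) q = q"
    and int: "integrable (measure_pmf q) (\<lambda>w. z ^ w)"
  shows "(\<integral>w. z ^ w \<partial>q) * (z ^ b - exp (of_real (real b * \<alpha>) * (z - 1))) =
      of_real (real b * (1 - \<alpha>)) * (z - 1) *
      ((\<Prod>l=1..b-1. (z - zeta_root b \<alpha> l)) / (\<Prod>l=1..b-1. (1 - zeta_root b \<alpha> l)))"
proof -
  define \<mu> where "\<mu> = real b * \<alpha>"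
  have \<mu>: "\<mu> > 0" using b \<alpha> by (simp add: \<mu>_def)
  have stat': "queue_step b \<mu> q = q" using stat by (simp add: \<mu>_def mult.commute)
  define p where "p k = complex_of_real (pmf (arrivals_pmf \<mu> q) k)" for k
  define R where "R = (\<Sum>k<b. smult (p k) (monom 1 b - monom 1 k))"
  define A where "A = insert 1 (zeta_root b \<alpha> ` {1..b - 1})"
  have R: "poly R z = (\<Sum>k<b. p k * (z ^ b - z ^ k))" for z
    by (simp add: R_def poly_sum poly_monom)
  have eq: "(\<integral>w. z ^ w \<partial>q) * (z ^ b - exp (of_real \<mu> * (z - 1))) = poly R z"
    if "integrable (measure_pmf q) (\<lambda>w. z ^ w)" for z
    using stationary_pgf_equation[OF \<mu> stat' that] by (simp add: R p_def)
  have bdd: "integrable (measure_pmf q) (\<lambda>w. z ^ w)" if "norm z \<le> 1" for z :: complex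
    using that by (intro measure_pmf.integrable_const_bound[where B = 1]) (auto simp: norm_power power_le_one)
  have "degree R \<le> b"
    unfolding R_def by (intro degree_sum_le) (auto intro!: order_trans[OF degree_smult_le] degree_diff_le simp: degree_monom_le order_trans[OF degree_monom_le])
  moreover have "finite A" "card A = b"
    using zeta_root_inj[OF \<alpha>, of b] b by (auto simp: A_def card_image)
  moreover have "poly R a = 0" if "a \<in> A" for a
  proof -
    have "norm a \<le> 1" "a ^ b = exp (of_real \<mu> * (a - 1))"
      using that zeta_root_norm_le[OF \<alpha>] zeta_root_power[OF \<alpha> b] by (auto simp: A_def \<mu>_def)
    then show ?thesis using eq[OF bdd] by force
  qed
  ultimately have "R = smult (coeff R b) (\<Prod>a\<in>A. [:- a, 1:])"
    by (rule poly_eq_prod_roots)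
  then have "poly R z = coeff R b * (\<Prod>a\<in>A. (z - a))" for z
    by (metis (no_types, lifting) poly_smult poly_prod prod.cong mult_1 add.commute uminus_add_conv_diff poly_pCons poly_0 mult_zero_right add_0_right mult.right_neutral)
  moreover have "(\<Prod>a\<in>A. (z - a)) = (z - 1) * (\<Prod>l=1..b-1. (z - zeta_root b \<alpha> l))" for z
    unfolding A_def using zeta_root_inj[OF \<alpha>, of b] by (subst prod.insert) (auto simp: prod.reindex)
  ultimately have R_prod: "poly R z = coeff R b * ((z - 1) * (\<Prod>l=1..b-1. (z - zeta_root b \<alpha> l)))" for z
    by simp
  define Z where "Z z = (\<Prod>l=1..b-1. (z - zeta_root b \<alpha> l))" for z
  have Z1: "Z 1 \<noteq> 0" using zeta_root_inj(2)[OF \<alpha>, of b] by (auto simp: Z_def)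
  have "coeff R b * Z 1 = of_real (real b - \<mu>)"
  proof -
    \<comment> \<open>These points tend to 1 inside the unit disc without reaching it. There R(z)/(z
      - 1) is compared with the derivative b - \<mu> of z^b - exp(\<mu>(z - 1)) at 1, while
      dominated convergence sends the generating function to 1.\<close>
    define x where "x i = complex_of_real (1 - 1 / real (i + 2))" for i
    define f where "f z = z ^ b - exp (of_real \<mu> * (z - 1))" for z :: complex
    have x_lim: "x \<longlonglongrightarrow> 1"
    proof -
      have "(\<lambda>i. 1 - 1 / real (i + 2)) \<longlonglongrightarrow> 1" by real_asymp
      from tendsto_of_real[OF this] show ?thesis unfolding x_def by (simp only: of_real_1)
    qed
    have x_ne: "x i \<noteq> 1" for i unfolding x_def of_real_eq_1_iff by simp
    have x_norm: "norm (x i) \<le> 1" for i unfolding x_def norm_of_real by (simp add: field_simps)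
    have "(f has_field_derivative (of_nat b - of_real \<mu>)) (at 1)"
      unfolding f_def by (auto intro!: derivative_eq_intros)
    moreover have "f 1 = 0" by (simp add: f_def)
    ultimately have "((\<lambda>z. f z / (z - 1)) \<longlongrightarrow> of_nat b - of_real \<mu>) (at 1)"
      unfolding has_field_derivative_iff by simp
    moreover have "filterlim x (at 1) sequentially"
      unfolding filterlim_at using x_lim x_ne by simp
    ultimately have 1: "(\<lambda>i. f (x i) / (x i - 1)) \<longlonglongrightarrow> of_nat b - of_real \<mu>"
      by (rule filterlim_compose)
    have 2: "(\<lambda>i. (\<integral>w. x i ^ w \<partial>q)) \<longlonglongrightarrow> (\<integral>w. 1 \<partial>measure_pmf q)"
    proof (rule integral_dominated_convergence[where w = "\<lambda>_. 1"])
      show "AE w in measure_pmf q. (\<lambda>i. x i ^ w) \<longlonglongrightarrow> 1"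
        using tendsto_power[OF x_lim] by (intro AE_I2) auto
      show "AE w in measure_pmf q. norm (x i ^ w) \<le> 1" for i
        using x_norm by (intro AE_I2) (auto simp: norm_power power_le_one)
    qed auto
    have "(\<lambda>i. (\<integral>w. x i ^ w \<partial>q) * (f (x i) / (x i - 1))) \<longlonglongrightarrow> of_nat b - of_real \<mu>"
      using tendsto_mult[OF 2 1] by simp
    moreover have "(\<integral>w. x i ^ w \<partial>q) * (f (x i) / (x i - 1)) = coeff R b * Z (x i)" for i
      using eq[OF bdd[OF x_norm[of i]]] x_ne[of i] unfolding R_prod f_def Z_def by (simp add: field_simps)
    moreover have "(\<lambda>i. coeff R b * Z (x i)) \<longlonglongrightarrow> coeff R b * Z 1"
      unfolding Z_def by (intro tendsto_intros x_lim)
    ultimately show ?thesis using LIMSEQ_unique by fastforce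
  qed
  then have "coeff R b = of_real (real b * (1 - \<alpha>)) / Z 1"
    using Z1 by (simp add: \<mu>_def field_simps)
  \<comment> \<open>The coefficient was found inside the disc, but the identity for R holds wherever
    the generating function of q converges.\<close>
  then show ?thesis
    using eq[OF int] unfolding R_prod Z_def \<mu>_def by (simp add: field_simps)
qed

lemma displacement_pgf_formula:
  assumes b: "b \<ge> 1" and \<alpha>: "0 < \<alpha>" "\<alpha> < 1" and stat: "queue_step b (\<alpha> * real b) q = q"
    and int: "integrable (pair_pmf (rank_pmf (\<alpha> * real b)) q) (\<lambda>x. z ^ (fst x + snd x))"
    and nz: "exp (of_real (real b * \<alpha>) * (z - 1)) - z ^ b \<noteq> 0"
  shows "(\<integral>x. z ^ (fst x + snd x) \<partial>pair_pmf (rank_pmf (\<alpha> * real b)) q) =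
           of_real ((1 - \<alpha>) / \<alpha>)
           * ((1 - exp (of_real (real b * \<alpha>) * (z - 1)))
              / (exp (of_real (real b * \<alpha>) * (z - 1)) - z ^ b))
           * ((\<Prod>l=1..b-1. (z - zeta_root b \<alpha> l)) / (\<Prod>l=1..b-1. (1 - zeta_root b \<alpha> l)))"
proof -
  define E where "E = exp (of_real (real b * \<alpha>) * (z - 1))"
  define W where "W = (\<Prod>l=1..b-1. (z - zeta_root b \<alpha> l)) / (\<Prod>l=1..b-1. (1 - zeta_root b \<alpha> l))"
  have z: "z \<noteq> 1" using nz by auto
  note i = pair_pmf_power_integrableD[OF int]
  have "\<alpha> * real b > 0" using b \<alpha> by simp
  from rank_pgf[OF this i(1) z]
  have V: "(\<integral>v. z ^ v \<partial>rank_pmf (\<alpha> * real b)) = (1 - E) / (of_real (real b * \<alpha>) * (1 - z))"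
    by (simp add: E_def mult.commute)
  have nzE: "z ^ b - E \<noteq> 0" using nz by (auto simp: E_def)
  have Q: "(\<integral>w. z ^ w \<partial>q) = of_real (real b * (1 - \<alpha>)) * (z - 1) * W / (z ^ b - E)"
    using stationary_pgf[OF b \<alpha> stat i(2)] nzE unfolding E_def[symmetric] W_def[symmetric] by (simp add: field_simps)
  have "(1 - E) / (of_real (real b * \<alpha>) * (1 - z)) * (of_real (real b * (1 - \<alpha>)) * (z - 1) * W / (z ^ b - E)) =
      of_real ((1 - \<alpha>) / \<alpha>) * ((1 - E) / (E - z ^ b)) * W"
  proof -
    have "z ^ b - E = - (E - z ^ b)" "z - 1 = - (1 - z)" by simp_all
    moreover have "E - z ^ b \<noteq> 0" "1 - z \<noteq> 0" "complex_of_real \<alpha> \<noteq> 0" "complex_of_nat b \<noteq> 0"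
      using nz z \<alpha> b by (auto simp: E_def)
    ultimately show ?thesis by (simp add: divide_simps, simp add: algebra_simps)
  qed
  then show ?thesis
    unfolding pair_pmf_power[OF int] V Q E_def[symmetric] W_def[symmetric] .
qed

section \<open>The infinite Poisson model\<close>

text \<open>From r^(u + w - b) \<le> 1 + r^(u + w)/r^b the moments satisfy E(K + 1) \<le> 1 + \<rho>
  E(K), and 1/(1 - \<rho>) is the fixed point of this bound.\<close>

lemma queue_pmf_moment_le:
  assumes \<mu>: "\<mu> > 0" and r: "r \<ge> 1" "exp ((r - 1) * \<mu>) / r ^ b \<le> \<rho>" "\<rho> < 1"
  shows "(\<integral>\<^sup>+w. ennreal (r ^ w) \<partial>queue_pmf b \<mu> K) \<le> ennreal (1 / (1 - \<rho>))"
proof (induction K)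
  case 0
  have "0 \<le> \<rho>" using r by (auto intro: order_trans[rotated])
  then show ?case using r by (simp add: nn_integral_return_pmf field_simps)
next
  case (Suc K)
  have \<rho>: "0 \<le> \<rho>" using r by (auto intro: order_trans[rotated])
  define q where "q = queue_pmf b \<mu> K"
  have pois: "(\<integral>\<^sup>+u. ennreal (r ^ u) \<partial>poisson_pmf \<mu>) = ennreal (exp ((r - 1) * \<mu>))"
  proof -
    have i: "integrable (poisson_pmf \<mu>) (\<lambda>u. complex_of_real (r ^ u))"
      using poisson_pgf(1)[OF \<mu>, of "of_real r"] by simp
    have i': "integrable (poisson_pmf \<mu>) (\<lambda>u. r ^ u)"
      using integrable_Re[OF i] by (simp del: of_real_power)
    have "complex_of_real (\<integral>u. r ^ u \<partial>poisson_pmf \<mu>) = of_real (exp ((r - 1) * \<mu>))"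
      using poisson_pgf(2)[OF \<mu>, of "of_real r"]
      by (simp add: integral_complex_of_real[symmetric] mult.commute flip: exp_of_real)
    then have "(\<integral>u. r ^ u \<partial>poisson_pmf \<mu>) = exp ((r - 1) * \<mu>)" by (simp only: of_real_eq_iff)
    then show ?thesis using i' r by (simp add: nn_integral_eq_integral)
  qed
  have "(\<integral>\<^sup>+w. ennreal (r ^ w) \<partial>queue_pmf b \<mu> (Suc K)) =
      (\<integral>\<^sup>+u. \<integral>\<^sup>+w. ennreal (r ^ (u + w - b)) \<partial>q \<partial>poisson_pmf \<mu>)"
    by (simp add: queue_step_def nn_integral_pair_pmf' q_def case_prod_unfold)
  also have "\<dots> \<le> (\<integral>\<^sup>+u. \<integral>\<^sup>+w. 1 + ennreal (r ^ u / r ^ b) * ennreal (r ^ w) \<partial>q \<partial>poisson_pmf \<mu>)"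
  proof (intro nn_integral_mono)
    fix u w
    have "r ^ (u + w - b) \<le> 1 + r ^ u / r ^ b * r ^ w"
    proof (cases "b \<le> u + w")
      case True
      then have "r ^ (u + w - b) = r ^ u / r ^ b * r ^ w" using r by (simp add: power_diff power_add)
      then show ?thesis by simp
    qed (use r in simp)
    then have "ennreal (r ^ (u + w - b)) \<le> ennreal (1 + r ^ u / r ^ b * r ^ w)" by (rule ennreal_leI)
    also have "\<dots> = 1 + ennreal (r ^ u / r ^ b) * ennreal (r ^ w)"
      using r by (subst ennreal_plus) (auto simp: ennreal_mult'[symmetric])
    finally show "ennreal (r ^ (u + w - b)) \<le> 1 + ennreal (r ^ u / r ^ b) * ennreal (r ^ w)" .
  qed
  also have "\<dots> = 1 + (\<integral>\<^sup>+u. ennreal (r ^ u / r ^ b) \<partial>poisson_pmf \<mu>) * (\<integral>\<^sup>+w. ennreal (r ^ w) \<partial>q)"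
    by (simp add: nn_integral_add nn_integral_cmult nn_integral_multc measure_pmf.emeasure_space_1)
  also have "(\<integral>\<^sup>+u. ennreal (r ^ u / r ^ b) \<partial>poisson_pmf \<mu>) = ennreal (exp ((r - 1) * \<mu>) / r ^ b)"
  proof -
    have "(\<integral>\<^sup>+u. ennreal (r ^ u / r ^ b) \<partial>poisson_pmf \<mu>) = (\<integral>\<^sup>+u. ennreal (1 / r ^ b) * ennreal (r ^ u) \<partial>poisson_pmf \<mu>)"
      using r by (intro nn_integral_cong) (simp add: ennreal_mult'[symmetric])
    also have "\<dots> = ennreal (1 / r ^ b) * ennreal (exp ((r - 1) * \<mu>))"
      by (simp add: nn_integral_cmult pois)
    finally show ?thesis using r by (simp add: ennreal_mult'[symmetric])
  qed
  also have "1 + ennreal (exp ((r - 1) * \<mu>) / r ^ b) * (\<integral>\<^sup>+w. ennreal (r ^ w) \<partial>q) \<le>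
      1 + ennreal \<rho> * ennreal (1 / (1 - \<rho>))"
    using Suc.IH r(2) unfolding q_def by (intro add_mono mult_mono ennreal_leI) auto
  also have "\<dots> = ennreal (1 + \<rho> * (1 / (1 - \<rho>)))"
    using \<rho> r(3) by (simp add: ennreal_mult'[symmetric] flip: ennreal_1 ennreal_plus)
  also have "1 + \<rho> * (1 / (1 - \<rho>)) = 1 / (1 - \<rho>)" using r(3) by (simp add: field_simps)
  finally show ?case .
qed

section \<open>Laws at finite depth in the Poisson model\<close>

lemma measurable_nat_combine:
  fixes f g :: "'a \<Rightarrow> nat" and h :: "nat \<Rightarrow> nat \<Rightarrow> 'c"
  assumes f: "f \<in> measurable M (count_space UNIV)" and g: "g \<in> measurable M (count_space UNIV)"
  shows "(\<lambda>x. h (f x) (g x)) \<in> measurable M (count_space UNIV)"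
  by (rule measurable_compose_countable[OF _ f], rule measurable_compose_countable[OF _ g]) simp

lemma measurable_lindley:
  assumes "\<And>i. (\<lambda>x. y i x) \<in> measurable M (count_space UNIV)"
  shows "(\<lambda>x. lindley b K (\<lambda>i. y i x)) \<in> measurable M (count_space UNIV)"
  using assms
proof (induction K arbitrary: y)
  case (Suc K)
  show ?case unfolding lindley.simps
    by (rule measurable_nat_combine[where h = "\<lambda>u w. u + w - b"]) (intro Suc.prems Suc.IH)+
qed simp

lemma measurable_lindley_PiM:
  assumes "range t \<subseteq> I"
  shows "(\<lambda>f. lindley b K (\<lambda>i. f (t i))) \<in> measurable (PiM I (\<lambda>_. count_space UNIV)) (count_space UNIV)"
  using assms by (intro measurable_lindley measurable_component_singleton) auto

lemma (in prob_space) distr_pair_pmf: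
  fixes f :: "'a \<Rightarrow> 'i :: countable" and g :: "'a \<Rightarrow> 'j :: countable"
  assumes meas: "f \<in> measurable M (count_space UNIV)" "g \<in> measurable M (count_space UNIV)"
    and eq: "\<And>u w. prob {x \<in> space M. f x = u \<and> g x = w} = pmf p u * pmf q w"
  shows "distr M (count_space UNIV) (\<lambda>x. (f x, g x)) = measure_pmf (pair_pmf p q)"
proof (rule measure_eqI_countable[of _ UNIV])
  have m: "(\<lambda>x. (f x, g x)) \<in> measurable M (count_space UNIV)"
    using measurable_Pair[OF meas] by (simp add: pair_measure_countable)
  fix z :: "'i \<times> 'j"
  obtain u w where z: "z = (u, w)" by fastforce
  have "emeasure (distr M (count_space UNIV) (\<lambda>x. (f x, g x))) {z} =
      emeasure M ((\<lambda>x. (f x, g x)) -` {z} \<inter> space M)"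
    using m by (subst emeasure_distr) auto
  also have "(\<lambda>x. (f x, g x)) -` {z} \<inter> space M = {x \<in> space M. f x = u \<and> g x = w}"
    by (auto simp: z)
  also have "emeasure M \<dots> = ennreal (pmf (pair_pmf p q) z)"
    by (simp add: emeasure_eq_measure eq z pmf_pair)
  finally show "emeasure (distr M (count_space UNIV) (\<lambda>x. (f x, g x))) {z} = emeasure (measure_pmf (pair_pmf p q)) {z}"
    by (simp add: emeasure_pmf_single)
qed auto

lemma (in prob_space) distr_eq_pmfD:
  assumes "f \<in> measurable M (count_space UNIV)" "distr M (count_space UNIV) f = measure_pmf p"
  shows "prob {x \<in> space M. f x = u} = pmf p u"
proof -
  have "pmf p u = measure (distr M (count_space UNIV) f) {u}"
    by (simp add: assms(2) measure_pmf_single)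
  also have "\<dots> = prob {x \<in> space M. f x = u}"
    using assms(1) by (subst measure_distr) (auto intro!: arg_cong[of _ _ prob])
  finally show ?thesis ..
qed

lemma distr_map_pmf:
  assumes f: "f \<in> measurable M (count_space UNIV)" and "distr M (count_space UNIV) f = measure_pmf p"
  shows "distr M (count_space UNIV) (\<lambda>x. g (f x)) = measure_pmf (map_pmf g p)"
proof -
  have "distr M (count_space UNIV) (\<lambda>x. g (f x)) = distr (distr M (count_space UNIV) f) (count_space UNIV) g"
    using f by (subst distr_distr) (auto simp: comp_def)
  then show ?thesis by (simp add: assms(2) map_pmf_rep_eq)
qed

text \<open>Claimed for every t, because one step of the recursion moves t to t - 1. Bucket t + 1 is
  independent of all buckets up to t.\<close>

lemma (in prob_space) poisson_lindley_law:
  fixes X :: "int \<Rightarrow> 'a \<Rightarrow> nat"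
  assumes iid: "iid_poisson M \<mu> X"
  shows "distr M (count_space UNIV) (\<lambda>x. lindley b K (\<lambda>i. X (t - int i) x)) = measure_pmf (queue_pmf b \<mu> K)"
    and "distr M (count_space UNIV) (\<lambda>x. (X (t + 1) x, lindley b K (\<lambda>i. X (t - int i) x))) =
      measure_pmf (pair_pmf (poisson_pmf \<mu>) (queue_pmf b \<mu> K))"
proof -
  have ind: "indep_vars (\<lambda>_. count_space UNIV) X UNIV"
    and pois: "distr M (count_space UNIV) (X i) = measure_pmf (poisson_pmf \<mu>)" for i
    using iid unfolding iid_poisson_def by auto
  have X: "X i \<in> measurable M (count_space UNIV)" for i
    using ind by (auto simp: indep_vars_def)
  have mL: "(\<lambda>x. lindley b K (\<lambda>i. X (t - int i) x)) \<in> measurable M (count_space UNIV)" for K t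
    by (intro measurable_lindley X)
  \<comment> \<open>Conditional on the law at depth K, so that the induction for \<open>law\<close>
    can use it in its step.\<close>
  have joint: "distr M (count_space UNIV) (\<lambda>x. (X (t + 1) x, lindley b K (\<lambda>i. X (t - int i) x))) =
      measure_pmf (pair_pmf (poisson_pmf \<mu>) (queue_pmf b \<mu> K))"
    if law: "distr M (count_space UNIV) (\<lambda>x. lindley b K (\<lambda>i. X (t - int i) x)) = measure_pmf (queue_pmf b \<mu> K)" for K t
  proof (rule distr_pair_pmf[OF X mL])
    fix u w
    have "indep_var (PiM {t + 1} (\<lambda>_. count_space UNIV)) (\<lambda>x. restrict (\<lambda>i. X i x) {t + 1})
        (PiM {..t} (\<lambda>_. count_space UNIV)) (\<lambda>x. restrict (\<lambda>i. X i x) {..t})"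
      by (rule indep_var_restrict[OF ind]) auto
    then have "indep_var (count_space UNIV) ((\<lambda>f. f (t + 1)) \<circ> (\<lambda>x. restrict (\<lambda>i. X i x) {t + 1}))
        (count_space UNIV) ((\<lambda>f. lindley b K (\<lambda>i. f (t - int i))) \<circ> (\<lambda>x. restrict (\<lambda>i. X i x) {..t}))"
      by (rule indep_var_compose) (auto intro!: measurable_component_singleton measurable_lindley_PiM)
    then have iv: "indep_var (count_space UNIV) (X (t + 1))
        (count_space UNIV) (\<lambda>x. lindley b K (\<lambda>i. X (t - int i) x))"
      by (simp add: comp_def)
    have "prob {x \<in> space M. X (t + 1) x = u \<and> lindley b K (\<lambda>i. X (t - int i) x) = w} =
        prob (X (t + 1) -` {u} \<inter> space M) * prob ((\<lambda>x. lindley b K (\<lambda>i. X (t - int i) x)) -` {w} \<inter> space M)"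
      using indep_varD[OF iv, of "{u}" "{w}"] by (auto simp: vimage_def Int_def conj_ac cong: conj_cong)
    also have "\<dots> = pmf (poisson_pmf \<mu>) u * pmf (queue_pmf b \<mu> K) w"
      using distr_eq_pmfD[OF X pois, of "t + 1" u] distr_eq_pmfD[OF mL law, of w]
      by (simp add: vimage_def Int_def conj_ac)
    finally show "prob {x \<in> space M. X (t + 1) x = u \<and> lindley b K (\<lambda>i. X (t - int i) x) = w} =
        pmf (poisson_pmf \<mu>) u * pmf (queue_pmf b \<mu> K) w" .
  qed
  have law: "distr M (count_space UNIV) (\<lambda>x. lindley b K (\<lambda>i. X (t - int i) x)) = measure_pmf (queue_pmf b \<mu> K)" for K t
  proof (induction K arbitrary: t)
    case 0
    have "distr M (count_space UNIV) (\<lambda>x. 0 :: nat) = measure_pmf (return_pmf 0)"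
      by (simp add: distr_const return_pmf.rep_eq)
    then show ?case by simp
  next
    case (Suc K)
    have "distr M (count_space UNIV) (\<lambda>x. (X t x, lindley b K (\<lambda>i. X (t - 1 - int i) x))) =
        measure_pmf (pair_pmf (poisson_pmf \<mu>) (queue_pmf b \<mu> K))"
      using joint[OF Suc.IH, of "t - 1"] by simp
    moreover have "(\<lambda>x. (X t x, lindley b K (\<lambda>i. X (t - 1 - int i) x))) \<in> measurable M (count_space UNIV)"
      using measurable_Pair[OF X mL] by (simp add: pair_measure_countable)
    ultimately have "distr M (count_space UNIV) (\<lambda>x. (\<lambda>(u, w). u + w - b) (X t x, lindley b K (\<lambda>i. X (t - 1 - int i) x))) =
        measure_pmf (queue_pmf b \<mu> (Suc K))"
      unfolding queue_pmf.simps queue_step_def by (intro distr_map_pmf)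
    then show ?case by (simp add: algebra_simps)
  qed
  show "distr M (count_space UNIV) (\<lambda>x. lindley b K (\<lambda>i. X (t - int i) x)) = measure_pmf (queue_pmf b \<mu> K)"
    by (rule law)
  show "distr M (count_space UNIV) (\<lambda>x. (X (t + 1) x, lindley b K (\<lambda>i. X (t - int i) x))) =
      measure_pmf (pair_pmf (poisson_pmf \<mu>) (queue_pmf b \<mu> K))"
    by (rule joint[OF law])
qed

text \<open>The count is kept beside the rank because V is independent of the other buckets only
  conditionally on X_0; it is projected away later.\<close>

definition count_rank_pmf :: "real \<Rightarrow> (nat \<times> nat) pmf" where
  "count_rank_pmf \<mu> = bind_pmf (poisson_pmf \<mu>) (\<lambda>u. map_pmf (Pair u) (pmf_of_set {..u}))"

lemma pmf_count_rank: "pmf (count_rank_pmf \<mu>) (u, v) = pmf (poisson_pmf \<mu>) u * pmf (pmf_of_set {..u}) v"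
proof -
  have "pmf (map_pmf (Pair u') (pmf_of_set {..u'})) (u, v) = indicator {u} u' * pmf (pmf_of_set {..u}) v" for u'
  proof (cases "u' = u")
    case True
    then show ?thesis using pmf_map_inj'[of "Pair u" "pmf_of_set {..u}" v] by (simp add: inj_def)
  next
    case False
    then show ?thesis by (simp, intro pmf_eq_0_set_pmf[THEN iffD2]) auto
  qed
  then show ?thesis
    unfolding count_rank_pmf_def pmf_bind by (simp add: measure_pmf_single)
qed

lemma map_snd_count_rank: "map_pmf snd (count_rank_pmf \<mu>) = rank_pmf \<mu>"
  by (simp add: count_rank_pmf_def rank_pmf_def map_bind_pmf pmf.map_comp comp_def)

text \<open>Given X_0 the rank is independent of the overflow W, and X_0 itself is independent of W;
  together the pair (X_0, V) is independent of W.\<close>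

lemma (in prob_space) rank_lindley_law:
  fixes X :: "int \<Rightarrow> 'a \<Rightarrow> nat"
  assumes \<mu>: "\<mu> > 0" and iid: "iid_poisson M \<mu> X" and rank: "cond_uniform_rank M X V"
  shows "distr M (count_space UNIV) (\<lambda>x. (V x, lindley b K (\<lambda>i. X (-1 - int i) x))) =
    measure_pmf (pair_pmf (rank_pmf \<mu>) (queue_pmf b \<mu> K))"
proof -
  define W where "W x = lindley b K (\<lambda>i. X (-1 - int i) x)" for x
  have ind: "indep_vars (\<lambda>_. count_space UNIV) X UNIV"
    and pois: "distr M (count_space UNIV) (X i) = measure_pmf (poisson_pmf \<mu>)" for i
    using iid unfolding iid_poisson_def by auto
  have X: "X i \<in> measurable M (count_space UNIV)" for i
    using ind by (auto simp: indep_vars_def)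
  have V: "V \<in> measurable M (count_space UNIV)" using rank by (simp add: cond_uniform_rank_def)
  have W: "W \<in> measurable M (count_space UNIV)" unfolding W_def by (intro measurable_lindley X)
  have X0: "prob {x \<in> space M. X 0 x = u} = pmf (poisson_pmf \<mu>) u" for u
    by (rule distr_eq_pmfD[OF X pois])
  have X0pos: "pmf (poisson_pmf \<mu>) u > 0" for u using \<mu> by simp
  have XW: "prob {x \<in> space M. X 0 x = u \<and> W x = w} = pmf (poisson_pmf \<mu>) u * pmf (queue_pmf b \<mu> K) w" for u w
  proof -
    have "prob {x \<in> space M. (X 0 x, W x) = (u, w)} = pmf (pair_pmf (poisson_pmf \<mu>) (queue_pmf b \<mu> K)) (u, w)"
      using poisson_lindley_law(2)[OF iid, of "-1" b K] measurable_Pair[OF X W]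
      by (intro distr_eq_pmfD) (simp_all add: W_def pair_measure_countable)
    then show ?thesis by (simp add: pmf_pair)
  qed
  have joint: "prob {x \<in> space M. (X 0 x, V x) = z \<and> W x = w} = pmf (count_rank_pmf \<mu>) z * pmf (queue_pmf b \<mu> K) w" for z w
  proof -
    obtain u v where z: "z = (u, v)" by fastforce
    \<comment> \<open>W reads only the buckets -1, -2, ..., so W = w is an event of the variables
      X_j with j \<noteq> 0, as the hypothesis on V demands.\<close>
    define B where "B = {f \<in> space (PiM (- {0}) (\<lambda>_. count_space UNIV)). lindley b K (\<lambda>i. f (-1 - int i)) = w}"
    have "B \<in> sets (PiM (- {0}) (\<lambda>_. count_space UNIV))"
    proof -
      have "(\<lambda>f. lindley b K (\<lambda>i. f (-1 - int i))) -` {w} \<inter> space (PiM (- {0}) (\<lambda>_. count_space UNIV))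
          \<in> sets (PiM (- {0}) (\<lambda>_. count_space UNIV))"
        by (rule measurable_sets[OF measurable_lindley_PiM]) auto
      then show ?thesis unfolding B_def by (simp add: vimage_def Int_def conj_ac)
    qed
    then have cond: "\<P>(x in M. V x = v \<and> (\<lambda>j\<in>- {0}. X j x) \<in> B \<bar> X 0 x = u) =
        \<P>(x in M. V x = v \<bar> X 0 x = u) * \<P>(x in M. (\<lambda>j\<in>- {0}. X j x) \<in> B \<bar> X 0 x = u)"
      using rank unfolding cond_uniform_rank_def by blast
    have unif: "\<P>(x in M. V x = v \<bar> X 0 x = u) = pmf (pmf_of_set {..u}) v"
      using rank unfolding cond_uniform_rank_def by (simp add: indicator_def add.commute)
    have inB: "(\<lambda>j\<in>- {0}. X j x) \<in> B \<longleftrightarrow> W x = w" for x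
      unfolding B_def W_def by (simp add: space_PiM)
    have "prob {x \<in> space M. (V x = v \<and> W x = w) \<and> X 0 x = u} =
        pmf (pmf_of_set {..u}) v * prob {x \<in> space M. W x = w \<and> X 0 x = u}"
      using cond X0pos[of u] unfolding inB unif unfolding cond_prob_def X0 by (simp del: pmf_poisson pmf_of_set)
    also have "prob {x \<in> space M. W x = w \<and> X 0 x = u} = pmf (poisson_pmf \<mu>) u * pmf (queue_pmf b \<mu> K) w"
      using XW[of u w] by (simp add: conj_commute)
    finally show ?thesis
      unfolding z pmf_count_rank by (simp add: conj_ac mult_ac del: pmf_poisson pmf_of_set)
  qed
  have XV: "(\<lambda>x. (X 0 x, V x)) \<in> measurable M (count_space UNIV)"
    using measurable_Pair[OF X V] by (simp add: pair_measure_countable)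
  have "distr M (count_space UNIV) (\<lambda>x. ((X 0 x, V x), W x)) = measure_pmf (pair_pmf (count_rank_pmf \<mu>) (queue_pmf b \<mu> K))"
    by (rule distr_pair_pmf[OF XV W joint])
  moreover have "(\<lambda>x. ((X 0 x, V x), W x)) \<in> measurable M (count_space UNIV)"
    using measurable_Pair[OF XV W] by (simp add: pair_measure_countable)
  ultimately have "distr M (count_space UNIV) (\<lambda>x. (\<lambda>(z, w). (snd z, w)) ((X 0 x, V x), W x)) =
      measure_pmf (map_pmf (\<lambda>(z, w). (snd z, w)) (pair_pmf (count_rank_pmf \<mu>) (queue_pmf b \<mu> K)))"
    by (intro distr_map_pmf)
  also have "map_pmf (\<lambda>(z, w). (snd z, w)) (pair_pmf (count_rank_pmf \<mu>) (queue_pmf b \<mu> K)) =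
      pair_pmf (rank_pmf \<mu>) (queue_pmf b \<mu> K)"
    using map_pair[of snd id "count_rank_pmf \<mu>" "queue_pmf b \<mu> K"] by (simp add: map_snd_count_rank)
  finally show ?thesis by (simp add: W_def)
qed

section \<open>The maximum over all earlier buckets\<close>

lemma excess_eq_sum:
  "excess b X x (-1 - int j) = (\<Sum>i<j. int (X (-1 - int i) x) - int b)"
  unfolding excess_def
  by (rule sum.reindex_bij_witness[of _ "\<lambda>i. -1 - int i" "\<lambda>k. nat (-1 - k)"]) auto

definition ult_const :: "(nat \<Rightarrow> nat) \<Rightarrow> nat \<Rightarrow> bool" where
  "ult_const f N \<longleftrightarrow> (\<forall>K\<ge>N. f K = f N)"

lemma mono_bounded_ult_const:
  fixes f :: "nat \<Rightarrow> nat"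
  assumes "mono f" "\<And>K. f K \<le> c"
  shows "\<exists>N. ult_const f N"
proof -
  have "finite (range f)" using assms(2) by (auto intro: finite_subset[of _ "{..c}"])
  then have "Max (range f) \<in> range f" by (intro Max_in) auto
  then obtain N where N: "f N = Max (range f)" by (metis rangeE)
  have "f K = f N" if "K \<ge> N" for K
    using monoD[OF assms(1) that] Max_ge[OF \<open>finite (range f)\<close>, of "f K"] N by simp
  then show ?thesis unfolding ult_const_def by blast
qed

text \<open>No candidate exceeds the stable value, and that value is attained by some j, so the
  supremum is a maximum.\<close>

lemma Q_inf_ult_const:
  fixes X :: "int \<Rightarrow> 'a \<Rightarrow> nat" and b :: nat
  defines "w x K \<equiv> lindley b K (\<lambda>i. X (-1 - int i) x)"
  assumes "ult_const (w x) N"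
  shows "\<exists>j\<le>-1. \<forall>i\<le>-1. excess b X x i \<le> excess b X x j" "Q_inf b X x = w x N"
proof -
  obtain j where j: "int (w x N) = excess b X x (-1 - int j)"
    using lindley_attained[of N b "\<lambda>i. X (-1 - int i) x"] by (auto simp: excess_eq_sum w_def)
  have le: "excess b X x i \<le> int (w x N)" if i: "i \<le> -1" for i
  proof -
    define k where "k = nat (-1 - i)"
    have "excess b X x i = (\<Sum>i<k. int (X (-1 - int i) x) - int b)"
      using i by (simp add: k_def flip: excess_eq_sum)
    also have "\<dots> \<le> int (w x (max k N))"
      unfolding w_def by (rule lindley_partial_sum_le) simp
    also have "\<dots> = int (w x N)"
      using assms(2)[unfolded ult_const_def, rule_format, of "max k N"] by simp
    finally show ?thesis .
  qed
  show "\<exists>j\<le>-1. \<forall>i\<le>-1. excess b X x i \<le> excess b X x j"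
    using j le by (intro exI[of _ "-1 - int j"]) auto
  have "Sup (excess b X x ` {..-1}) = int (w x N)"
    using le j by (intro cSup_eq_maximum) (auto intro!: image_eqI[of _ _ "-1 - int j"])
  then show "Q_inf b X x = w x N" unfolding Q_inf_def by simp
qed

text \<open>The supremum of an unbounded set of integers is one fixed, unspecified number, so \<open>Q_inf\<close> is
  measurable everywhere and not only up to a null set.\<close>

lemma Q_inf_eq:
  fixes X :: "int \<Rightarrow> 'a \<Rightarrow> nat" and b :: nat
  defines "w x K \<equiv> lindley b K (\<lambda>i. X (-1 - int i) x)"
  shows "Q_inf b X x = (if \<exists>N. ult_const (w x) N then w x (LEAST N. ult_const (w x) N)
     else nat (THE z. False))"
proof (cases "\<exists>N. ult_const (w x) N")
  case True
  have w_eq: "w x = (\<lambda>K. lindley b K (\<lambda>i. X (-1 - int i) x))" by (simp add: fun_eq_iff w_def)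
  have "ult_const (w x) (LEAST N. ult_const (w x) N)" using True by (rule LeastI_ex)
  from Q_inf_ult_const(2)[where b = b and X = X and x = x, OF this[unfolded w_eq]] True show ?thesis
    by (simp only: w_eq if_True)
next
  case False
  have "mono (w x)" unfolding w_def by (intro monoI lindley_mono)
  then have unb: "\<exists>K. w x K > c" for c
    using mono_bounded_ult_const[of "w x" c] False by (meson not_le)
  \<comment> \<open>\<open>Sup\<close> on integers is a \<open>THE\<close> over maximal elements;
    for unbounded excess its predicate is constantly false, so every such x gets the same
    unspecified value.\<close>
  have "\<not> (z \<in> excess b X x ` {..-1} \<and> (\<forall>y\<in>excess b X x ` {..-1}. y \<le> z))" for z
  proof
    assume z: "z \<in> excess b X x ` {..-1} \<and> (\<forall>y\<in>excess b X x ` {..-1}. y \<le> z)"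
    obtain K where K: "w x K > nat z" using unb by blast
    obtain j where j: "int (w x K) = excess b X x (-1 - int j)"
      using lindley_attained[of K b "\<lambda>i. X (-1 - int i) x"] by (auto simp: excess_eq_sum w_def)
    have "excess b X x (-1 - int j) \<le> z" using z by auto
    then show False using j K by linarith
  qed
  then have "(THE z. z \<in> excess b X x ` {..-1} \<and> (\<forall>y\<in>excess b X x ` {..-1}. y \<le> z)) = (THE z. False)"
    by (intro arg_cong[of _ _ The] ext) blast
  then show ?thesis using False unfolding Q_inf_def Sup_int_def by simp
qed

lemma measurable_Q_inf:
  assumes X: "\<And>i. X i \<in> measurable M (count_space UNIV)"
  shows "Q_inf b X \<in> measurable M (count_space UNIV)"
proof -
  define w where "w x K = lindley b K (\<lambda>i. X (-1 - int i) x)" for x K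
  have "(\<lambda>x. w x K) \<in> measurable M (count_space UNIV)" for K
    unfolding w_def by (intro measurable_lindley X)
  note w = this
  have ult: "Measurable.pred M (\<lambda>x. ult_const (w x) N)" for N
  proof -
    have "Measurable.pred M (\<lambda>x. w x K = w x N)" for K
      by (rule measurable_nat_combine[OF w w])
    then show ?thesis unfolding ult_const_def
      by (intro pred_intros_countable pred_intros_imp')
  qed
  have least: "(\<lambda>x. LEAST N. ult_const (w x) N) \<in> measurable M (count_space UNIV)"
    by (rule measurable_Least) (rule ult)
  have "(\<lambda>x. w x (LEAST N. ult_const (w x) N)) \<in> measurable M (count_space UNIV)"
    by (rule measurable_compose_countable[where f = "\<lambda>N x. w x N", OF w least])
  moreover have "Measurable.pred M (\<lambda>x. \<exists>N. ult_const (w x) N)"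
    by (intro pred_intros_countable ult)
  ultimately have "(\<lambda>x. if \<exists>N. ult_const (w x) N then w x (LEAST N. ult_const (w x) N) else nat (THE z. False))
      \<in> measurable M (count_space UNIV)"
    by (intro measurable_If) (auto simp: pred_def)
  moreover have "Q_inf b X = (\<lambda>x. if \<exists>N. ult_const (w x) N then w x (LEAST N. ult_const (w x) N) else nat (THE z. False))"
    unfolding w_def by (rule ext) (rule Q_inf_eq)
  ultimately show ?thesis by simp
qed

text \<open>Monotone convergence turns the moment bound, uniform in the depth, into an integrable
  supremum. It is almost surely finite, and a bounded nondecreasing sequence of naturals becomes
  constant.\<close>

lemma (in prob_space) AE_lindley_ult_const:
  fixes X :: "int \<Rightarrow> 'a \<Rightarrow> nat"
  assumes \<mu>: "\<mu> > 0" and iid: "iid_poisson M \<mu> X" and r: "r > 1" "exp ((r - 1) * \<mu>) < r ^ b"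
  shows "AE x in M. \<exists>N. ult_const (\<lambda>K. lindley b K (\<lambda>i. X (-1 - int i) x)) N"
proof -
  have X: "X i \<in> measurable M (count_space UNIV)" for i
    using iid by (auto simp: iid_poisson_def indep_vars_def)
  define w where "w x K = lindley b K (\<lambda>i. X (-1 - int i) x)" for x K
  have w[measurable]: "(\<lambda>x. w x K) \<in> measurable M (count_space UNIV)" for K
    unfolding w_def by (intro measurable_lindley X)
  define \<rho> where "\<rho> = exp ((r - 1) * \<mu>) / r ^ b"
  have \<rho>: "\<rho> < 1" using r by (simp add: \<rho>_def)
  have [measurable]: "(\<lambda>x. ennreal (r ^ w x K)) \<in> borel_measurable M" for K
    by (rule measurable_compose[OF w]) simp
  have le: "(\<integral>\<^sup>+x. ennreal (r ^ w x K) \<partial>M) \<le> ennreal (1 / (1 - \<rho>))" for K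
  proof -
    have "(\<integral>\<^sup>+x. ennreal (r ^ w x K) \<partial>M) = (\<integral>\<^sup>+k. ennreal (r ^ k) \<partial>distr M (count_space UNIV) (\<lambda>x. w x K))"
      by (subst nn_integral_distr) auto
    also have "distr M (count_space UNIV) (\<lambda>x. w x K) = measure_pmf (queue_pmf b \<mu> K)"
      unfolding w_def by (rule poisson_lindley_law(1)[OF iid])
    also have "(\<integral>\<^sup>+k. ennreal (r ^ k) \<partial>queue_pmf b \<mu> K) \<le> ennreal (1 / (1 - \<rho>))"
      using r \<rho> by (intro queue_pmf_moment_le[OF \<mu>]) (auto simp: \<rho>_def)
    finally show ?thesis .
  qed
  have "incseq (\<lambda>K x. ennreal (r ^ w x K))"
    unfolding w_def using r by (intro monoI le_funI ennreal_leI power_increasing lindley_mono) auto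
  then have "(\<integral>\<^sup>+x. (SUP K. ennreal (r ^ w x K)) \<partial>M) = (SUP K. \<integral>\<^sup>+x. ennreal (r ^ w x K) \<partial>M)"
    by (intro nn_integral_monotone_convergence_SUP) auto
  also have "\<dots> \<le> ennreal (1 / (1 - \<rho>))" using le by (intro SUP_least)
  finally have "(\<integral>\<^sup>+x. (SUP K. ennreal (r ^ w x K)) \<partial>M) \<noteq> \<infinity>" by (auto simp: top_unique)
  then have "AE x in M. (SUP K. ennreal (r ^ w x K)) \<noteq> \<infinity>"
    by (intro nn_integral_PInf_AE) auto
  then have "AE x in M. \<exists>N. ult_const (w x) N"
  proof eventually_elim
    case (elim x)
    then obtain c where c: "0 \<le> c" "(SUP K. ennreal (r ^ w x K)) = ennreal c"
      by (cases "(SUP K. ennreal (r ^ w x K))") auto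
    obtain C where C: "c < r ^ C" using real_arch_pow[OF r(1)] by blast
    have "w x K \<le> C" for K
    proof (rule ccontr)
      assume "\<not> w x K \<le> C"
      then have "r ^ C \<le> r ^ w x K" using r by (intro power_increasing) auto
      moreover have "ennreal (r ^ w x K) \<le> ennreal c" unfolding c(2)[symmetric] by (rule SUP_upper) simp
      then have "r ^ w x K \<le> c" using c(1) by (simp add: ennreal_le_iff)
      ultimately show False using C by simp
    qed
    moreover have "mono (w x)" unfolding w_def by (intro monoI lindley_mono)
    ultimately show ?case by (intro mono_bounded_ult_const)
  qed
  then show ?thesis unfolding w_def .
qed

lemma (in prob_space) obtain_pmf:
  fixes f :: "'a \<Rightarrow> 'i :: countable"
  assumes f: "f \<in> measurable M (count_space UNIV)"
  obtains p where "distr M (count_space UNIV) f = measure_pmf p"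
proof -
  define D where "D = distr M (count_space UNIV) f"
  interpret D: prob_space D unfolding D_def by (rule prob_space_distr[OF f])
  have s: "sets D = UNIV" by (simp add: D_def)
  have "AE x in D. measure D {x} \<noteq> 0"
    using D.AE_support_countable[OF s] by (metis AE_I2 UNIV_I uncountable_infinite countableI_type)
  then have "measure_pmf (Abs_pmf D) = D"
    using s D.prob_space_axioms by (intro Abs_pmf_inverse) auto
  then show ?thesis using that[of "Abs_pmf D"] by (simp add: D_def)
qed

text \<open>This produces the q assumed in the limit theorems for the exact model. Almost surely the
  finite-depth values become constant in K, so probabilities converge and the product form passes to
  the limit.\<close>

lemma (in prob_space) poisson_model_law:
  fixes X :: "int \<Rightarrow> 'a \<Rightarrow> nat"
  assumes \<mu>: "\<mu> > 0" and iid: "iid_poisson M \<mu> X" and rank: "cond_uniform_rank M X V"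
    and r: "r > 1" "exp ((r - 1) * \<mu>) < r ^ b"
  obtains q where "\<And>w. (\<lambda>K. pmf (queue_pmf b \<mu> K) w) \<longlonglongrightarrow> pmf q w"
    "(\<lambda>x. (V x, Q_inf b X x)) \<in> measurable M (count_space UNIV)"
    "distr M (count_space UNIV) (\<lambda>x. (V x, Q_inf b X x)) = measure_pmf (pair_pmf (rank_pmf \<mu>) q)"
proof -
  have X: "X i \<in> measurable M (count_space UNIV)" for i
    using iid by (auto simp: iid_poisson_def indep_vars_def)
  have V: "V \<in> measurable M (count_space UNIV)" using rank by (simp add: cond_uniform_rank_def)
  have Q: "Q_inf b X \<in> measurable M (count_space UNIV)" by (rule measurable_Q_inf[OF X])
  define w where "w x K = lindley b K (\<lambda>i. X (-1 - int i) x)" for x K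
  have w: "(\<lambda>x. w x K) \<in> measurable M (count_space UNIV)" for K
    unfolding w_def by (intro measurable_lindley X)
  have VQ: "(\<lambda>x. (V x, Q_inf b X x)) \<in> measurable M (count_space UNIV)"
    using measurable_Pair[OF V Q] by (simp add: pair_measure_countable)
  have Vw: "(\<lambda>x. (V x, w x K)) \<in> measurable M (count_space UNIV)" for K
    using measurable_Pair[OF V w] by (simp add: pair_measure_countable)
  have conv: "(\<lambda>K. prob {x \<in> space M. P (V x, w x K)}) \<longlonglongrightarrow> prob {x \<in> space M. P (V x, Q_inf b X x)}" for P
  proof -
    have mw: "(\<lambda>x. indicat_real {z. P z} (V x, w x K)) \<in> borel_measurable M" for K
      by (rule measurable_compose[OF Vw]) simp
    have mQ: "(\<lambda>x. indicat_real {z. P z} (V x, Q_inf b X x)) \<in> borel_measurable M"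
      by (rule measurable_compose[OF VQ]) simp
    have "(\<lambda>K. \<integral>x. indicat_real {z. P z} (V x, w x K) \<partial>M) \<longlonglongrightarrow> (\<integral>x. indicat_real {z. P z} (V x, Q_inf b X x) \<partial>M)"
    proof (rule integral_dominated_convergence[where w = "\<lambda>_. 1"])
      show "AE x in M. (\<lambda>K. indicat_real {z. P z} (V x, w x K)) \<longlonglongrightarrow> indicat_real {z. P z} (V x, Q_inf b X x)"
        using AE_lindley_ult_const[OF \<mu> iid r]
      proof eventually_elim
        case (elim x)
        then obtain N where N: "ult_const (w x) N" unfolding w_def by blast
        have Qw: "Q_inf b X x = w x N" using Q_inf_ult_const(2)[where b = b and X = X and x = x, OF N[unfolded w_def]] by (simp add: w_def)
        have "eventually (\<lambda>K. indicat_real {z. P z} (V x, w x K) = indicat_real {z. P z} (V x, Q_inf b X x)) sequentially"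
        proof (rule eventually_mono[OF eventually_ge_at_top[of N]])
          fix K assume "N \<le> K"
          then have "w x K = w x N" using N[unfolded ult_const_def] by blast
          then show "indicat_real {z. P z} (V x, w x K) = indicat_real {z. P z} (V x, Q_inf b X x)"
            by (simp only: Qw)
        qed
        then show ?case by (rule tendsto_eventually)
      qed
    qed (rule mQ mw | simp add: indicator_def)+
    moreover have "(\<integral>x. indicat_real {z. P z} (f x) \<partial>M) = prob {x \<in> space M. P (f x)}"
      if f: "f \<in> measurable M (count_space UNIV)" for f :: "'a \<Rightarrow> nat \<times> nat"
    proof -
      have "(\<integral>x. indicat_real {z. P z} (f x) \<partial>M) = (\<integral>x. indicat_real {x \<in> space M. P (f x)} x \<partial>M)"
        by (intro Bochner_Integration.integral_cong) (auto simp: indicator_def)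
      moreover have "{x \<in> space M. P (f x)} = f -` {z. P z} \<inter> space M" by auto
      ultimately show ?thesis by (simp add: Int_commute)
    qed
    ultimately show ?thesis using VQ Vw by simp
  qed
  obtain q where q: "distr M (count_space UNIV) (Q_inf b X) = measure_pmf q"
    using obtain_pmf[OF Q] by blast
  have law: "prob {x \<in> space M. (V x, w x K) = z} = pmf (pair_pmf (rank_pmf \<mu>) (queue_pmf b \<mu> K)) z" for z K
    by (rule distr_eq_pmfD[OF Vw]) (simp add: w_def rank_lindley_law[OF \<mu> iid rank])
  have lim: "(\<lambda>K. pmf (queue_pmf b \<mu> K) k) \<longlonglongrightarrow> pmf q k" for k
  proof -
    have "prob {x \<in> space M. w x K = k} = pmf (queue_pmf b \<mu> K) k" for K
      unfolding w_def by (rule distr_eq_pmfD[OF w[unfolded w_def] poisson_lindley_law(1)[OF iid]])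
    moreover have "prob {x \<in> space M. Q_inf b X x = k} = pmf q k" by (rule distr_eq_pmfD[OF Q q])
    ultimately show ?thesis using conv[of "\<lambda>z. snd z = k"] by simp
  qed
  have "distr M (count_space UNIV) (\<lambda>x. (V x, Q_inf b X x)) = measure_pmf (pair_pmf (rank_pmf \<mu>) q)"
  proof (rule distr_pair_pmf[OF V Q])
    fix v k
    have "(\<lambda>K. prob {x \<in> space M. (V x, w x K) = (v, k)}) \<longlonglongrightarrow> prob {x \<in> space M. (V x, Q_inf b X x) = (v, k)}"
      by (rule conv)
    moreover have "(\<lambda>K. prob {x \<in> space M. (V x, w x K) = (v, k)}) \<longlonglongrightarrow> pmf (rank_pmf \<mu>) v * pmf q k"
      unfolding law pmf_pair by (intro tendsto_intros lim)
    ultimately show "prob {x \<in> space M. V x = v \<and> Q_inf b X x = k} = pmf (rank_pmf \<mu>) v * pmf q k"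
      using LIMSEQ_unique by fastforce
  qed
  then show ?thesis using that lim VQ by blast
qed

section \<open>The theorem\<close>

text \<open>Any r strictly between 1 and 1/\<alpha> works, since (r - 1) \<alpha> < 1 - 1/r \<le> ln
  r.\<close>

lemma exists_radius:
  assumes "0 < \<alpha>" "\<alpha> < 1" "b \<ge> (1 :: nat)"
  obtains r where "r > 1" "exp ((r - 1) * (\<alpha> * real b)) < r ^ b"
proof -
  obtain r where r: "1 < r" "r < 1 / \<alpha>"
    using dense[of 1 "1 / \<alpha>"] assms by auto
  have "(r - 1) * \<alpha> < (r - 1) * (1 / r)"
    using r assms by (intro mult_strict_left_mono) (auto simp: field_simps)
  also have "\<dots> \<le> ln r"
    using ln_le_minus_one[of "1 / r"] r by (simp add: ln_div field_simps)
  finally have "exp ((r - 1) * \<alpha>) < r"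
    using r by (metis exp_less_mono exp_ln less_trans zero_less_one)
  then have "exp ((r - 1) * \<alpha>) ^ b < r ^ b"
    using assms r by (intro power_strict_mono) auto
  moreover have "exp ((r - 1) * \<alpha>) ^ b = exp ((r - 1) * (\<alpha> * real b))"
    by (simp add: exp_of_nat_mult[symmetric] mult_ac)
  ultimately show ?thesis using that r by metis
qed

lemma power_le_exponential:
  fixes s :: real
  assumes "s > 1"
  obtains C where "C > 0" "\<And>t. real t ^ p \<le> C * s ^ t"
proof -
  have "(\<lambda>t. real t ^ p / s ^ t) \<longlonglongrightarrow> 0" using assms by real_asymp
  then have "Bseq (\<lambda>t. real t ^ p / s ^ t)" by (intro convergent_imp_Bseq convergentI)
  then obtain C where C: "C > 0" "\<And>t. norm (real t ^ p / s ^ t) \<le> C" by (auto simp: Bseq_def)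
  have "real t ^ p \<le> C * s ^ t" for t
    using C(2)[of t] assms by (simp add: field_simps)
  then show ?thesis using that C(1) by blast
qed

text \<open>Writing the distribution function as a complex expectation brings convergence in
  distribution under the same uniform limit as the generating functions.\<close>

lemma cdf_distr_nat:
  fixes f :: "'b \<Rightarrow> nat"
  assumes "g \<in> measurable P (count_space UNIV)"
  shows "cdf (distr P borel (\<lambda>w. real (f (g w)))) x =
    Re (\<integral>w. complex_of_real (indicator {..x} (real (f (g w)))) \<partial>P)"
proof -
  have m: "(\<lambda>w. real (f (g w))) \<in> borel_measurable P"
    by (rule measurable_compose[OF assms]) simp
  have "cdf (distr P borel (\<lambda>w. real (f (g w)))) x = measure P ((\<lambda>w. real (f (g w))) -` {..x} \<inter> space P)"
    unfolding cdf_def using m by (subst measure_distr) auto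
  also have "\<dots> = (\<integral>w. indicator ((\<lambda>w. real (f (g w))) -` {..x} \<inter> space P) w \<partial>P)"
    by simp
  also have "\<dots> = (\<integral>w. indicator {..x} (real (f (g w))) \<partial>P)"
    by (intro Bochner_Integration.integral_cong) (auto simp: indicator_def)
  also have "\<dots> = Re (\<integral>w. complex_of_real (indicator {..x} (real (f (g w)))) \<partial>P)"
    unfolding integral_complex_of_real by simp
  finally show ?thesis .
qed

text \<open>Everything observed in the two models is a function of the pair \<open>(V, Q)\<close> that does not exceed
  \<open>V + Q\<close>.\<close>

lemma convergence_of_statistics:
  fixes N :: "nat \<Rightarrow> 'b measure" and Y :: "nat \<Rightarrow> 'b \<Rightarrow> nat \<times> nat" and Z :: "'a \<Rightarrow> nat \<times> nat"
  assumes N: "\<And>k. \<exists>p. N k = measure_pmf p"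
    and Z: "Z \<in> measurable M (count_space UNIV)" "distr M (count_space UNIV) Z = measure_pmf A"
    and s: "s = 1 + \<delta>" "\<delta> > 0"
    and int: "integrable (measure_pmf A) (\<lambda>z. s ^ (fst z + snd z))"
    and unif: "\<And>e. e > 0 \<Longrightarrow> eventually (\<lambda>k. \<forall>G :: nat \<times> nat \<Rightarrow> complex.
       (\<forall>z. norm (G z) \<le> s ^ (fst z + snd z)) \<longrightarrow>
       norm ((\<integral>w. G (Y k w) \<partial>N k) - (\<integral>z. G z \<partial>A)) < e) sequentially"
    and f: "\<And>z. f z \<le> fst z + snd z"
  shows "conv_in_distribution N (\<lambda>k w. f (Y k w)) M (\<lambda>x. f (Z x))"
    and "conv_all_moments N (\<lambda>k w. f (Y k w)) M (\<lambda>x. f (Z x))"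
    and "conv_pgf_uniformly \<delta> N (\<lambda>k w. f (Y k w)) M (\<lambda>x. f (Z x))"
proof -
  have s1: "s > 1" using s by simp
  have sf: "s ^ f z \<le> s ^ (fst z + snd z)" for z
    using f s1 by (intro power_increasing) auto
  have EZ: "(\<integral>x. G (Z x) \<partial>M) = (\<integral>z. G z \<partial>A)" for G :: "nat \<times> nat \<Rightarrow> complex"
    unfolding Z(2)[symmetric] by (rule integral_distr[symmetric]) (use Z(1) in auto)
  have IZ: "integrable M (\<lambda>x. G (Z x))" if "\<And>z. norm (G z) \<le> C * s ^ (fst z + snd z)"
    for G :: "nat \<times> nat \<Rightarrow> complex" and C
  proof -
    have "integrable (measure_pmf A) G"
      using that s1 by (intro Bochner_Integration.integrable_bound[OF integrable_mult_right[OF int, of C]])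
        (auto intro!: AE_I2 order_trans[OF that] abs_ge_self)
    then show ?thesis
      unfolding Z(2)[symmetric] using Z(1) by (subst (asm) integrable_distr_eq) auto
  qed
  have lim: "(\<lambda>k. (\<integral>w. G (Y k w) \<partial>N k)) \<longlonglongrightarrow> (\<integral>x. G (Z x) \<partial>M)"
    if "\<And>z. norm (G z) \<le> s ^ (fst z + snd z)" for G :: "nat \<times> nat \<Rightarrow> complex"
  proof (rule tendstoI)
    fix e :: real assume "e > 0"
    from unif[OF this] show "eventually (\<lambda>k. dist (\<integral>w. G (Y k w) \<partial>N k) (\<integral>x. G (Z x) \<partial>M) < e) sequentially"
      by (rule eventually_mono) (use that in \<open>auto simp: EZ dist_norm\<close>)
  qed
  show "conv_pgf_uniformly \<delta> N (\<lambda>k w. f (Y k w)) M (\<lambda>x. f (Z x))"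
    unfolding conv_pgf_uniformly_def
  proof
    have le: "norm (q ^ f z) \<le> s ^ (fst z + snd z)" if "q \<in> cball 0 (1 + \<delta>)" for q :: complex and z
      using that sf[of z] power_mono[of "norm q" s "f z"] by (auto simp: norm_power s(1))
    show "\<forall>q\<in>cball 0 (1 + \<delta>). pgf_converges M (\<lambda>x. f (Z x)) q"
      unfolding pgf_converges_def using le by (auto intro!: IZ[where C = 1])
    show "uniform_limit (cball 0 (1 + \<delta>)) (\<lambda>k. pgf (N k) (\<lambda>w. f (Y k w))) (pgf M (\<lambda>x. f (Z x))) sequentially"
      unfolding uniform_limit_iff
    proof (intro allI impI)
      fix e :: real assume "e > 0"
      \<comment> \<open>The threshold for k in \<open>unif\<close> precedes the choice of G, so all
        q of the disc are served at once.\<close>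
      from unif[OF this] show "eventually (\<lambda>k. \<forall>q\<in>cball 0 (1 + \<delta>).
          dist (pgf (N k) (\<lambda>w. f (Y k w)) q) (pgf M (\<lambda>x. f (Z x)) q) < e) sequentially"
      proof eventually_elim
        case (elim k)
        show ?case
        proof
          fix q :: complex assume "q \<in> cball 0 (1 + \<delta>)"
          then show "dist (pgf (N k) (\<lambda>w. f (Y k w)) q) (pgf M (\<lambda>x. f (Z x)) q) < e"
            using elim[rule_format, of "\<lambda>z. q ^ f z"] le[of q]
            by (simp add: pgf_def dist_norm EZ[of "\<lambda>z. q ^ f z"])
        qed
      qed
    qed
  qed
  show "conv_all_moments N (\<lambda>k w. f (Y k w)) M (\<lambda>x. f (Z x))"
    unfolding conv_all_moments_def
  proof (intro allI conjI)
    fix p :: nat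
    \<comment> \<open>Powers are bounded only by a multiple of s^t; dividing by C makes
      \<open>lim\<close> applicable.\<close>
    obtain C where C: "C > 0" "\<And>t. real t ^ p \<le> C * s ^ t" using power_le_exponential[OF s1] by blast
    define G where "G z = complex_of_real (real (f z) ^ p)" for z
    have G: "norm (G z) \<le> C * s ^ (fst z + snd z)" for z
      using C(2)[of "f z"] sf[of z] C(1)
      by (auto simp: G_def norm_power intro: order_trans[OF _ mult_left_mono])
    from integrable_Re[OF IZ[OF G]] show "integrable M (\<lambda>x. real (f (Z x)) ^ p)"
      by (simp add: G_def del: of_real_power)
    have "(\<lambda>k. of_real C * (\<integral>w. G (Y k w) / of_real C \<partial>N k)) \<longlonglongrightarrow> of_real C * (\<integral>x. G (Z x) / of_real C \<partial>M)"
      using G C(1) by (intro tendsto_intros lim) (simp add: norm_divide field_simps)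
    then have "(\<lambda>k. (\<integral>w. G (Y k w) \<partial>N k)) \<longlonglongrightarrow> (\<integral>x. G (Z x) \<partial>M)"
      using C(1) by simp
    then show "(\<lambda>k. \<integral>w. real (f (Y k w)) ^ p \<partial>N k) \<longlonglongrightarrow> (\<integral>x. real (f (Z x)) ^ p \<partial>M)"
      unfolding G_def integral_complex_of_real tendsto_of_real_iff .
  qed
  show "conv_in_distribution N (\<lambda>k w. f (Y k w)) M (\<lambda>x. f (Z x))"
    unfolding conv_in_distribution_def weak_conv_m_def weak_conv_def
  proof (intro allI impI)
    fix x :: real
    define G :: "nat \<times> nat \<Rightarrow> complex" where "G z = of_real (indicator {..x} (real (f z)))" for z
    have "norm (G z) \<le> s ^ (fst z + snd z)" for z
      using s1 by (auto simp: G_def indicator_def)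
    from tendsto_Re[OF lim[OF this]]
    have "(\<lambda>k. Re (\<integral>w. G (Y k w) \<partial>N k)) \<longlonglongrightarrow> Re (\<integral>x. G (Z x) \<partial>M)" .
    moreover have "Y k \<in> measurable (N k) (count_space UNIV)" for k
      using N[of k] by auto
    ultimately show "(\<lambda>k. cdf (distr (N k) borel (\<lambda>w. real (f (Y k w)))) x) \<longlonglongrightarrow>
        cdf (distr M borel (\<lambda>x. real (f (Z x)))) x"
      using Z(1) by (simp only: cdf_distr_nat G_def)
  qed
qed

text \<open>The guards on convergence and on q exclude the places where an integral or a quotient
  takes the default value 0, such as the removable singularity at q = 1. The first conjunct makes
  the supremum in \<open>Q_inf\<close> a maximum. \<delta> is chosen before m and n.\<close>

theorem theorem9p3:
  fixes M :: "'a measure" and X :: "int \<Rightarrow> 'a \<Rightarrow> nat" and V :: "'a \<Rightarrow> nat"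
    and b :: nat and \<alpha> :: real
  assumes "b \<ge> 1" and "0 < \<alpha>" and "\<alpha> < 1"
    and "iid_poisson M (\<alpha> * real b) X"
    and "cond_uniform_rank M X V"
  shows "(AE x in M. \<exists>j\<le>-1. \<forall>i\<le>-1. excess b X x i \<le> excess b X x j)
    \<and> (\<forall>q. pgf_converges M V q \<longrightarrow> q \<noteq> 1 \<longrightarrow>
         pgf M V q = (1 - exp (of_real (real b * \<alpha>) * (q - 1))) / (of_real (real b * \<alpha>) * (1 - q)))
    \<and> (\<forall>q. pgf_converges M (C_inf b X V) q \<longrightarrow>
         exp (of_real (real b * \<alpha>) * (q - 1)) - q ^ b \<noteq> 0 \<longrightarrow>
         pgf M (C_inf b X V) q =
           of_real ((1 - \<alpha>) / \<alpha>)
           * ((1 - exp (of_real (real b * \<alpha>) * (q - 1)))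
              / (exp (of_real (real b * \<alpha>) * (q - 1)) - q ^ b))
           * ((\<Prod>l=1..b-1. (q - zeta_root b \<alpha> l)) / (\<Prod>l=1..b-1. (1 - zeta_root b \<alpha> l))))
    \<and> (\<forall>q. pgf_converges M (C_inf b X V) q \<longrightarrow>
         pgf M (C_inf b X V) q = pgf M (Q_inf b X) q * pgf M V q)
    \<and> (\<forall>q r. pgf_converges M (D_inf b X V) q \<longrightarrow> q \<noteq> 0 \<longrightarrow> q \<noteq> 1 \<longrightarrow> r ^ b = q \<longrightarrow>
         pgf M (D_inf b X V) q =
           1 / of_nat b * (\<Sum>j<b. pgf M (C_inf b X V) (root_unity b ^ j * r)
             * ((1 - inverse q) / (1 - inverse (root_unity b ^ j) * inverse r))))
    \<and> (\<exists>\<delta>>0. \<forall>m n :: nat \<Rightarrow> nat.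
         filterlim m at_top sequentially \<longrightarrow> filterlim n at_top sequentially \<longrightarrow>
         (\<lambda>k. real (n k) / (real b * real (m k))) \<longlonglongrightarrow> \<alpha> \<longrightarrow>
         (let N = (\<lambda>k. hash_model (m k) (n k));
              V' = (\<lambda>k. V_exact);
              C' = (\<lambda>k. C_exact b (m k) (n k));
              D' = (\<lambda>k. D_exact b (m k) (n k))
          in conv_in_distribution N V' M V
           \<and> conv_in_distribution N C' M (C_inf b X V)
           \<and> conv_in_distribution N D' M (D_inf b X V)
           \<and> conv_all_moments N V' M V
           \<and> conv_all_moments N C' M (C_inf b X V)
           \<and> conv_all_moments N D' M (D_inf b X V)
           \<and> conv_pgf_uniformly \<delta> N V' M V
           \<and> conv_pgf_uniformly \<delta> N C' M (C_inf b X V)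
           \<and> conv_pgf_uniformly \<delta> N D' M (D_inf b X V)))"
proof -
  interpret prob_space M using assms(4) by (simp add: iid_poisson_def)
  define \<mu> where "\<mu> = \<alpha> * real b"
  have \<mu>: "\<mu> > 0" using assms by (simp add: \<mu>_def)
  have iid: "iid_poisson M \<mu> X" using assms(4) by (simp add: \<mu>_def)
  obtain r where r: "r > 1" "exp ((r - 1) * \<mu>) < r ^ b"
    using exists_radius[OF assms(2,3,1)] unfolding \<mu>_def by blast
  obtain q where lim: "\<And>w. (\<lambda>K. pmf (queue_pmf b \<mu> K) w) \<longlonglongrightarrow> pmf q w"
    and VQ: "(\<lambda>x. (V x, Q_inf b X x)) \<in> measurable M (count_space UNIV)"
    and law: "distr M (count_space UNIV) (\<lambda>x. (V x, Q_inf b X x)) = measure_pmf (pair_pmf (rank_pmf \<mu>) q)"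
    using poisson_model_law[OF \<mu> iid assms(5) r] by blast
  have stat: "queue_step b \<mu> q = q" by (rule queue_limit_stationary[OF lim])
  define A where "A = pair_pmf (rank_pmf \<mu>) q"
  have E: "(\<integral>x. G (V x, Q_inf b X x) \<partial>M) = (\<integral>z. G z \<partial>A)" for G :: "nat \<times> nat \<Rightarrow> complex"
    unfolding A_def law[symmetric] by (rule integral_distr[symmetric]) (use VQ in auto)
  have I: "integrable M (\<lambda>x. G (V x, Q_inf b X x)) \<longleftrightarrow> integrable (measure_pmf A) G" for G :: "nat \<times> nat \<Rightarrow> complex"
    unfolding A_def law[symmetric] by (subst integrable_distr_eq) (use VQ in auto)
  have VA: "pgf M V z = (\<integral>v. z ^ v \<partial>rank_pmf \<mu>)" for z
    using E[of "\<lambda>x. z ^ fst x"] by (simp add: pgf_def A_def)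
  have QA: "pgf M (Q_inf b X) z = (\<integral>w. z ^ w \<partial>q)" for z
    using E[of "\<lambda>x. z ^ snd x"] by (simp add: pgf_def A_def)
  have VI: "pgf_converges M V z \<longleftrightarrow> integrable (measure_pmf (rank_pmf \<mu>)) (\<lambda>v. z ^ v)" for z
    using I[of "\<lambda>x. z ^ fst x"] integrable_map_pmf_eq[of fst A "\<lambda>v. z ^ v"]
    by (simp add: pgf_converges_def A_def map_fst_pair_pmf)
  have CA: "pgf M (C_inf b X V) z = (\<integral>x. z ^ (fst x + snd x) \<partial>A)"
    and CI: "pgf_converges M (C_inf b X V) z \<longleftrightarrow> integrable (measure_pmf A) (\<lambda>x. z ^ (fst x + snd x))" for z
    using E[of "\<lambda>x. z ^ (fst x + snd x)"] I[of "\<lambda>x. z ^ (fst x + snd x)"]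
    by (simp_all add: pgf_def pgf_converges_def C_inf_def add.commute)
  have DA: "pgf M (D_inf b X V) z = (\<integral>x. z ^ ((fst x + snd x) div b) \<partial>A)"
    and DI: "pgf_converges M (D_inf b X V) z \<longleftrightarrow> integrable (measure_pmf A) (\<lambda>x. z ^ ((fst x + snd x) div b))" for z
    using E[of "\<lambda>x. z ^ ((fst x + snd x) div b)"] I[of "\<lambda>x. z ^ ((fst x + snd x) div b)"]
    by (simp_all add: pgf_def pgf_converges_def D_inf_def C_inf_def add.commute)
  have part1: "AE x in M. \<exists>j\<le>-1. \<forall>i\<le>-1. excess b X x i \<le> excess b X x j"
    using AE_lindley_ult_const[OF \<mu> iid r]
  proof eventually_elim
    case (elim x)
    then obtain N where "ult_const (\<lambda>K. lindley b K (\<lambda>i. X (-1 - int i) x)) N" by blast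
    from Q_inf_ult_const(1)[where b = b and X = X and x = x, OF this] show ?case .
  qed
  have part2: "pgf M V z = (1 - exp (of_real (real b * \<alpha>) * (z - 1))) / (of_real (real b * \<alpha>) * (1 - z))"
    if "pgf_converges M V z" "z \<noteq> 1" for z
    using rank_pgf[OF \<mu> _ that(2)] that(1) unfolding VI VA by (simp add: \<mu>_def mult.commute)
  have part3: "pgf M (C_inf b X V) z =
           of_real ((1 - \<alpha>) / \<alpha>)
           * ((1 - exp (of_real (real b * \<alpha>) * (z - 1)))
              / (exp (of_real (real b * \<alpha>) * (z - 1)) - z ^ b))
           * ((\<Prod>l=1..b-1. (z - zeta_root b \<alpha> l)) / (\<Prod>l=1..b-1. (1 - zeta_root b \<alpha> l)))"
    if "pgf_converges M (C_inf b X V) z" "exp (of_real (real b * \<alpha>) * (z - 1)) - z ^ b \<noteq> 0" for z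
    using that unfolding CA CI A_def \<mu>_def
    by (intro displacement_pgf_formula assms stat[unfolded \<mu>_def])
  have part4: "pgf M (C_inf b X V) z = pgf M (Q_inf b X) z * pgf M V z"
    if "pgf_converges M (C_inf b X V) z" for z
    using pair_pmf_power[of "rank_pmf \<mu>" q z] that unfolding CA CI A_def QA VA by (simp add: mult.commute)
  have part5: "pgf M (D_inf b X V) z =
           1 / of_nat b * (\<Sum>j<b. pgf M (C_inf b X V) (root_unity b ^ j * y)
             * ((1 - inverse z) / (1 - inverse (root_unity b ^ j) * inverse y)))"
    if conv: "pgf_converges M (D_inf b X V) z" and z: "z \<noteq> 0" "z \<noteq> 1" "y ^ b = z" for z y
  proof -
    define c where "c x = fst x + snd x" for x :: "nat \<times> nat"
    \<comment> \<open>The sum needs the generating function of C at every b-th root of z, but only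
      that of D is assumed to converge. Writing c = b (c div b) + c mod b leaves a remainder factor
      of at most max(1, norm y)^b.\<close>
    have int: "integrable (measure_pmf A) (\<lambda>x. (root_unity b ^ j * y) ^ c x)" for j
    proof (rule Bochner_Integration.integrable_bound[OF integrable_mult_right[OF conv[unfolded DI]]])
      show "AE x in measure_pmf A. norm ((root_unity b ^ j * y) ^ c x) \<le>
          norm (of_real (max 1 (norm y) ^ b) * z ^ ((fst x + snd x) div b))"
      proof (rule AE_I2)
        fix x
        have "norm ((root_unity b ^ j * y) ^ c x) = norm y ^ c x"
          by (simp only: norm_power[of "root_unity b ^ j * y"] norm_mult norm_root_unity_power mult_1_left)
        also have "\<dots> = norm z ^ (c x div b) * norm y ^ (c x mod b)"
          unfolding z(3)[symmetric] norm_power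
          by (metis mult_div_mod_eq power_add power_mult)
        also have "\<dots> \<le> norm z ^ (c x div b) * max 1 (norm y) ^ b"
        proof (rule mult_left_mono)
          have "norm y ^ (c x mod b) \<le> max 1 (norm y) ^ (c x mod b)" by (intro power_mono) auto
          also have "\<dots> \<le> max 1 (norm y) ^ b"
            using assms(1) by (intro power_increasing) (auto intro: less_imp_le)
          finally show "norm y ^ (c x mod b) \<le> max 1 (norm y) ^ b" .
        qed simp
        also have "\<dots> = norm (of_real (max 1 (norm y) ^ b) * z ^ ((fst x + snd x) div b))"
          by (simp add: norm_mult norm_power c_def mult.commute)
        finally show "norm ((root_unity b ^ j * y) ^ c x) \<le>
            norm (of_real (max 1 (norm y) ^ b) * z ^ ((fst x + snd x) div b))" .
      qed
    qed simp
    have "(\<Sum>j<b. pgf M (C_inf b X V) (root_unity b ^ j * y)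
             * ((1 - inverse z) / (1 - inverse (root_unity b ^ j) * inverse y))) =
        (\<integral>x. (\<Sum>j<b. (root_unity b ^ j * y) ^ c x
             * ((1 - inverse z) / (1 - inverse (root_unity b ^ j) * inverse y))) \<partial>A)"
      unfolding CA c_def[symmetric]
      by (subst Bochner_Integration.integral_sum, rule integrable_mult_left[OF int])
         (simp only: integral_mult_left_zero)
    also have "\<dots> = (\<integral>x. of_nat b * z ^ (c x div b) \<partial>A)"
      by (simp only: root_unity_filter[OF assms(1) z])
    also have "\<dots> = of_nat b * pgf M (D_inf b X V) z"
      unfolding DA by (simp add: c_def)
    finally show ?thesis using assms(1) by simp
  qed
  \<comment> \<open>The strict inequality 1 + \<delta> < r makes powers of 1 + \<delta> negligible
    against the bounded r-moment.\<close>
  define \<delta> where "\<delta> = (r - 1) / 2"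
  have \<delta>: "\<delta> > 0" "1 \<le> 1 + \<delta>" "1 + \<delta> < r" using r by (auto simp: \<delta>_def field_simps)
  have part6: "conv_in_distribution N (\<lambda>k w. f (V_exact w, Q_exact b (m k) (n k) w)) M (\<lambda>x. f (V x, Q_inf b X x)) \<and>
      conv_all_moments N (\<lambda>k w. f (V_exact w, Q_exact b (m k) (n k) w)) M (\<lambda>x. f (V x, Q_inf b X x)) \<and>
      conv_pgf_uniformly \<delta> N (\<lambda>k w. f (V_exact w, Q_exact b (m k) (n k) w)) M (\<lambda>x. f (V x, Q_inf b X x))"
    if mn: "filterlim m at_top sequentially" "filterlim n at_top sequentially"
      "(\<lambda>k. real (n k) / (real b * real (m k))) \<longlonglongrightarrow> \<alpha>"
      and N: "N = (\<lambda>k. hash_model (m k) (n k))" and f: "\<And>z. f z \<le> fst z + snd z" for m n N f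
  proof -
    have "(\<lambda>k. real (n k) / (real b * real (m k)) * real b) \<longlonglongrightarrow> \<alpha> * real b"
      by (intro tendsto_intros mn)
    then have ol: "occ_limit \<mu> m n"
      using mn assms(1) by (simp add: occ_limit_def \<mu>_def)
    obtain B where B: "eventually (\<lambda>k. integrable (exact_pmf b (m k) (n k)) (\<lambda>x. r ^ (fst x + snd x)) \<and>
        (\<integral>x. r ^ (fst x + snd x) \<partial>exact_pmf b (m k) (n k)) \<le> B) sequentially"
      using exact_pmf_limit(2)[OF \<mu> ol r lim] by blast
    have "integrable (measure_pmf A) (\<lambda>x. r ^ (fst x + snd x))"
      unfolding A_def by (rule pmf_fatou(1)[OF exact_pmf_limit(1)[OF \<mu> ol r lim] B]) (use r in simp)
    then have int: "integrable (measure_pmf A) (\<lambda>x. (1 + \<delta>) ^ (fst x + snd x))"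
      by (rule Bochner_Integration.integrable_bound)
         (use \<delta> r in \<open>auto intro!: power_mono simp: power_abs[symmetric]\<close>)
    have Nk: "\<exists>p. N k = measure_pmf p" for k by (auto simp: N hash_model_def)
    have unif: "eventually (\<lambda>k. \<forall>G :: nat \<times> nat \<Rightarrow> complex. (\<forall>z. norm (G z) \<le> (1 + \<delta>) ^ (fst z + snd z)) \<longrightarrow>
       norm ((\<integral>w. G (V_exact w, Q_exact b (m k) (n k) w) \<partial>N k) - (\<integral>z. G z \<partial>A)) < e) sequentially"
      if "e > 0" for e
      unfolding N A_def by (rule exact_limit_uniform[OF \<mu> ol r lim \<delta>(2,3) that])
    show ?thesis
      by (intro conjI convergence_of_statistics[OF Nk VQ law[folded A_def] refl \<delta>(1) int unif f])
  qed
  have VC: "V_exact = (\<lambda>w. fst (V_exact w, Q_exact b m n w))" "V = (\<lambda>x. fst (V x, Q_inf b X x))"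
    "C_exact b m n = (\<lambda>w. (\<lambda>z. fst z + snd z) (V_exact w, Q_exact b m n w))"
    "C_inf b X V = (\<lambda>x. (\<lambda>z. fst z + snd z) (V x, Q_inf b X x))"
    "D_exact b m n = (\<lambda>w. (\<lambda>z. (fst z + snd z) div b) (V_exact w, Q_exact b m n w))"
    "D_inf b X V = (\<lambda>x. (\<lambda>z. (fst z + snd z) div b) (V x, Q_inf b X x))" for m n
    by (simp_all add: fun_eq_iff C_exact_def D_exact_def C_inf_def D_inf_def add.commute)
  have "let N = (\<lambda>k. hash_model (m k) (n k));
              V' = (\<lambda>k. V_exact);
              C' = (\<lambda>k. C_exact b (m k) (n k));
              D' = (\<lambda>k. D_exact b (m k) (n k))
          in conv_in_distribution N V' M V
           \<and> conv_in_distribution N C' M (C_inf b X V)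
           \<and> conv_in_distribution N D' M (D_inf b X V)
           \<and> conv_all_moments N V' M V
           \<and> conv_all_moments N C' M (C_inf b X V)
           \<and> conv_all_moments N D' M (D_inf b X V)
           \<and> conv_pgf_uniformly \<delta> N V' M V
           \<and> conv_pgf_uniformly \<delta> N C' M (C_inf b X V)
           \<and> conv_pgf_uniformly \<delta> N D' M (D_inf b X V)"
    if mn: "filterlim m at_top sequentially" "filterlim n at_top sequentially"
      "(\<lambda>k. real (n k) / (real b * real (m k))) \<longlonglongrightarrow> \<alpha>" for m n
    \<comment> \<open>The three statistics are v, v + w and (v + w) div b, each at most v +
      w.\<close>
    using part6[OF mn refl, of fst] part6[OF mn refl, of "\<lambda>z. fst z + snd z"]
      part6[OF mn refl, of "\<lambda>z. (fst z + snd z) div b"]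
    unfolding Let_def by (simp add: VC(3-6))
  with \<delta>(1) have "\<exists>\<delta>>0. \<forall>m n :: nat \<Rightarrow> nat.
         filterlim m at_top sequentially \<longrightarrow> filterlim n at_top sequentially \<longrightarrow>
         (\<lambda>k. real (n k) / (real b * real (m k))) \<longlonglongrightarrow> \<alpha> \<longrightarrow>
         (let N = (\<lambda>k. hash_model (m k) (n k));
              V' = (\<lambda>k. V_exact);
              C' = (\<lambda>k. C_exact b (m k) (n k));
              D' = (\<lambda>k. D_exact b (m k) (n k))
          in conv_in_distribution N V' M V
           \<and> conv_in_distribution N C' M (C_inf b X V)
           \<and> conv_in_distribution N D' M (D_inf b X V)
           \<and> conv_all_moments N V' M V
           \<and> conv_all_moments N C' M (C_inf b X V)
           \<and> conv_all_moments N D' M (D_inf b X V)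
           \<and> conv_pgf_uniformly \<delta> N V' M V
           \<and> conv_pgf_uniformly \<delta> N C' M (C_inf b X V)
           \<and> conv_pgf_uniformly \<delta> N D' M (D_inf b X V))"
    by blast
  with part1 part2 part3 part4 part5 show ?thesis by blast
qed

end
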